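(* Let $X$ be a finite CW-complex. For each $k\ge 0$ there exists a constant $a_k$ such that for all $k$-bases $T$ of $X$, $$\mathbf P_k(T)=a_k\,t_{k-1}(T)^2 .$$
   Context: Cells are oriented; $\Xi_kX$ is the set of $k$-cells; $\partial_k$ is the cellular boundary map, with matrix of incidence numbers. For $T\subseteq\Xi_kX$, $X_T$ is the subcomplex consisting of $T$ and all cells of $X$ of dimension at most $k-1$. $T$ is a $k$-base of $X$ if it is maximal with $Z_k(X_T;\mathbb C)=0$, i.e., maximal such that the columns of $\partial_k$ indexed by $T$ are linearly independent. $t_{k-1}(T)=|[H_{k-1}(X_T;\mathbb Z)]|$, the order of the torsion subgroup of $H_{k-1}(X_T;\mathbb Z)$ (equal to $1$ when $k=0$). $\mathbf P_k$, the $k$th lower matroidal measure on $X$, is the probability measure on the set of $k$-bases of $X$ given by $\mathbf P_k(T)=\det[Q_k]_{T,T}$, where $Q_k$ is the matrix, in the basis of $k$-cells, of the orthogonal projection of $C_k(X;\mathbb C)$ (with the $k$-cells orthonormal) onto the row space of $\partial_k$, i.e., onto the space of coboundaries $B^k(X;\mathbb C)$, and $[Q_k]_{T,T}$ is the submatrix with rows and columns indexed by $T$. Here $\mathbf P_k(T)$ denotes the probability of the single set $T$. *)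

theory Defs
  imports "HOL-Analysis.Analysis" "HOL-Homology.Homology"
begin

section \<open>Finite CW-complexes\<close>

text \<open>The closed and open unit balls of dimension \<open>n\<close>, in the same concrete model of Euclidean
  space that HOL-Homology uses for \<^const>\<open>nsphere\<close>.  The closed ball minus the open one
  is empty for \<open>n = 0\<close> and is the underlying set of \<open>nsphere (n - 1)\<close> for \<open>n > 0\<close>.\<close>

definition disc :: "nat \<Rightarrow> (nat \<Rightarrow> real) set" where
  "disc n = {x \<in> topspace (Euclidean_space n). (\<Sum>i<n. (x i)\<^sup>2) \<le> 1}"

definition open_disc :: "nat \<Rightarrow> (nat \<Rightarrow> real) set" where
  "open_disc n = {x \<in> topspace (Euclidean_space n). (\<Sum>i<n. (x i)\<^sup>2) < 1}"

text \<open>\<open>cells X k\<close> is an index set for the \<open>k\<close>-cells, so a cell is really a pair \<open>(k, c)\<close> and the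
  same index may occur in several dimensions.  The orientation of a cell is the one transported
  from the standard ball by its characteristic map \<open>char_map X k c\<close>.\<close>

record ('a, 'c) cell_structure =
  space :: "'a topology"
  cells :: "nat \<Rightarrow> 'c set"
  char_map :: "nat \<Rightarrow> 'c \<Rightarrow> (nat \<Rightarrow> real) \<Rightarrow> 'a"

definition open_cell :: "('a, 'c) cell_structure \<Rightarrow> nat \<Rightarrow> 'c \<Rightarrow> 'a set" where
  "open_cell X k c = char_map X k c ` open_disc k"

definition carrier_below :: "('a, 'c) cell_structure \<Rightarrow> nat \<Rightarrow> 'a set" where
  "carrier_below X n = (\<Union>m<n. \<Union>c\<in>cells X m. open_cell X m c)"

text \<open>As there are finitely many cells, closure-finiteness and the weak topology come for free.\<close>

definition finite_CW :: "('a, 'c) cell_structure \<Rightarrow> bool" where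
  "finite_CW X \<longleftrightarrow>
     Hausdorff_space (space X) \<and>
     finite (SIGMA k:UNIV. cells X k) \<and>
     (\<forall>k. \<forall>c\<in>cells X k.
        continuous_map (subtopology (Euclidean_space k) (disc k)) (space X) (char_map X k c) \<and>
        inj_on (char_map X k c) (open_disc k) \<and>
        char_map X k c ` (disc k - open_disc k) \<subseteq> carrier_below X k) \<and>
     disjoint_family_on (\<lambda>(k, c). open_cell X k c) (SIGMA k:UNIV. cells X k) \<and>
     topspace (space X) = (\<Union>k. \<Union>c\<in>cells X k. open_cell X k c)"

text \<open>The subcomplex \<open>X\<^sub>T\<close>, for a set \<open>T\<close> of \<open>k\<close>-cells.\<close>

definition subcomplex :: "('a, 'c) cell_structure \<Rightarrow> nat \<Rightarrow> 'c set \<Rightarrow> ('a, 'c) cell_structure" where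
  "subcomplex X k T = X\<lparr>
     space := subtopology (space X) (carrier_below X k \<union> (\<Union>c\<in>T. open_cell X k c)),
     cells := (\<lambda>j. if j < k then cells X j else if j = k then T else {})\<rparr>"

section \<open>Incidence numbers and cellular chains\<close>

text \<open>\<open>disc_to_sphere m\<close> maps the closed \<open>m\<close>-ball onto the \<open>m\<close>-sphere; it collapses the boundary
  of the ball to the point \<open>base_point m\<close> and is injective on the open ball.\<close>

definition base_point :: "nat \<Rightarrow> nat \<Rightarrow> real" where
  "base_point m = (\<lambda>i. if i = m then -1 else 0)"

definition disc_to_sphere :: "nat \<Rightarrow> (nat \<Rightarrow> real) \<Rightarrow> nat \<Rightarrow> real" where
  "disc_to_sphere m x = (let r2 = \<Sum>i<m. (x i)\<^sup>2 in
     (\<lambda>i. if i < m then 2 * sqrt (1 - r2) * x i else if i = m then 1 - 2 * r2 else 0))"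

text \<open>For an \<open>m\<close>-cell \<open>f\<close>, the projection of the \<open>m\<close>-skeleton onto its quotient by the complement
  of the open cell \<open>f\<close>, this quotient being identified with the \<open>m\<close>-sphere.\<close>

definition pinch :: "('a, 'c) cell_structure \<Rightarrow> nat \<Rightarrow> 'c \<Rightarrow> 'a \<Rightarrow> nat \<Rightarrow> real" where
  "pinch X m f y =
     (if y \<in> open_cell X m f
      then disc_to_sphere m (inv_into (open_disc m) (char_map X m f) y)
      else base_point m)"

text \<open>The incidence number of the \<open>(m+1)\<close>-cell \<open>e\<close> with the \<open>m\<close>-cell \<open>f\<close>: the degree of the
  attaching map of \<open>e\<close> followed by the pinch onto \<open>f\<close>.  The choice of \<^const>\<open>disc_to_sphere\<close>
  fixes a global sign in each dimension; for \<open>m = 0\<close> the boundary of \<open>e\<close> is its endpoint at \<open>1\<close>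
  minus its endpoint at \<open>-1\<close>.\<close>

definition incidence :: "('a, 'c) cell_structure \<Rightarrow> nat \<Rightarrow> 'c \<Rightarrow> 'c \<Rightarrow> int" where
  "incidence X m e f = Brouwer_degree2 m (pinch X m f \<circ> char_map X (Suc m) e)"

definition cell_chains :: "('a, 'c) cell_structure \<Rightarrow> nat \<Rightarrow> ('c \<Rightarrow> 'r::comm_ring_1) set" where
  "cell_chains X k = {c. \<forall>e. e \<notin> cells X k \<longrightarrow> c e = 0}"

text \<open>\<open>cell_boundary X k\<close> is \<open>\<partial>\<^sub>k\<close>; in particular \<open>\<partial>\<^sub>0 = 0\<close> (no augmentation).\<close>

fun cell_boundary :: "('a, 'c) cell_structure \<Rightarrow> nat \<Rightarrow> ('c \<Rightarrow> 'r::comm_ring_1) \<Rightarrow> 'c \<Rightarrow> 'r" where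
  "cell_boundary X 0 c = (\<lambda>_. 0)"
| "cell_boundary X (Suc m) c =
     (\<lambda>f. if f \<in> cells X m then \<Sum>e\<in>cells X (Suc m). of_int (incidence X m e f) * c e else 0)"

definition cell_cycles :: "('a, 'c) cell_structure \<Rightarrow> nat \<Rightarrow> ('c \<Rightarrow> 'r::comm_ring_1) set" where
  "cell_cycles X k = {c \<in> cell_chains X k. cell_boundary X k c = (\<lambda>_. 0)}"

definition cell_boundaries :: "('a, 'c) cell_structure \<Rightarrow> nat \<Rightarrow> ('c \<Rightarrow> 'r::comm_ring_1) set" where
  "cell_boundaries X k = cell_boundary X (Suc k) ` cell_chains X (Suc k)"

section \<open>Integral homology and its torsion\<close>

definition integral_cycle_group :: "('a, 'c) cell_structure \<Rightarrow> nat \<Rightarrow> ('c \<Rightarrow> int) monoid" where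
  "integral_cycle_group X k =
     \<lparr>carrier = cell_cycles X k, mult = (\<lambda>c d e. c e + d e), one = (\<lambda>_. 0)\<rparr>"

definition integral_homology :: "('a, 'c) cell_structure \<Rightarrow> nat \<Rightarrow> ('c \<Rightarrow> int) set monoid" where
  "integral_homology X k = integral_cycle_group X k Mod cell_boundaries X k"

definition torsion_part :: "('g, 'b) monoid_scheme \<Rightarrow> 'g set" where
  "torsion_part G = {x \<in> carrier G. \<exists>n::nat. n > 0 \<and> x [^]\<^bsub>G\<^esub> n = \<one>\<^bsub>G\<^esub>}"

text \<open>\<open>torsion_number X k T\<close> is \<open>t\<^sub>k\<^sub>-\<^sub>1(T)\<close>.\<close>

fun torsion_number :: "('a, 'c) cell_structure \<Rightarrow> nat \<Rightarrow> 'c set \<Rightarrow> nat" where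
  "torsion_number X 0 T = 1"
| "torsion_number X (Suc m) T = card (torsion_part (integral_homology (subcomplex X (Suc m) T) m))"

section \<open>Bases and the lower matroidal measure\<close>

definition acyclic_cells :: "('a, 'c) cell_structure \<Rightarrow> nat \<Rightarrow> 'c set \<Rightarrow> bool" where
  "acyclic_cells X k T \<longleftrightarrow>
     T \<subseteq> cells X k \<and> (cell_cycles (subcomplex X k T) k :: ('c \<Rightarrow> complex) set) = {\<lambda>_. 0}"

definition k_base :: "('a, 'c) cell_structure \<Rightarrow> nat \<Rightarrow> 'c set \<Rightarrow> bool" where
  "k_base X k T \<longleftrightarrow> acyclic_cells X k T \<and> (\<forall>T'. T \<subset> T' \<longrightarrow> \<not> acyclic_cells X k T')"

text \<open>\<open>B\<^sup>k(X; \<complex>)\<close>: the row space of \<open>\<partial>\<^sub>k\<close>, the rows being indexed by the \<open>(k-1)\<close>-cells.\<close>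

fun coboundaries :: "('a, 'c) cell_structure \<Rightarrow> nat \<Rightarrow> ('c \<Rightarrow> complex) set" where
  "coboundaries X 0 = {\<lambda>_. 0}"
| "coboundaries X (Suc m) =
     {(\<lambda>e. if e \<in> cells X (Suc m) then \<Sum>f\<in>cells X m. of_int (incidence X m e f) * u f else 0)
      | u. u \<in> cell_chains X m}"

definition cell_inner ::
    "('a, 'c) cell_structure \<Rightarrow> nat \<Rightarrow> ('c \<Rightarrow> complex) \<Rightarrow> ('c \<Rightarrow> complex) \<Rightarrow> complex" where
  "cell_inner X k c d = (\<Sum>e\<in>cells X k. c e * cnj (d e))"

definition coboundary_proj ::
    "('a, 'c) cell_structure \<Rightarrow> nat \<Rightarrow> ('c \<Rightarrow> complex) \<Rightarrow> 'c \<Rightarrow> complex" where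
  "coboundary_proj X k c =
     (THE w. w \<in> coboundaries X k \<and> (\<forall>v\<in>coboundaries X k. cell_inner X k (\<lambda>e. c e - w e) v = 0))"

text \<open>The entry of \<open>Q\<^sub>k\<close> in row \<open>e\<close> and column \<open>f\<close>.\<close>

definition Q_matrix :: "('a, 'c) cell_structure \<Rightarrow> nat \<Rightarrow> 'c \<Rightarrow> 'c \<Rightarrow> complex" where
  "Q_matrix X k e f = coboundary_proj X k (\<lambda>g. if g = f then 1 else 0) e"

text \<open>The principal minor on the index set \<open>T\<close>: the defining formula of \<^const>\<open>det\<close>
  with the finite index type replaced by a finite index set.\<close>

definition principal_minor :: "('c \<Rightarrow> 'c \<Rightarrow> 'r::comm_ring_1) \<Rightarrow> 'c set \<Rightarrow> 'r" where
  "principal_minor A T = (\<Sum>p\<in>{p. p permutes T}. of_int (sign p) * (\<Prod>i\<in>T. A i (p i)))"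

text \<open>Since \<open>Q\<^sub>k\<close> is an orthogonal projection, its principal minors are real and nonnegative;
  \<^const>\<open>Re\<close> and \<^const>\<open>ennreal\<close> are only coercions.\<close>

definition lower_matroidal_measure :: "('a, 'c) cell_structure \<Rightarrow> nat \<Rightarrow> 'c set measure" where
  "lower_matroidal_measure X k =
     point_measure {T. k_base X k T} (\<lambda>T. ennreal (Re (principal_minor (Q_matrix X k) T)))"

end

theory Submission
  imports Defs "HOL-Library.Function_Algebras"
begin

text \<open>
  For two bases \<open>T\<close> and \<open>T - {g} \<union> {e}\<close>, the column of \<open>e\<close> in \<open>\<partial>\<^sub>k\<close> has a rational coefficient \<open>q\<close> at \<open>g\<close>
  in its expansion over \<open>T\<close>.  The rows and columns of \<open>Q\<^sub>k\<close> lie in the row space of \<open>\<partial>\<^sub>k\<close> (up to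
  conjugation), so they satisfy the same linear relation as the columns of \<open>\<partial>\<^sub>k\<close>, and the exchange
  multiplies the principal minor by \<open>q\<^sup>2\<close>.  On the other side, \<open>t\<^sub>k\<^sub>-\<^sub>1(T)\<close> is the index of the lattice spanned
  by the columns in \<open>T\<close> inside its saturation, which is the same for all bases; comparing with a common
  sublattice, the exchange multiplies this index by \<open>\<bar>q\<bar>\<close>.  Any two bases are joined by exchanges.

  The torsion is the full quotient of the saturation only because boundaries are cycles, i.e. because the
  incidence numbers satisfy \<open>\<partial>\<partial> = 0\<close>.  As they are Brouwer degrees, this is proved in singular homology:
  for the \<open>n\<close>-skeleton \<open>Y\<close> and the complement \<open>U\<close> of the centres of its \<open>n\<close>-cells, \<open>H\<^sub>n(Y, U)\<close> is generated by the
  images of the pairs (open cell, punctured open cell).  Hence the boundary map into \<open>H\<^sub>n\<^sub>-\<^sub>1(U)\<close>, followed by the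
  radial retraction and a pinch map, is the expected combination of the local degrees of the pinch maps, and
  it vanishes on the class of an attaching map.
\<close>

section \<open>Balls, spheres and the pinch of a ball onto a sphere\<close>

text \<open>The balls are collapsed onto spheres by explicit formulas, and the argument is arranged
  so that no degree or sign of these maps is ever computed. All cells of one dimension share the
  model pair (open ball, punctured open ball), whose relative group embeds in the integers by
  boundary followed by radial projection. Every other homomorphism from that group to the integers
  is proportional to this embedding, so pinching and radial boundary agree up to one ratio
  \<open>c2 / c1\<close> with \<open>c1\<close> nonzero, and it suffices that \<open>c1\<close>
  times each entry of the product of boundary matrices vanishes. Bases are defined by complex
  independence, while lattice indices need integer relations; a functional that is linear over the
  rationals turns the former into the latter. The exchange coefficient q is carried as a fraction
  \<open>k g / N\<close> with the denominator cleared, so that the same integers enter minors and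
  indices. For k > 0 the constant is the minor of one fixed base, truncated at 0, over the square of
  its torsion number, which is positive because a lattice has finite index in its
  saturation.\<close>

lemma continuous_map_into_Euclidean_subspace:
  "continuous_map X (subtopology (Euclidean_space n) S) f \<longleftrightarrow>
     (\<forall>i. continuous_map X euclideanreal (\<lambda>x. f x i)) \<and>
     (\<forall>x\<in>topspace X. f x \<in> topspace (Euclidean_space n) \<inter> S)"
  by (auto simp: Euclidean_space_def subtopology_subtopology continuous_map_in_subtopology
      continuous_map_componentwise_UNIV Pi_iff)

lemma continuous_map_Euclidean_coordinate:
  "continuous_map (subtopology (Euclidean_space n) S) euclideanreal (\<lambda>x. x i)"
  unfolding Euclidean_space_def subtopology_subtopology
  by (intro continuous_map_from_subtopology continuous_map_product_projection) auto

lemma nsphere_eq_subtopology: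
  "nsphere n = subtopology (Euclidean_space (Suc n)) {x. (\<Sum>i<Suc n. (x i)\<^sup>2) = 1}"
  by (simp add: nsphere_def lessThan_Suc_atMost)

lemma topspace_nsphere:
  "topspace (nsphere n) = disc (Suc n) - open_disc (Suc n)"
  by (auto simp: nsphere_eq_subtopology disc_def open_disc_def)

lemma nsphere_eq_boundary_disc:
  "nsphere n = subtopology (Euclidean_space (Suc n)) (disc (Suc n) - open_disc (Suc n))"
  by (metis topspace_nsphere nsphere_eq_subtopology subtopology_restrict topspace_subtopology inf.left_idem)

abbreviation disc_top :: "nat \<Rightarrow> (nat \<Rightarrow> real) topology" where
  "disc_top n \<equiv> subtopology (Euclidean_space n) (disc n)"

lemma disc_subset_Euclidean: "disc n \<subseteq> topspace (Euclidean_space n)"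
  and open_disc_subset_disc: "open_disc n \<subseteq> disc n"
  by (auto simp: disc_def open_disc_def)

lemma topspace_disc_top [simp]: "topspace (disc_top n) = disc n"
  using disc_subset_Euclidean by auto

lemma Euclidean_Int_disc [simp]:
  "topspace (Euclidean_space n) \<inter> disc n = disc n"
  "topspace (Euclidean_space n) \<inter> open_disc n = open_disc n"
  using open_disc_subset_disc disc_subset_Euclidean by fast+

text \<open>The ball is closed in the cube with sides [-1,1], which is compact as a product of
  compact intervals. Compactness is what makes the characteristic maps closed.\<close>

lemma compact_space_disc: "compact_space (disc_top n)"
proof -
  let ?P = "powertop_real UNIV"
  let ?B = "PiE UNIV (\<lambda>i::nat. {-1..1::real})"
  have sub: "disc n \<subseteq> ?B"
  proof
    fix x assume x: "x \<in> disc n"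
    have "x i \<in> {-1..1}" for i
    proof (cases "i < n")
      case True
      then have "(x i)\<^sup>2 \<le> (\<Sum>i<n. (x i)\<^sup>2)"
        by (intro member_le_sum) auto
      with x have "(x i)\<^sup>2 \<le> 1" by (simp add: disc_def)
      then show ?thesis by (simp add: abs_square_le_1 abs_le_iff)
    next
      case False
      with x show ?thesis by (simp add: disc_def topspace_Euclidean_space)
    qed
    then show "x \<in> ?B" by (simp add: PiE_UNIV_domain)
  qed
  have "closedin ?P (topspace (Euclidean_space n) \<inter> {x\<in>topspace ?P. (\<Sum>i<n. (x i)\<^sup>2) \<in> {..1}})"
    by (intro closedin_Int closedin_Euclidean_space closedin_continuous_map_preimage[of _ euclideanreal]
        continuous_intros continuous_map_product_projection) auto
  also have "topspace (Euclidean_space n) \<inter> {x\<in>topspace ?P. (\<Sum>i<n. (x i)\<^sup>2) \<in> {..1}} = disc n"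
    by (auto simp: disc_def)
  finally have "closedin ?P (disc n)" .
  moreover have "compactin ?P ?B"
    by (simp add: compactin_PiE)
  ultimately have "compactin ?P (disc n)"
    using closed_compactin sub by blast
  moreover have "disc_top n = subtopology ?P (disc n)"
    unfolding Euclidean_space_def subtopology_subtopology
    using disc_subset_Euclidean[of n] by (simp add: topspace_Euclidean_space Int_absorb1)
  ultimately show ?thesis
    by (simp add: compact_space_subtopology)
qed

lemma disc_to_sphere_in_nsphere:
  assumes "x \<in> disc n" shows "disc_to_sphere n x \<in> topspace (nsphere n)"
proof -
  define r where "r = (\<Sum>i<n. (x i)\<^sup>2)"
  have "r \<le> 1" using assms by (simp add: disc_def r_def)
  then have "(\<Sum>i<n. (2 * sqrt (1 - r) * x i)\<^sup>2) + (1 - 2 * r)\<^sup>2 = 1"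
    by (simp add: power_mult_distrib flip: sum_distrib_left r_def) (simp add: power2_eq_square algebra_simps)
  then show ?thesis
    by (simp add: nsphere_eq_subtopology topspace_Euclidean_space disc_to_sphere_def Let_def r_def)
qed

lemma continuous_disc_to_sphere: "continuous_map (disc_top n) (nsphere n) (disc_to_sphere n)"
  unfolding nsphere_eq_subtopology continuous_map_into_Euclidean_subspace
proof (intro conjI allI ballI)
  fix i
  show "continuous_map (disc_top n) euclideanreal (\<lambda>x. disc_to_sphere n x i)"
  proof (cases "i < n")
    case True
    then show ?thesis
      by (simp add: disc_to_sphere_def Let_def)
         (intro continuous_intros continuous_map_Euclidean_coordinate, auto)
  next
    case False
    then show ?thesis
      by (cases "i = n"; simp add: disc_to_sphere_def Let_def)
         (intro continuous_intros continuous_map_Euclidean_coordinate, auto)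
  qed
qed (use disc_to_sphere_in_nsphere in \<open>auto simp: nsphere_eq_subtopology\<close>)

lemma disc_to_sphere_boundary:
  "x \<in> disc n - open_disc n \<Longrightarrow> disc_to_sphere n x = base_point n"
  by (auto simp: disc_def open_disc_def disc_to_sphere_def base_point_def)

text \<open>The point of the sphere opposite \<open>base_point n\<close>, and the image of the
  centre of the ball. Removing it corresponds to puncturing a cell at its centre.\<close>

definition north_pole :: "nat \<Rightarrow> nat \<Rightarrow> real" where
  "north_pole n = (\<lambda>i. if i = n then 1 else 0)"

lemma zero_in_open_disc [simp]: "(\<lambda>i. 0) \<in> open_disc n"
  by (simp add: open_disc_def topspace_Euclidean_space)

lemma disc_to_sphere_eq_north_pole_iff:
  assumes "x \<in> disc n"
  shows "disc_to_sphere n x = north_pole n \<longleftrightarrow> x = (\<lambda>i. 0)"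
proof
  assume "disc_to_sphere n x = north_pole n"
  then have "disc_to_sphere n x n = north_pole n n" by simp
  then have "(\<Sum>i<n. (x i)\<^sup>2) = 0"
    by (simp add: disc_to_sphere_def Let_def north_pole_def)
  then have "\<forall>i<n. x i = 0"
    by (subst (asm) sum_nonneg_eq_0_iff) auto
  then show "x = (\<lambda>i. 0)"
    using assms by (auto simp: disc_def topspace_Euclidean_space fun_eq_iff) (meson leI)
qed (simp add: disc_to_sphere_def north_pole_def fun_eq_iff)

lemma base_point_neq_north_pole: "base_point n \<noteq> north_pole n"
  by (auto simp: base_point_def north_pole_def fun_eq_iff)

lemma base_point_in_nsphere: "base_point n \<in> topspace (nsphere n)"
  by (simp add: nsphere_eq_subtopology topspace_Euclidean_space base_point_def)

lemma contractible_nsphere_minus_pole: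
  "contractible_space (subtopology (nsphere n) (topspace (nsphere n) - {north_pole n}))"
    (is "contractible_space ?X")
proof (rule contractible_space_retraction_map_image[of "Euclidean_space n" "?X"])
  \<comment> \<open>\<open>g\<close> is stereographic projection from the pole and \<open>f\<close>
    its inverse. Only \<open>f (g x) = x\<close> is needed: it makes the punctured sphere a retract
    of Euclidean space, and retracts of contractible spaces are contractible.\<close>
  define g where "g = (\<lambda>(x::nat\<Rightarrow>real) i. if i < n then x i / (1 - x n) else 0)"
  define f where "f = (\<lambda>(y::nat\<Rightarrow>real) i. let r = \<Sum>i<n. (y i)\<^sup>2 in
     if i < n then 2 * y i / (r + 1) else if i = n then (r - 1) / (r + 1) else 0)"
  have X: "?X = subtopology (Euclidean_space (Suc n)) ({x. (\<Sum>i<Suc n. (x i)\<^sup>2) = 1} \<inter> - {north_pole n})"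
    unfolding Diff_eq subtopology_restrict nsphere_eq_subtopology subtopology_subtopology ..
  have pos: "r + 1 > 0" if "r = (\<Sum>i<n. (y i)\<^sup>2)" for r and y :: "nat \<Rightarrow> real"
    using that sum_nonneg[of "{..<n}" "\<lambda>i. (y i)\<^sup>2"] by simp
  have xn: "x n \<noteq> 1" if "x \<in> topspace ?X" for x
  proof
    assume "x n = 1"
    with that have "(\<Sum>i<n. (x i)\<^sup>2) = 0" by (simp add: nsphere_eq_subtopology)
    then have "\<forall>i<n. x i = 0" by (subst (asm) sum_nonneg_eq_0_iff) auto
    moreover have "\<forall>i>n. x i = 0"
      using that by (simp add: nsphere_eq_subtopology topspace_Euclidean_space)
    ultimately have "x = north_pole n"
      using \<open>x n = 1\<close> by (auto simp: north_pole_def fun_eq_iff) (metis linorder_neqE_nat)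
    with that show False by simp
  qed
  have fg: "f (g x) = x" if "x \<in> topspace ?X" for x
  proof -
    have s: "(\<Sum>i<n. (x i)\<^sup>2) = 1 - (x n)\<^sup>2"
      using that by (simp add: nsphere_eq_subtopology)
    have "(\<Sum>i<n. (g x i)\<^sup>2) = (1 - (x n)\<^sup>2) / (1 - x n)\<^sup>2"
      unfolding s[symmetric] sum_divide_distrib by (simp add: g_def power_divide)
    also have "\<dots> = (1 + x n) / (1 - x n)"
    proof -
      have "1 - (x n)\<^sup>2 = (1 - x n) * (1 + x n)" by (simp add: power2_eq_square algebra_simps)
      then show ?thesis using xn[OF that] by (simp add: power2_eq_square)
    qed
    finally have r: "(\<Sum>i<n. (g x i)\<^sup>2) = (1 + x n) / (1 - x n)" .
    have r1: "(1 + x n) / (1 - x n) + 1 = 2 / (1 - x n)" "(1 + x n) / (1 - x n) - 1 = 2 * x n / (1 - x n)"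
      using xn[OF that] by (simp_all add: field_simps)
    show ?thesis
    proof
      fix i
      show "f (g x) i = x i"
        using that xn[OF that] unfolding f_def Let_def r r1
        by (auto simp: g_def nsphere_eq_subtopology topspace_Euclidean_space)
    qed
  qed
  have fin: "f y \<in> topspace (Euclidean_space (Suc n)) \<inter> ({x. (\<Sum>i<Suc n. (x i)\<^sup>2) = 1} \<inter> - {north_pole n})" for y
  proof -
    define r where "r = (\<Sum>i<n. (y i)\<^sup>2)"
    have p: "r + 1 > 0" by (rule pos[OF r_def])
    have "(\<Sum>i<Suc n. (f y i)\<^sup>2) = (\<Sum>i<n. (2 * y i / (r + 1))\<^sup>2) + ((r - 1) / (r + 1))\<^sup>2"
      by (simp add: f_def Let_def flip: r_def)
    also have "(\<Sum>i<n. (2 * y i / (r + 1))\<^sup>2) = 4 * r / (r + 1)\<^sup>2"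
      unfolding r_def by (simp add: power_divide power_mult_distrib sum_divide_distrib sum_distrib_left)
    also have "4 * r / (r + 1)\<^sup>2 + ((r - 1) / (r + 1))\<^sup>2 = (4 * r + (r - 1)\<^sup>2) / (r + 1)\<^sup>2"
      by (simp add: power_divide add_divide_distrib)
    also have "4 * r + (r - 1)\<^sup>2 = (r + 1)\<^sup>2" by (simp add: power2_eq_square algebra_simps)
    finally have "(\<Sum>i<Suc n. (f y i)\<^sup>2) = 1" using p by simp
    moreover have "f y n \<noteq> 1" using p by (simp add: f_def Let_def flip: r_def)
    moreover have "f y \<in> topspace (Euclidean_space (Suc n))"
      by (simp add: topspace_Euclidean_space f_def Let_def)
    ultimately show ?thesis
      by (auto simp: north_pole_def)
  qed
  have cf: "continuous_map (Euclidean_space n) ?X f"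
    unfolding X continuous_map_into_Euclidean_subspace
  proof (intro conjI allI ballI)
    fix i
    have "continuous_map (subtopology (Euclidean_space n) UNIV) euclideanreal (\<lambda>y. f y i)"
    proof (cases "i < n")
      case True
      then show ?thesis
        by (simp add: f_def Let_def del: subtopology_UNIV)
          (intro continuous_intros continuous_map_Euclidean_coordinate, use pos in \<open>simp_all add: less_imp_neq[symmetric]\<close>)
    next
      case False
      then show ?thesis
        by (cases "i = n"; simp add: f_def Let_def del: subtopology_UNIV)
          (intro continuous_intros continuous_map_Euclidean_coordinate, use pos in \<open>simp_all add: less_imp_neq[symmetric]\<close>)
    qed
    then show "continuous_map (Euclidean_space n) euclideanreal (\<lambda>y. f y i)" by simp
  qed (use fin in auto)
  have cg: "continuous_map ?X (Euclidean_space n) g"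
    unfolding continuous_map_into_Euclidean_subspace[where S = UNIV, simplified]
  proof (intro conjI allI ballI)
    fix i
    show "continuous_map ?X euclideanreal (\<lambda>x. g x i)"
    proof (cases "i < n")
      case True
      have "continuous_map ?X euclideanreal (\<lambda>x. x i / (1 - x n))"
        using xn unfolding X
        by (intro continuous_intros continuous_map_Euclidean_coordinate) (use X in auto)
      with True show ?thesis by (simp add: g_def)
    qed (simp add: g_def)
  qed (simp add: g_def topspace_Euclidean_space)
  show "retraction_map (Euclidean_space n) ?X f"
    unfolding retraction_map_def retraction_maps_def
    using cf cg fg by auto
qed simp

section \<open>Radial projection and the local homology of a ball at its centre\<close>

abbreviation euclid_norm :: "nat \<Rightarrow> (nat \<Rightarrow> real) \<Rightarrow> real" where
  "euclid_norm n x \<equiv> sqrt (\<Sum>i<n. (x i)\<^sup>2)"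

abbreviation open_disc_top :: "nat \<Rightarrow> (nat \<Rightarrow> real) topology" where
  "open_disc_top n \<equiv> subtopology (Euclidean_space n) (open_disc n)"

definition radial :: "nat \<Rightarrow> (nat \<Rightarrow> real) \<Rightarrow> nat \<Rightarrow> real" where
  "radial n x = (\<lambda>i. x i / euclid_norm n x)"

lemma topspace_open_disc_top [simp]: "topspace (open_disc_top n) = open_disc n"
  using open_disc_subset_disc disc_subset_Euclidean by auto

lemma euclid_norm_scale: "euclid_norm n (\<lambda>i. a * x i) = \<bar>a\<bar> * euclid_norm n x"
  by (simp add: power_mult_distrib real_sqrt_mult flip: sum_distrib_left)

lemma euclid_norm_pos:
  assumes "x \<in> topspace (Euclidean_space n)" "x \<noteq> (\<lambda>i. 0)"
  shows "euclid_norm n x > 0"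
proof -
  obtain i where "x i \<noteq> 0" using assms(2) by auto
  moreover then have "i < n"
    using assms(1) by (auto simp: topspace_Euclidean_space not_le[symmetric])
  ultimately have "(\<Sum>i<n. (x i)\<^sup>2) > 0"
    by (intro sum_pos2[of _ i]) auto
  then show ?thesis by simp
qed

lemma open_disc_iff_norm: "x \<in> open_disc n \<longleftrightarrow> x \<in> topspace (Euclidean_space n) \<and> euclid_norm n x < 1"
  by (simp add: open_disc_def)

lemma continuous_map_prod_interval_coordinate:
  "continuous_map (prod_topology (top_of_set {0..1::real}) (subtopology (Euclidean_space n) S)) euclideanreal (\<lambda>p. snd p i)"
  using continuous_map_compose[OF continuous_map_snd continuous_map_Euclidean_coordinate] by (simp add: o_def)

lemma continuous_map_prod_interval_fst:
  "continuous_map (prod_topology (top_of_set {0..1::real}) X) euclideanreal fst"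
  by (rule continuous_map_into_fulltopology[OF continuous_map_fst])

lemma contractible_open_disc: "contractible_space (open_disc_top n)"
proof -
  let ?h = "\<lambda>p::real \<times> (nat \<Rightarrow> real). \<lambda>i. (1 - fst p) * snd p i"
  have "?h p \<in> open_disc n" if "p \<in> {0..1} \<times> open_disc n" for p
  proof -
    have "euclid_norm n (?h p) \<le> 1 * euclid_norm n (snd p)"
      unfolding euclid_norm_scale using that by (intro mult_right_mono) (auto simp: sum_nonneg)
    then show ?thesis using that by (auto simp: open_disc_iff_norm topspace_Euclidean_space)
  qed
  then have "continuous_map (prod_topology (top_of_set {0..1}) (open_disc_top n)) (open_disc_top n) ?h"
    unfolding continuous_map_into_Euclidean_subspace
    by (intro conjI allI continuous_intros continuous_map_prod_interval_coordinate continuous_map_prod_interval_fst)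
       (auto simp: open_disc_def)
  then have "homotopic_with (\<lambda>_. True) (open_disc_top n) (open_disc_top n) id (\<lambda>x i. 0)"
    by (simp add: homotopic_with_def) (rule exI[of _ ?h], auto)
  then show ?thesis by (auto simp: contractible_space_def)
qed

lemma radial_in_nsphere:
  assumes "x \<in> topspace (Euclidean_space (Suc m))" "x \<noteq> (\<lambda>i. 0)"
  shows "radial (Suc m) x \<in> topspace (nsphere m)"
proof -
  have "(\<Sum>i<Suc m. (x i / euclid_norm (Suc m) x)\<^sup>2) = (\<Sum>i<Suc m. (x i)\<^sup>2) / (euclid_norm (Suc m) x)\<^sup>2"
    unfolding power_divide sum_divide_distrib ..
  also have "\<dots> = 1"
    using euclid_norm_pos[OF assms] by (simp add: sum_nonneg del: sum.lessThan_Suc)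
  finally show ?thesis
    using assms by (simp add: nsphere_eq_subtopology radial_def topspace_Euclidean_space del: sum.lessThan_Suc)
qed

lemma radial_on_nsphere: "x \<in> topspace (nsphere m) \<Longrightarrow> radial (Suc m) x = x"
  by (simp add: nsphere_eq_subtopology radial_def)

lemma continuous_map_radial:
  assumes "(\<lambda>i. 0) \<notin> S"
  shows "continuous_map (subtopology (Euclidean_space (Suc m)) S) (nsphere m) (radial (Suc m))"
  unfolding nsphere_eq_subtopology continuous_map_into_Euclidean_subspace radial_def
proof (intro conjI allI ballI continuous_intros continuous_map_Euclidean_coordinate)
  fix x assume "x \<in> topspace (subtopology (Euclidean_space (Suc m)) S)"
  then have x: "x \<in> topspace (Euclidean_space (Suc m))" "x \<noteq> (\<lambda>i. 0)" using assms by auto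
  show "euclid_norm (Suc m) x \<noteq> 0" using euclid_norm_pos[OF x] by (simp del: sum.lessThan_Suc)
  show "(\<lambda>i. x i / euclid_norm (Suc m) x) \<in> topspace (Euclidean_space (Suc m)) \<inter> {x. (\<Sum>i<Suc m. (x i)\<^sup>2) = 1}"
    using radial_in_nsphere[OF x] by (simp add: nsphere_eq_subtopology radial_def del: sum.lessThan_Suc)
qed auto

abbreviation punctured_disc :: "nat \<Rightarrow> (nat \<Rightarrow> real) set" where
  "punctured_disc n \<equiv> open_disc n - {\<lambda>i. 0}"

text \<open>Exhibits the sphere of radius 1/2 as a deformation of the punctured open ball. The
  factor 1/2 brings the unit sphere, the target of \<open>radial\<close>, back inside the open
  ball.\<close>

lemma homotopic_half_radial:
  "homotopic_with (\<lambda>_. True) (subtopology (Euclidean_space (Suc m)) (punctured_disc (Suc m)))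
     (subtopology (Euclidean_space (Suc m)) (punctured_disc (Suc m)))
     ((\<lambda>x i. x i / 2) \<circ> radial (Suc m)) id"
proof -
  let ?n = "euclid_norm (Suc m)"
  let ?P = "subtopology (Euclidean_space (Suc m)) (punctured_disc (Suc m))"
  \<comment> \<open>The scaling factor interpolates between 1/(2|x|) and 1, so at time t the norm is
    (1 - t)/2 + t|x|, which stays strictly between 0 and 1.\<close>
  let ?s = "\<lambda>p::real \<times> (nat \<Rightarrow> real). (1 - fst p) / (2 * ?n (snd p)) + fst p"
  let ?h = "\<lambda>p. \<lambda>i. ?s p * snd p i"
  have P: "topspace ?P = punctured_disc (Suc m)"
    by (auto simp: open_disc_def)
  have pos: "?n x > 0" if "x \<in> punctured_disc (Suc m)" for x
    using that by (intro euclid_norm_pos) (auto simp: open_disc_def)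
  have in1: "?h p \<in> topspace (Euclidean_space (Suc m)) \<inter> punctured_disc (Suc m)"
    if pp: "p \<in> {0..1} \<times> punctured_disc (Suc m)" for p
  proof -
    obtain t x where "p = (t, x)" by (cases p)
    with pp have p: "p = (t, x)" "0 \<le> t" "t \<le> 1" "x \<in> punctured_disc (Suc m)"
      by simp_all
    note n0 = pos[OF p(4)]
    have n1: "?n x < 1" using p by (simp add: open_disc_iff_norm del: sum.lessThan_Suc)
    have s0: "?s p > 0"
    proof (cases "t = 0")
      case False
      then have "(1 - t) / (2 * ?n x) \<ge> 0" using p n0 by (simp del: sum.lessThan_Suc)
      then show ?thesis using False p by (simp del: sum.lessThan_Suc)
    qed (use p n0 in \<open>simp del: sum.lessThan_Suc\<close>)
    have "?n (?h p) = ?s p * ?n x"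
      unfolding euclid_norm_scale using s0 p by (simp del: sum.lessThan_Suc)
    also have "\<dots> = (1 - t) / 2 + t * ?n x"
      using n0 p by (simp add: field_simps del: sum.lessThan_Suc)
    also have "\<dots> < 1"
    proof (cases "t = 1")
      case False
      then have "t * ?n x \<le> t * 1" using p n1 by (intro mult_left_mono) auto
      moreover have "t < 1" using False p by simp
      ultimately show ?thesis by argo
    qed (use n1 in simp)
    finally have "?n (?h p) < 1" .
    moreover have "?h p \<in> topspace (Euclidean_space (Suc m))"
      using p by (auto simp: topspace_Euclidean_space open_disc_def)
    moreover have "?h p \<noteq> (\<lambda>i. 0)"
      using s0 p by (auto simp: fun_eq_iff)
    ultimately show ?thesis by (simp add: open_disc_iff_norm del: sum.lessThan_Suc)
  qed
  have "continuous_map (prod_topology (top_of_set {0..1}) ?P) ?P ?h"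
    unfolding continuous_map_into_Euclidean_subspace
  proof (intro conjI allI ballI continuous_intros continuous_map_prod_interval_coordinate continuous_map_prod_interval_fst)
    fix p assume "p \<in> topspace (prod_topology (top_of_set {0..1::real}) ?P)"
    then have p: "p \<in> {0..1} \<times> punctured_disc (Suc m)" by (auto simp: P)
    show "2 * ?n (snd p) \<noteq> 0" using pos[of "snd p"] p by (auto simp del: sum.lessThan_Suc)
    show "?h p \<in> topspace (Euclidean_space (Suc m)) \<inter> punctured_disc (Suc m)"
      by (rule in1[OF p])
  qed auto
  then show ?thesis
    unfolding homotopic_with_def
    by (intro exI[of _ ?h]) (auto simp: radial_def fun_eq_iff)
qed

text \<open>The ball is contractible, so the boundary map is injective into the reduced homology of
  the punctured ball, and radial projection has a homology inverse on the left. The composite will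
  serve as an embedding of the local group of a cell into the integers.\<close>

lemma inj_on_radial_boundary:
  fixes m :: nat
  defines "P \<equiv> punctured_disc (Suc m)"
  shows "inj_on (\<lambda>w. hom_induced (int m) (subtopology (open_disc_top (Suc m)) P) {} (nsphere m) {} (radial (Suc m))
            (hom_boundary (int (Suc m)) (open_disc_top (Suc m)) P w))
          (carrier (relative_homology_group (int (Suc m)) (open_disc_top (Suc m)) P))"
proof -
  let ?D = "open_disc_top (Suc m)"
  let ?P = "subtopology ?D P"
  have P: "?P = subtopology (Euclidean_space (Suc m)) P"
    unfolding subtopology_subtopology P_def by (rule arg_cong[of _ _ "subtopology _"]) auto
  have ne: "topspace ?D \<inter> P \<noteq> {}"
  proof -
    \<comment> \<open>The isomorphism between relative and reduced homology asks for a nonempty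
      subspace; a point of radius 1/2 on the first axis is a witness.\<close>
    have "(\<lambda>i. if i = 0 then 1/2 else 0) \<in> P"
      by (auto simp: P_def open_disc_def topspace_Euclidean_space power2_eq_square fun_eq_iff if_distrib cong: if_cong)
    then show ?thesis unfolding topspace_open_disc_top P_def by blast
  qed
  have bd: "hom_boundary (int (Suc m)) ?D P \<in> iso (relative_homology_group (int (Suc m)) ?D P) (reduced_homology_group (int m) ?P)"
    using iso_relative_homology_of_contractible[OF contractible_open_disc ne, of "int (Suc m)"] by simp
  have cr: "continuous_map ?P (nsphere m) (radial (Suc m))"
    unfolding P unfolding P_def by (rule continuous_map_radial) auto
  have ch: "continuous_map (nsphere m) ?P (\<lambda>x i. x i / 2)"
    unfolding P continuous_map_into_Euclidean_subspace
  proof (intro conjI allI ballI continuous_intros continuous_map_nsphere_projection)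
    fix x assume x: "x \<in> topspace (nsphere m)"
    have x0: "x \<noteq> (\<lambda>i. 0)" using x by (auto simp: nsphere_eq_subtopology)
    have "(\<Sum>i<Suc m. (x i / 2)\<^sup>2) = (\<Sum>i<Suc m. (x i)\<^sup>2) / 4"
      unfolding power_divide sum_divide_distrib by simp
    then show "(\<lambda>i. x i / 2) \<in> topspace (Euclidean_space (Suc m)) \<inter> P"
      using x x0 by (auto simp: P_def nsphere_eq_subtopology open_disc_def topspace_Euclidean_space fun_eq_iff simp del: sum.lessThan_Suc)
  qed auto
  have inv: "hom_induced (int m) (nsphere m) {} ?P {} (\<lambda>x i. x i / 2)
              (hom_induced (int m) ?P {} (nsphere m) {} (radial (Suc m)) c) = c"
    if "c \<in> carrier (homology_group (int m) ?P)" for c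
  proof -
    have "hom_induced (int m) ?P {} ?P {} ((\<lambda>x i. x i / 2) \<circ> radial (Suc m)) = hom_induced (int m) ?P {} ?P {} id"
      using homotopic_half_radial[of m] unfolding P unfolding P_def by (intro homology_homotopy_empty) auto
    then show ?thesis
      using that cr ch by (subst hom_induced_compose') (auto simp: hom_induced_id)
  qed
  show ?thesis
  proof (rule inj_onI)
    fix v w
    assume v: "v \<in> carrier (relative_homology_group (int (Suc m)) ?D P)"
      and w: "w \<in> carrier (relative_homology_group (int (Suc m)) ?D P)"
      and eq: "hom_induced (int m) ?P {} (nsphere m) {} (radial (Suc m)) (hom_boundary (int (Suc m)) ?D P v) =
         hom_induced (int m) ?P {} (nsphere m) {} (radial (Suc m)) (hom_boundary (int (Suc m)) ?D P w)"
    have "hom_boundary (int (Suc m)) ?D P u \<in> carrier (homology_group (int m) ?P)" for u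
      using hom_boundary_carrier[of "int (Suc m)" ?D P u] by simp
    then have "hom_boundary (int (Suc m)) ?D P v = hom_boundary (int (Suc m)) ?D P w"
      using inv eq by metis
    then show "v = w"
      using bd v w by (auto simp: iso_def bij_betw_def inj_on_def)
  qed
qed

section \<open>Relative homology generated by disjoint open pieces\<close>

lemma subgroup_hom_preimage:
  assumes "group_hom G H h" "subgroup K H"
  shows "subgroup {x \<in> carrier G. h x \<in> K} G"
proof -
  interpret group_hom G H h by fact
  show ?thesis
    by (rule G.subgroupI) (use assms(2) in \<open>auto simp: subgroup.m_closed subgroup.m_inv_closed subgroup.one_closed intro!: exI[of _ "\<one>\<^bsub>G\<^esub>"]\<close>)
qed

text \<open>Additivity of local homology, in the form of generation only. Excision at one point
  shows that each class agrees, modulo the homology of the rest, with a class from the piece around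
  that point; subtracting it leaves a class that comes from a space with one puncture fewer. Stating
  this for a subgroup \<open>K\<close> fits the use with \<open>K\<close> the kernel of a
  homomorphism.\<close>

lemma subgroup_carrier_induct_open_pieces:
  assumes "finite F" "t1_space Y"
    and "\<And>f. f \<in> F \<Longrightarrow> openin Y (V f) \<and> c f \<in> V f"
    and "pairwise (\<lambda>f g. disjnt (V f) (V g)) F"
    and "subgroup K (relative_homology_group p Y (topspace Y - c ` F))"
    and "\<And>f w. f \<in> F \<Longrightarrow> w \<in> carrier (relative_homology_group p (subtopology Y (V f)) (V f - {c f})) \<Longrightarrow>
       hom_induced p (subtopology Y (V f)) (V f - {c f}) Y (topspace Y - c ` F) id w \<in> K"
  shows "carrier (relative_homology_group p Y (topspace Y - c ` F)) \<subseteq> K"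
  using assms
proof (induction F arbitrary: Y K rule: finite_induct)
  case empty
  then show ?case
    using trivial_relative_homology_group_topspace[of p Y] subgroup.one_closed
    by (fastforce simp: trivial_group_def)
next
  case (insert f F)
  define U where "U = topspace Y - c ` insert f F"
  note K = insert.prems(4)[folded U_def] and imgs = insert.prems(5)[folded U_def]
  let ?U1 = "topspace Y - {c f}"
  let ?Y1 = "subtopology Y ?U1"
  let ?G = "relative_homology_group p Y U"
  let ?Vf = "subtopology Y (V f)"
  interpret G: comm_group ?G by simp
  have op: "openin Y (V g)" "c g \<in> V g" if "g \<in> insert f F" for g
    using insert.prems that by auto
  have disj: "disjnt (V f) (V g)" if "g \<in> F" for g
    using insert.prems(3) insert.hyps that by (auto simp: pairwise_insert)
  have Vsub: "V g \<subseteq> topspace Y" if "g \<in> insert f F" for g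
    using op[OF that] openin_subset by blast
  have cf: "c f \<notin> V g" "c g \<notin> V f" if "g \<in> F" for g
    using disj[OF that] op that by (auto simp: disjnt_iff)
  have closedc: "closedin Y {c f}"
    using insert.prems(1) op(2) Vsub by (metis closedin_t1_singleton insertI1 subsetD)
  have incl: "id \<in> U \<rightarrow> ?U1" by (auto simp: U_def)
  have inclS: "U \<subseteq> ?U1" by (auto simp: U_def)
  define \<iota> where "\<iota> = hom_induced p ?Vf (V f - {c f}) Y U id"
  define j where "j = hom_induced p Y U Y ?U1 id"
  define k where "k = hom_induced p ?Y1 U Y U id"
  have jhom: "group_hom ?G (relative_homology_group p Y ?U1) j"
    and khom: "group_hom (relative_homology_group p ?Y1 U) ?G k"
    by (simp_all add: j_def k_def group_hom_def group_hom_axioms_def hom_induced_hom)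
  interpret J: group_hom ?G "relative_homology_group p Y ?U1" j by (fact jhom)
  have sub: "V f - {c f} \<subseteq> U"
    using Vsub cf by (auto simp: U_def)
  have exc: "hom_induced p ?Vf (V f - {c f}) Y ?U1 id
       \<in> iso (relative_homology_group p ?Vf (V f - {c f})) (relative_homology_group p Y ?U1)"
  proof -
    \<comment> \<open>The hypothesis of excision holds because the removed set is already closed and
      \<open>Y\<close> minus a point is already open, the latter by the T1 axiom.\<close>
    have *: "Y closure_of (topspace Y - V f) \<subseteq> Y interior_of ?U1"
    proof -
      have "closedin Y (topspace Y - V f)" "openin Y ?U1"
        using op[of f] closedc by (auto simp: openin_diff)
      then show ?thesis
        using op(2)[of f] by (auto simp: closure_of_closedin interior_of_openin)
    qed
    show ?thesis
    proof -
      have "topspace Y - (topspace Y - V f) = V f" "?U1 - (topspace Y - V f) = V f - {c f}"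
        using Vsub[of f] by auto
      moreover have "Y closure_of (topspace Y - V f) \<subseteq> Y interior_of ?U1 \<Longrightarrow> ?thesis"
        using homology_excision_axiom[of Y "topspace Y - V f" ?U1 "topspace Y" p] calculation by simp
      ultimately show ?thesis using * by blast
    qed
  qed
  show ?case
    unfolding U_def[symmetric]
  proof
    fix z assume z: "z \<in> carrier ?G"
    then have "j z \<in> carrier (relative_homology_group p Y ?U1)"
      by (simp add: j_def hom_induced_carrier)
    then have "j z \<in> hom_induced p ?Vf (V f - {c f}) Y ?U1 id ` carrier (relative_homology_group p ?Vf (V f - {c f}))"
      using exc by (simp add: iso_def bij_betw_def)
    then obtain a where a: "a \<in> carrier (relative_homology_group p ?Vf (V f - {c f}))"
      and ja: "hom_induced p ?Vf (V f - {c f}) Y ?U1 id a = j z"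
      unfolding image_iff by (elim bexE) (rule that, auto)
    have \<iota>K: "\<iota> a \<in> K"
      unfolding \<iota>_def by (rule imgs[OF insertI1 a])
    have \<iota>G: "\<iota> a \<in> carrier ?G"
      by (simp add: \<iota>_def hom_induced_carrier)
    have j\<iota>: "j (\<iota> a) = j z"
      using ja sub incl unfolding j_def \<iota>_def
      by (subst hom_induced_compose') (auto simp: continuous_map_from_subtopology)
    \<comment> \<open>The remainder of \<open>z\<close> after removing the contribution of the piece
      at \<open>f\<close>. It dies in the homology of \<open>Y\<close> relative to the complement of
      \<open>c f\<close>, so exactness of the triple \<open>U\<close>, \<open>?U1\<close>,
      \<open>Y\<close> lifts it to \<open>?Y1\<close>.\<close>
    define y where "y = z \<otimes>\<^bsub>?G\<^esub> inv\<^bsub>?G\<^esub> \<iota> a"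
    have yG: "y \<in> carrier ?G" by (simp add: y_def z \<iota>G)
    have "j y = \<one>\<^bsub>relative_homology_group p Y ?U1\<^esub>"
      by (simp add: y_def z \<iota>G j\<iota>)
    then have "y \<in> kernel ?G (relative_homology_group p Y ?U1) j"
      using yG by (simp add: kernel_def)
    moreover have "kernel ?G (relative_homology_group p Y ?U1) j = k ` carrier (relative_homology_group p ?Y1 U)"
      using homology_exactness_triple_3[of U ?U1 p Y] inclS unfolding j_def k_def by simp
    ultimately obtain y' where y': "y' \<in> carrier (relative_homology_group p ?Y1 U)" "k y' = y"
      by auto
    have eq: "topspace ?Y1 - c ` F = U" by (auto simp: U_def)
    \<comment> \<open>The induction hypothesis is applied to the space without \<open>c f\<close>
      and to the preimage of \<open>K\<close> under \<open>k\<close>; the remaining pieces avoid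
      \<open>c f\<close> and are therefore unchanged.\<close>
    have "carrier (relative_homology_group p ?Y1 (topspace ?Y1 - c ` F)) \<subseteq> {x \<in> carrier (relative_homology_group p ?Y1 U). k x \<in> K}"
    proof (rule insert.IH)
      have Vg: "subtopology ?Y1 (V g) = subtopology Y (V g)" if "g \<in> F" for g
        using that cf Vsub[of g] by (simp add: subtopology_subtopology Int_absorb1 subset_insert Diff_Int_distrib2 subset_Diff_insert)
      show "t1_space ?Y1" using insert.prems(1) t1_space_subtopology by blast
      show "openin ?Y1 (V g) \<and> c g \<in> V g" if "g \<in> F" for g
        using op[of g] that cf Vsub[of g] by (simp add: openin_subtopology) blast
      show "pairwise (\<lambda>f g. disjnt (V f) (V g)) F"
        using insert.prems(3) by (simp add: pairwise_insert)
      show "subgroup {x \<in> carrier (relative_homology_group p ?Y1 U). k x \<in> K} (relative_homology_group p ?Y1 (topspace ?Y1 - c ` F))"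
        unfolding eq
        by (rule subgroup_hom_preimage[OF khom K])
      show "hom_induced p (subtopology ?Y1 (V g)) (V g - {c g}) ?Y1 (topspace ?Y1 - c ` F) id w
            \<in> {x \<in> carrier (relative_homology_group p ?Y1 U). k x \<in> K}"
        if g: "g \<in> F" and w: "w \<in> carrier (relative_homology_group p (subtopology ?Y1 (V g)) (V g - {c g}))" for g w
      proof -
        have "k (hom_induced p (subtopology ?Y1 (V g)) (V g - {c g}) ?Y1 U id w) 
            = hom_induced p (subtopology Y (V g)) (V g - {c g}) Y U id w"
          unfolding k_def Vg[OF g]
        proof (subst hom_induced_compose')
          show "continuous_map (subtopology Y (V g)) ?Y1 id"
            using cf[OF g] by (auto simp: continuous_map_in_subtopology continuous_map_from_subtopology)
          have chg: "c h \<notin> V g" if "h \<in> insert f F" "h \<noteq> g" for h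
          proof -
            have "disjnt (V h) (V g)"
              using pairwiseD[OF insert.prems(3), of h g] that g by blast
            then show ?thesis using op(2)[OF that(1)] by (auto simp: disjnt_iff)
          qed
          show "id \<in> V g - {c g} \<rightarrow> U"
          proof
            fix x assume x: "x \<in> V g - {c g}"
            have "x \<noteq> c h" if "h \<in> insert f F" for h
              using chg[OF that] x by (cases "h = g") auto
            then show "id x \<in> U"
              using Vsub[of g] g x unfolding U_def by auto
          qed
        qed (auto simp: continuous_map_from_subtopology)
        then show ?thesis
          using imgs[OF insertI2[OF g] w[unfolded Vg[OF g]]] unfolding eq Vg[OF g] id_def
          by (simp add: hom_induced_carrier)
      qed
    qed
    then have "k y' \<in> K" using y' unfolding eq by auto
    then have "y \<otimes>\<^bsub>?G\<^esub> \<iota> a \<in> K"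
      using y' \<iota>K subgroup.m_closed[OF K] by auto
    then show "z \<in> K"
      using z \<iota>G by (simp add: y_def G.m_assoc)
  qed
qed

section \<open>Skeleta of a finite CW-complex\<close>

text \<open>The preimage of a closed set is its trace on \<open>A\<close> together with finitely
  many images of closed sets under the closed maps \<open>\<Phi> f\<close>. This allows maps out of
  a skeleton to be checked on the lower part and on each ball separately.\<close>

lemma continuous_map_closed_glue:
  assumes "finite F" and cov: "topspace Y \<subseteq> A \<union> (\<Union>f\<in>F. \<Phi> f ` topspace (D f))"
    and A: "closedin Y A" "continuous_map (subtopology Y A) Z h"
    and D: "\<And>f. f \<in> F \<Longrightarrow> closed_map (D f) Y (\<Phi> f)"
    and hD: "\<And>f. f \<in> F \<Longrightarrow> continuous_map (D f) Z (h \<circ> \<Phi> f)"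
  shows "continuous_map Y Z h"
  unfolding continuous_map_closedin
proof (intro conjI allI impI ballI)
  have AY: "A \<subseteq> topspace Y" using A(1) closedin_subset by blast
  have DY: "\<Phi> f ` topspace (D f) \<subseteq> topspace Y" if "f \<in> F" for f
    using D[OF that] closed_map_imp_subset_topspace by blast
  have hA: "h x \<in> topspace Z" if "x \<in> A" for x
    using continuous_map_image_subset_topspace[OF A(2)] that AY by (auto simp: Int_absorb1)
  have h\<Phi>: "h (\<Phi> f x) \<in> topspace Z" if "f \<in> F" "x \<in> topspace (D f)" for f x
    using continuous_map_image_subset_topspace[OF hD[OF that(1)]] that by auto
  show "h \<in> topspace Y \<rightarrow> topspace Z"
    using cov hA h\<Phi> by fastforce
  fix C assume C: "closedin Z C"
  have "{x \<in> topspace Y. h x \<in> C} = {x \<in> A. h x \<in> C} \<union> (\<Union>f\<in>F. \<Phi> f ` {x \<in> topspace (D f). h (\<Phi> f x) \<in> C})"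
    using cov AY DY by (auto simp: image_subset_iff)
  moreover have "closedin Y {x \<in> A. h x \<in> C}"
  proof -
    have "closedin (subtopology Y A) {x \<in> topspace (subtopology Y A). h x \<in> C}"
      by (rule closedin_continuous_map_preimage[OF A(2) C])
    then show ?thesis
      using closedin_trans_full[OF _ A(1)] AY by (simp add: Int_absorb1)
  qed
  moreover have "closedin Y (\<Phi> f ` {x \<in> topspace (D f). h (\<Phi> f x) \<in> C})" if "f \<in> F" for f
    using closedin_continuous_map_preimage[OF hD[OF that] C] D[OF that] by (simp add: closed_map_def)
  ultimately show "closedin Y {x \<in> topspace Y. h x \<in> C}"
    using \<open>finite F\<close> by (auto intro!: closedin_Un closedin_Union)
qed

text \<open>\<open>carrier_below\<close> is strict in the dimension, whence \<open>Suc n\<close> for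
  cells of dimension at most \<open>n\<close>.\<close>

definition skeleton :: "('a, 'c) cell_structure \<Rightarrow> nat \<Rightarrow> 'a topology" where
  "skeleton X n = subtopology (space X) (carrier_below X (Suc n))"

definition centre :: "('a, 'c) cell_structure \<Rightarrow> nat \<Rightarrow> 'c \<Rightarrow> 'a" where
  "centre X n f = char_map X n f (\<lambda>i. 0)"

lemma open_cell_subset_disc: "open_cell X n c \<subseteq> char_map X n c ` disc n"
  unfolding open_cell_def by (rule image_mono[OF open_disc_subset_disc])

locale CW =
  fixes X :: "('a, 'c) cell_structure"
  assumes finite_CW: "finite_CW X"
begin

section \<open>Closed skeleta, open cells and their characteristic maps\<close>

lemma Hausdorff: "Hausdorff_space (space X)"
  using finite_CW by (simp add: finite_CW_def)

lemma finite_cells: "finite (cells X k)"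
proof -
  have "Pair k ` cells X k \<subseteq> (SIGMA k:UNIV. cells X k)" by auto
  then have "finite (Pair k ` cells X k)"
    using finite_CW by (meson finite_CW_def finite_subset)
  then show ?thesis by (simp add: finite_image_iff inj_on_def)
qed

lemma continuous_char_map:
  "c \<in> cells X k \<Longrightarrow> continuous_map (disc_top k) (space X) (char_map X k c)"
  and inj_char_map: "c \<in> cells X k \<Longrightarrow> inj_on (char_map X k c) (open_disc k)"
  and char_map_boundary: "c \<in> cells X k \<Longrightarrow> char_map X k c ` (disc k - open_disc k) \<subseteq> carrier_below X k"
  using finite_CW by (simp_all add: finite_CW_def)

lemma open_cells_disjoint:
  assumes "c \<in> cells X k" "d \<in> cells X l" "(k, c) \<noteq> (l, d)"
  shows "open_cell X k c \<inter> open_cell X l d = {}"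
proof -
  have "disjoint_family_on (\<lambda>(k, c). open_cell X k c) (SIGMA k:UNIV. cells X k)"
    using finite_CW by (simp add: finite_CW_def)
  from disjoint_family_onD[OF this, of "(k, c)" "(l, d)"] show ?thesis
    using assms by simp
qed

lemma carrier_below_Suc: "carrier_below X (Suc n) = carrier_below X n \<union> (\<Union>c\<in>cells X n. open_cell X n c)"
  unfolding carrier_below_def lessThan_Suc by auto

lemma carrier_below_mono: "m \<le> n \<Longrightarrow> carrier_below X m \<subseteq> carrier_below X n"
  by (fastforce simp: carrier_below_def)

lemma char_map_disc: "c \<in> cells X k \<Longrightarrow> char_map X k c ` disc k \<subseteq> carrier_below X (Suc k)"
  using char_map_boundary[of c k] by (auto simp: carrier_below_Suc open_cell_def)

lemma open_cell_disjoint_below: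
  "c \<in> cells X k \<Longrightarrow> open_cell X k c \<inter> carrier_below X k = {}"
  using open_cells_disjoint[of c k] by (auto simp: carrier_below_def)

lemma closedin_char_map_disc:
  assumes "c \<in> cells X k" shows "closedin (space X) (char_map X k c ` disc k)"
proof -
  have "compactin (space X) (char_map X k c ` disc k)"
    using image_compactin[OF _ continuous_char_map[OF assms]] compact_space_disc[of k]
    by (metis compact_space_def topspace_disc_top)
  then show ?thesis using Hausdorff compactin_imp_closedin by blast
qed

text \<open>Open cells need not be closed sets. Since the boundary of each ball lands in lower
  cells, closed balls cover the same set, which is thereby a finite union of compact sets and so
  closed.\<close>

lemma carrier_below_eq_discs:
  "carrier_below X n = (\<Union>m<n. \<Union>c\<in>cells X m. char_map X m c ` disc m)"
proof
  show "carrier_below X n \<subseteq> (\<Union>m<n. \<Union>c\<in>cells X m. char_map X m c ` disc m)"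
    using open_disc_subset_disc by (fastforce simp: carrier_below_def open_cell_def)
  have "char_map X m c ` disc m \<subseteq> carrier_below X n" if "m < n" "c \<in> cells X m" for m c
    using char_map_disc[OF that(2)] carrier_below_mono[of "Suc m" n] that by auto
  then show "(\<Union>m<n. \<Union>c\<in>cells X m. char_map X m c ` disc m) \<subseteq> carrier_below X n"
    by blast
qed

lemma closedin_carrier_below: "closedin (space X) (carrier_below X n)"
  unfolding carrier_below_eq_discs
  by (intro closedin_Union finite_imageI) (auto intro!: closedin_Union closedin_char_map_disc finite_cells)

lemma topspace_skeleton: "topspace (skeleton X n) = carrier_below X (Suc n)"
  using closedin_carrier_below[of "Suc n"] closedin_subset by (fastforce simp: skeleton_def)

lemma Hausdorff_skeleton: "Hausdorff_space (skeleton X n)"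
  by (simp add: skeleton_def Hausdorff_space_subtopology Hausdorff)

lemma skeleton_subtopology: "m \<le> n \<Longrightarrow> subtopology (skeleton X n) (carrier_below X (Suc m)) = skeleton X m"
  using carrier_below_mono[of "Suc m" "Suc n"] by (simp add: skeleton_def subtopology_subtopology Int_absorb1)

lemma closedin_skeleton: "closedin (space X) S \<Longrightarrow> S \<subseteq> carrier_below X (Suc n) \<Longrightarrow> closedin (skeleton X n) S"
  by (simp add: skeleton_def closedin_closed_subtopology closedin_carrier_below)

lemma continuous_char_map_skeleton:
  "c \<in> cells X k \<Longrightarrow> continuous_map (disc_top k) (skeleton X k) (char_map X k c)"
  unfolding skeleton_def using continuous_char_map char_map_disc
  by (intro continuous_map_into_subtopology) (auto simp: image_subset_iff)

lemma closed_char_map_skeleton: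
  "c \<in> cells X k \<Longrightarrow> closed_map (disc_top k) (skeleton X k) (char_map X k c)"
  by (simp add: continuous_imp_closed_map compact_space_disc Hausdorff_skeleton continuous_char_map_skeleton)

lemma continuous_attaching_map:
  assumes "e \<in> cells X (Suc n)"
  shows "continuous_map (nsphere n) (skeleton X n) (char_map X (Suc n) e)"
  unfolding skeleton_def
proof (rule continuous_map_into_subtopology)
  have "nsphere n = subtopology (disc_top (Suc n)) (disc (Suc n) - open_disc (Suc n))"
    unfolding nsphere_eq_boundary_disc subtopology_subtopology by (rule arg_cong[of _ _ "subtopology _"]) auto
  then show "continuous_map (nsphere n) (space X) (char_map X (Suc n) e)"
    by (simp add: continuous_char_map[OF assms] continuous_map_from_subtopology)
qed (use char_map_boundary[OF assms] in \<open>auto simp: topspace_nsphere\<close>)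

lemma char_map_in_open_cell_iff:
  assumes "c \<in> cells X k" "x \<in> disc k"
  shows "char_map X k c x \<in> open_cell X k c \<longleftrightarrow> x \<in> open_disc k"
  using assms char_map_boundary[of c k] open_cell_disjoint_below[of c k]
  by (auto simp: open_cell_def)

text \<open>Its complement in the skeleton is the lower skeleton together with the closed balls of
  the other cells of dimension \<open>n\<close>, a finite union of closed sets.\<close>

lemma openin_open_cell:
  assumes "f \<in> cells X n" shows "openin (skeleton X n) (open_cell X n f)"
proof -
  let ?R = "carrier_below X n \<union> (\<Union>c\<in>cells X n - {f}. char_map X n c ` disc n)"
  have R: "?R \<subseteq> carrier_below X (Suc n)"
    using char_map_disc carrier_below_mono[of n "Suc n"] by fastforce
  have "closedin (skeleton X n) ?R"
    by (intro closedin_skeleton R) (auto intro!: closedin_Un closedin_Union closedin_carrier_below closedin_char_map_disc finite_cells)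
  moreover have "open_cell X n f = topspace (skeleton X n) - ?R"
  proof -
    have "open_cell X n f \<inter> char_map X n c ` disc n = {}" if "c \<in> cells X n - {f}" for c
    proof -
      have "char_map X n c ` disc n \<subseteq> open_cell X n c \<union> carrier_below X n"
        using char_map_boundary[of c n] that by (auto simp: open_cell_def)
      then show ?thesis
        using open_cells_disjoint[of f n c n] open_cell_disjoint_below[OF assms] that assms by blast
    qed
    then have "open_cell X n f \<inter> ?R = {}"
      using open_cell_disjoint_below[OF assms] by auto
    moreover have "topspace (skeleton X n) \<subseteq> open_cell X n f \<union> ?R"
    proof -
      have "open_cell X n c \<subseteq> open_cell X n f \<union> ?R" if "c \<in> cells X n" for c
        using that open_cell_subset_disc[of X n c] by (cases "c = f") auto
      then have "(\<Union>c\<in>cells X n. open_cell X n c) \<subseteq> open_cell X n f \<union> ?R"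
        by (rule UN_least)
      then show ?thesis
        unfolding topspace_skeleton carrier_below_Suc by (intro Un_least) auto
    qed
    moreover have "open_cell X n f \<subseteq> topspace (skeleton X n)"
      using assms by (auto simp: topspace_skeleton carrier_below_Suc)
    moreover have "A \<inter> R = {} \<Longrightarrow> T \<subseteq> A \<union> R \<Longrightarrow> A \<subseteq> T \<Longrightarrow> A = T - R" for A R T :: "'a set"
      by blast
    ultimately show ?thesis by presburger
  qed
  ultimately show ?thesis by auto
qed

text \<open>The characteristic map is closed, being defined on a compact space with Hausdorff
  target. Restricting a closed map to a full preimage keeps it closed, and the preimage of the open
  cell is exactly the open ball, where the map is injective.\<close>

lemma homeomorphic_char_map:
  assumes "f \<in> cells X n"
  shows "homeomorphic_map (open_disc_top n) (subtopology (skeleton X n) (open_cell X n f)) (char_map X n f)"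
proof -
  have eq: "subtopology (disc_top n) (open_disc n) = open_disc_top n"
    using open_disc_subset_disc[of n] by (simp add: subtopology_subtopology Int_absorb1)
  have "{x \<in> topspace (disc_top n). char_map X n f x \<in> open_cell X n f} = open_disc n"
    unfolding topspace_disc_top using char_map_in_open_cell_iff[OF assms] open_disc_subset_disc by auto
  from closed_map_restriction[OF closed_char_map_skeleton[OF assms] this]
  have "closed_map (open_disc_top n) (subtopology (skeleton X n) (open_cell X n f)) (char_map X n f)"
    by (simp only: eq)
  moreover have "continuous_map (open_disc_top n) (subtopology (skeleton X n) (open_cell X n f)) (char_map X n f)"
    using continuous_map_from_subtopology[OF continuous_char_map_skeleton[OF assms], of "open_disc n"]
    unfolding eq by (intro continuous_map_into_subtopology) (auto simp: open_cell_def)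
  moreover have "open_cell X n f \<subseteq> topspace (skeleton X n)"
    using openin_open_cell[OF assms] openin_subset by blast
  ultimately show ?thesis
    using inj_char_map[OF assms]
    by (intro bijective_closed_imp_homeomorphic_map) (auto simp: open_cell_def)
qed

section \<open>Pinch maps, centres of cells and the punctured skeleton\<close>

lemma pinch_char_map:
  assumes "f \<in> cells X n" "x \<in> disc n"
  shows "pinch X n f (char_map X n f x) = disc_to_sphere n x"
proof (cases "x \<in> open_disc n")
  case True
  then show ?thesis
    using inj_char_map[OF assms(1)] by (simp add: pinch_def open_cell_def)
next
  case False
  then show ?thesis
    using assms disc_to_sphere_boundary[of x n] by (simp add: pinch_def char_map_in_open_cell_iff)
qed

lemma pinch_outside: "y \<notin> open_cell X n f \<Longrightarrow> pinch X n f y = base_point n"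
  by (simp add: pinch_def)

lemma continuous_pinch:
  assumes "f \<in> cells X n" shows "continuous_map (skeleton X n) (nsphere n) (pinch X n f)"
proof (rule continuous_map_closed_glue[where F = "{f}" and A = "carrier_below X (Suc n) - open_cell X n f"
        and \<Phi> = "char_map X n" and D = "\<lambda>_. disc_top n"])
  show "closedin (skeleton X n) (carrier_below X (Suc n) - open_cell X n f)"
    using openin_open_cell[OF assms] topspace_skeleton by (metis closedin_diff closedin_topspace)
  show "continuous_map (subtopology (skeleton X n) (carrier_below X (Suc n) - open_cell X n f)) (nsphere n) (pinch X n f)"
    by (rule continuous_map_eq[of _ _ "\<lambda>_. base_point n"]) (auto simp: pinch_outside base_point_in_nsphere)
  show "continuous_map (disc_top n) (nsphere n) (pinch X n f \<circ> char_map X n g)" if "g \<in> {f}" for g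
    using that assms by (intro continuous_map_eq[OF continuous_disc_to_sphere]) (auto simp: pinch_char_map)
qed (use assms open_cell_subset_disc[of X n f] closed_char_map_skeleton in \<open>auto simp: topspace_skeleton\<close>)

lemma centre_in_open_cell: "centre X n f \<in> open_cell X n f"
  by (simp add: centre_def open_cell_def)

lemma char_map_eq_centre_iff:
  assumes "f \<in> cells X n" "x \<in> disc n" "g \<in> cells X n"
  shows "char_map X n f x = centre X n g \<longleftrightarrow> g = f \<and> x = (\<lambda>i. 0)"
proof
  assume eq: "char_map X n f x = centre X n g"
  have "centre X n g \<notin> carrier_below X n"
    using centre_in_open_cell open_cell_disjoint_below[OF assms(3)] by fastforce
  then have x: "x \<in> open_disc n"
    using eq char_map_boundary[OF assms(1)] assms(2) by fastforce
  then have "centre X n g \<in> open_cell X n f"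
    using eq unfolding open_cell_def by (metis imageI)
  then have "g = f"
    using open_cells_disjoint[OF assms(1,3)] centre_in_open_cell[of n g] by auto
  then show "g = f \<and> x = (\<lambda>i. 0)"
    using eq x inj_char_map[OF assms(1)] by (auto simp: centre_def inj_on_def)
qed (simp add: centre_def)

text \<open>This makes the pinch onto \<open>f\<close> a map of pairs, from the skeleton and its
  punctured part to the sphere and its complement of the pole.\<close>

lemma pinch_eq_north_pole_iff:
  assumes "f \<in> cells X n"
  shows "pinch X n f y = north_pole n \<longleftrightarrow> y = centre X n f"
proof (cases "y \<in> open_cell X n f")
  case True
  then obtain x where x: "x \<in> open_disc n" "y = char_map X n f x"
    by (auto simp: open_cell_def)
  then have "x \<in> disc n" using open_disc_subset_disc by auto
  then show ?thesis
    using assms char_map_eq_centre_iff[OF assms _ assms]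
    by (simp add: x(2) pinch_char_map disc_to_sphere_eq_north_pole_iff)
next
  case False
  then show ?thesis
    using centre_in_open_cell[of n f] base_point_neq_north_pole by (auto simp: pinch_outside)
qed

text \<open>The punctured skeleton retracts onto the next lower one, radially in each cell.\<close>

definition punctured :: "nat \<Rightarrow> 'a set" where
  "punctured n = topspace (skeleton X n) - centre X n ` cells X n"

definition retract :: "nat \<Rightarrow> 'a \<Rightarrow> 'a" where
  "retract n y = (if y \<in> carrier_below X n then y else
     (let f = (SOME f. f \<in> cells X n \<and> y \<in> open_cell X n f) in
       char_map X n f (radial n (inv_into (open_disc n) (char_map X n f) y))))"

text \<open>On the boundary sphere \<open>radial\<close> is the identity, which matches the clause
  for the lower skeleton. At the origin both sides use the same default value of
  \<open>radial\<close>, so the identity holds there too; only continuity requires the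
  puncture.\<close>

lemma retract_char_map:
  assumes f: "f \<in> cells X (Suc m)" and x: "x \<in> disc (Suc m)"
  shows "retract (Suc m) (char_map X (Suc m) f x) = char_map X (Suc m) f (radial (Suc m) x)"
proof (cases "x \<in> open_disc (Suc m)")
  case True
  let ?y = "char_map X (Suc m) f x"
  have y: "?y \<in> open_cell X (Suc m) f" using True by (auto simp: open_cell_def)
  then have "?y \<notin> carrier_below X (Suc m)"
    using open_cell_disjoint_below[OF f] by auto
  moreover have "(SOME g. g \<in> cells X (Suc m) \<and> ?y \<in> open_cell X (Suc m) g) = f"
    using f y open_cells_disjoint[OF f, of _ "Suc m"] by (intro some_equality) auto
  ultimately show ?thesis
    using inj_char_map[OF f] True by (simp add: retract_def)
next
  case False
  then have "x \<in> topspace (nsphere m)" using x by (simp add: topspace_nsphere)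
  moreover have "char_map X (Suc m) f x \<in> carrier_below X (Suc m)"
    using False x char_map_boundary[OF f] by auto
  ultimately show ?thesis by (simp add: retract_def radial_on_nsphere)
qed

text \<open>Glued from the identity on the lower skeleton and, on each punctured closed ball, radial
  projection followed by the attaching map.\<close>

lemma continuous_retract:
  "continuous_map (subtopology (skeleton X (Suc m)) (punctured (Suc m))) (skeleton X m) (retract (Suc m))"
proof (rule continuous_map_closed_glue[where F = "cells X (Suc m)" and A = "carrier_below X (Suc m)"
        and \<Phi> = "char_map X (Suc m)" and D = "\<lambda>_. subtopology (Euclidean_space (Suc m)) (disc (Suc m) - {\<lambda>i. 0})"])
  let ?n = "Suc m"
  let ?D = "subtopology (Euclidean_space ?n) (disc ?n - {\<lambda>i. 0})"
  have D: "?D = subtopology (disc_top ?n) (disc ?n - {\<lambda>i. 0})"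
    unfolding subtopology_subtopology by (rule arg_cong[of _ _ "subtopology _"]) auto
  have below: "carrier_below X ?n \<subseteq> punctured ?n"
    using carrier_below_mono[of ?n "Suc ?n"] centre_in_open_cell open_cell_disjoint_below
    by (fastforce simp: punctured_def topspace_skeleton)
  show "finite (cells X ?n)" by (rule finite_cells)
  have topD: "topspace ?D = disc ?n - {\<lambda>i. 0}" using disc_subset_Euclidean by auto
  show "topspace (subtopology (skeleton X ?n) (punctured ?n)) \<subseteq>
      carrier_below X ?n \<union> (\<Union>f\<in>cells X ?n. char_map X ?n f ` topspace ?D)"
  proof
    fix y assume "y \<in> topspace (subtopology (skeleton X ?n) (punctured ?n))"
    then have y: "y \<in> carrier_below X (Suc ?n)" "y \<notin> centre X ?n ` cells X ?n"
      by (auto simp: punctured_def topspace_skeleton)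
    show "y \<in> carrier_below X ?n \<union> (\<Union>f\<in>cells X ?n. char_map X ?n f ` topspace ?D)"
    proof (cases "y \<in> carrier_below X ?n")
      case False
      then obtain f where f: "f \<in> cells X ?n" "y \<in> open_cell X ?n f"
        using y by (auto simp: carrier_below_Suc)
      then obtain x where x: "x \<in> open_disc ?n" "y = char_map X ?n f x"
        by (auto simp: open_cell_def)
      moreover have "x \<noteq> (\<lambda>i. 0)" using y(2) x f by (auto simp: centre_def)
      ultimately have "x \<in> topspace ?D" unfolding topD using open_disc_subset_disc by auto
      then show ?thesis using x f by auto
    qed simp
  qed
  show "closedin (subtopology (skeleton X ?n) (punctured ?n)) (carrier_below X ?n)"
    using below closedin_carrier_below carrier_below_mono[of ?n "Suc ?n"]
    by (intro closedin_subset_topspace closedin_skeleton) auto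
  have "subtopology (subtopology (skeleton X ?n) (punctured ?n)) (carrier_below X ?n) = skeleton X m"
    using below skeleton_subtopology[of m ?n] by (simp add: subtopology_subtopology Int_absorb1)
  moreover have "continuous_map (skeleton X m) (skeleton X m) (retract ?n)"
    by (rule continuous_map_eq[OF continuous_map_id]) (auto simp: retract_def topspace_skeleton)
  ultimately show "continuous_map (subtopology (subtopology (skeleton X ?n) (punctured ?n)) (carrier_below X ?n)) (skeleton X m) (retract ?n)"
    by simp
  fix f assume f: "f \<in> cells X ?n"
  \<comment> \<open>A punctured ball is not compact, so closedness of the restricted characteristic
    map comes from this description of the ball as a full preimage.\<close>
  have "{x \<in> topspace (disc_top ?n). char_map X ?n f x \<in> punctured ?n} = disc ?n - {\<lambda>i. 0}"
    unfolding topspace_disc_top using char_map_disc[OF f] char_map_eq_centre_iff[OF f] f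
    by (auto simp: punctured_def topspace_skeleton)
  from closed_map_restriction[OF closed_char_map_skeleton[OF f] this]
  show "closed_map ?D (subtopology (skeleton X ?n) (punctured ?n)) (char_map X ?n f)"
    by (simp only: D)
  have "continuous_map ?D (skeleton X m) (char_map X ?n f \<circ> radial ?n)"
    by (rule continuous_map_compose[OF continuous_map_radial continuous_attaching_map[OF f]]) auto
  then show "continuous_map ?D (skeleton X m) (retract ?n \<circ> char_map X ?n f)"
    by (rule continuous_map_eq) (auto simp: retract_char_map[OF f])
qed

end

section \<open>The cellular boundary squares to zero\<close>

text \<open>The map factors through the pair \<open>({b}, {b})\<close>, whose relative homology is
  trivial. It handles the pinch onto one cell when restricted to another cell.\<close>

lemma hom_induced_const_trivial:
  assumes "b \<in> topspace Y" "b \<in> T"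
  shows "hom_induced p X S Y T (\<lambda>x. b) w = \<one>\<^bsub>relative_homology_group p Y T\<^esub>"
proof -
  let ?B = "subtopology Y {b}"
  have B: "topspace ?B = {b}" using assms by auto
  have triv: "trivial_group (relative_homology_group p ?B {b})"
    using trivial_relative_homology_group_topspace[of p ?B] unfolding B .
  have "hom_induced p X S Y T (id \<circ> (\<lambda>x. b)) w
      = hom_induced p ?B {b} Y T id (hom_induced p X S ?B {b} (\<lambda>x. b) w)"
    using assms by (subst hom_induced_compose[where Y = ?B and T = "{b}"])
      (auto simp: continuous_map_in_subtopology continuous_map_from_subtopology)
  moreover have "hom_induced p X S ?B {b} (\<lambda>x. b) w = \<one>\<^bsub>relative_homology_group p ?B {b}\<^esub>"
    using triv hom_induced_carrier[of p X S ?B "{b}"] by (auto simp: trivial_group_def)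
  moreover have "hom_induced p ?B {b} Y T id \<one>\<^bsub>relative_homology_group p ?B {b}\<^esub> = \<one>\<^bsub>relative_homology_group p Y T\<^esub>"
    by (rule hom_one[OF hom_induced_hom]) simp_all
  ultimately show ?thesis by (simp add: o_def)
qed

text \<open>The powers of \<open>w\<close> to the exponent \<open>l h\<close> and of
  \<open>h\<close> to the exponent \<open>l w\<close> have the same image under \<open>l\<close>, so
  they coincide by injectivity; applying \<open>u\<close> gives
  \<open>l h * u w = u h * l w\<close>. This replaces the computation of a local degree by an
  unspecified ratio.\<close>

lemma hom_int_ratio:
  assumes "group G" and l: "l \<in> hom G integer_group" "inj_on l (carrier G)" and u: "u \<in> hom G integer_group"
  obtains c1 c2 where "c1 \<noteq> 0" "\<And>w. w \<in> carrier G \<Longrightarrow> c1 * u w = c2 * l w"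
proof -
  interpret group G by fact
  interpret l: group_hom G integer_group l
    using l by (simp add: group_hom_def group_hom_axioms_def is_group)
  interpret u: group_hom G integer_group u
    using u by (simp add: group_hom_def group_hom_axioms_def is_group)
  show thesis
  proof (cases "\<exists>h\<in>carrier G. l h \<noteq> 0")
    case True
    then obtain h where h: "h \<in> carrier G" "l h \<noteq> 0" by blast
    have "l h * u w = u h * l w" if w: "w \<in> carrier G" for w
    proof -
      have "l (w [^]\<^bsub>G\<^esub> l h) = l (h [^]\<^bsub>G\<^esub> l w)"
        using h w by (simp add: l.hom_int_pow)
      then have "w [^]\<^bsub>G\<^esub> l h = h [^]\<^bsub>G\<^esub> l w"
        using l(2) h w by (simp add: inj_on_def)
      then have "u (w [^]\<^bsub>G\<^esub> l h) = u (h [^]\<^bsub>G\<^esub> l w)" by simp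
      then show ?thesis using h w by (simp add: u.hom_int_pow mult.commute)
    qed
    then show thesis using that[of "l h" "u h"] h(2) by blast
  next
    case False
    have "u w = 0" if "w \<in> carrier G" for w
    proof -
      have "l w = l \<one>\<^bsub>G\<^esub>" using False that by simp
      then have "w = \<one>\<^bsub>G\<^esub>" using l(2) that by (simp add: inj_on_def)
      then show ?thesis using u.hom_one by simp
    qed
    then show thesis by (intro that[of 1 0]) auto
  qed
qed

lemma Brouwer_degree2_iso_integer:
  assumes b: "b \<in> iso (reduced_homology_group (int p) (nsphere p)) integer_group"
    and x: "x \<in> carrier (reduced_homology_group (int p) (nsphere p))"
  shows "b (hom_induced (int p) (nsphere p) {} (nsphere p) {} f x) = Brouwer_degree2 p f * b x"
proof -
  interpret b: group_hom "reduced_homology_group (int p) (nsphere p)" integer_group b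
    using b by (simp add: group_hom_def group_hom_axioms_def iso_def)
  show ?thesis by (simp add: Brouwer_degree2[OF x] b.hom_int_pow[OF x])
qed

context CW
begin

text \<open>Moves the generators of the relative group from the open cells to the standard ball, so
  that all cells of one dimension are measured in one model group.\<close>

lemma induced_char_map_from_open_cell:
  assumes f: "f \<in> cells X n" 
    and w: "w \<in> carrier (relative_homology_group p (subtopology (skeleton X n) (open_cell X n f)) (open_cell X n f - {centre X n f}))"
  shows "\<exists>w' \<in> carrier (relative_homology_group p (open_disc_top n) (punctured_disc n)).
    hom_induced p (subtopology (skeleton X n) (open_cell X n f)) (open_cell X n f - {centre X n f}) (skeleton X n) (punctured n) id w
    = hom_induced p (open_disc_top n) (punctured_disc n) (skeleton X n) (punctured n) (char_map X n f) w'"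
proof -
  let ?V = "subtopology (skeleton X n) (open_cell X n f)"
  have im: "char_map X n f ` punctured_disc n = open_cell X n f - {centre X n f}"
    using inj_char_map[OF f] by (auto simp: open_cell_def centre_def inj_on_def)
  have "hom_induced p (open_disc_top n) (punctured_disc n) ?V (open_cell X n f - {centre X n f}) (char_map X n f)
      \<in> iso (relative_homology_group p (open_disc_top n) (punctured_disc n)) (relative_homology_group p ?V (open_cell X n f - {centre X n f}))"
    by (rule homeomorphic_map_relative_homology_iso[OF homeomorphic_char_map[OF f]]) (use im in auto)
  then have "w \<in> hom_induced p (open_disc_top n) (punctured_disc n) ?V (open_cell X n f - {centre X n f}) (char_map X n f)
      ` carrier (relative_homology_group p (open_disc_top n) (punctured_disc n))"
    using w by (simp add: iso_def bij_betw_def)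
  then obtain w' where w': "w' \<in> carrier (relative_homology_group p (open_disc_top n) (punctured_disc n))"
      "w = hom_induced p (open_disc_top n) (punctured_disc n) ?V (open_cell X n f - {centre X n f}) (char_map X n f) w'"
    unfolding image_iff by blast
  have "open_cell X n f - {centre X n f} \<subseteq> punctured n"
  proof -
    have "centre X n g \<notin> open_cell X n f" if "g \<in> cells X n" "g \<noteq> f" for g
      using open_cells_disjoint[OF that(1) f] that(2) centre_in_open_cell[of n g] by auto
    then show ?thesis
      using openin_subset[OF openin_open_cell[OF f]] by (auto simp: punctured_def)
  qed
  moreover have "continuous_map (open_disc_top n) ?V (char_map X n f)"
    using homeomorphic_char_map[OF f] homeomorphic_imp_continuous_map by blast
  ultimately have "hom_induced p ?V (open_cell X n f - {centre X n f}) (skeleton X n) (punctured n) id w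
    = hom_induced p (open_disc_top n) (punctured_disc n) (skeleton X n) (punctured n) (id \<circ> char_map X n f) w'"
    unfolding w'(2) using im
    by (intro hom_induced_compose') (auto simp: continuous_map_from_subtopology)
  with w'(1) show ?thesis by auto
qed

lemma continuous_char_map_open:
  "f \<in> cells X n \<Longrightarrow> continuous_map (open_disc_top n) (skeleton X n) (char_map X n f)"
  using homeomorphic_imp_continuous_map[OF homeomorphic_char_map] continuous_map_in_subtopology by blast

lemma char_map_punctured:
  assumes "f \<in> cells X n" shows "char_map X n f \<in> punctured_disc n \<rightarrow> punctured n"
proof
  fix x assume x: "x \<in> punctured_disc n"
  then have "x \<in> disc n" using open_disc_subset_disc by auto
  then show "char_map X n f x \<in> punctured n"
    using x char_map_disc[OF assms] char_map_eq_centre_iff[OF assms]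
    by (auto simp: punctured_def topspace_skeleton)
qed

text \<open>Two homomorphisms to the integers are compared on the homology of the
  \<open>n\<close>-skeleton relative to its punctured part, with \<open>n = Suc m\<close>: one goes
  through the boundary map and a pinch onto \<open>g\<close>, the other sums the pinches onto the
  \<open>n\<close>-cells, weighted by incidence with \<open>g\<close>. They are proportional on
  generators, hence everywhere, and are then evaluated on the class of the attaching map of
  \<open>e\<close>.\<close>

theorem incidence_compose_eq_0:
  assumes e: "e \<in> cells X (Suc (Suc m))" and g: "g \<in> cells X m"
  shows "(\<Sum>f\<in>cells X (Suc m). incidence X (Suc m) e f * incidence X m f g) = 0"
proof -
  define n where "n = Suc m"
  note n_def [simp]
  define Y where "Y = skeleton X n"
  define U where "U = punctured n"
  define S where "S = topspace (nsphere n) - {north_pole n}"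
  \<comment> \<open>Reduced homology makes these groups infinite cyclic in dimension 0 as well, so
    \<open>m = 0\<close> is no special case.\<close>
  let ?R = "\<lambda>p. reduced_homology_group (int p) (nsphere p)"
  let ?D = "open_disc_top n" and ?P = "punctured_disc n"
  let ?DP = "subtopology ?D ?P"
  let ?G = "relative_homology_group (int n) Y U"
  let ?H = "relative_homology_group (int n) ?D ?P"
  let ?YU = "subtopology Y U"
  let ?N = "relative_homology_group (int n) (nsphere n) S"
  obtain bm where bm: "bm \<in> iso (?R m) integer_group"
    using reduced_homology_group_nsphere(1)[of m] unfolding is_iso_def by blast
  obtain bn where bn: "bn \<in> iso (?R n) integer_group"
    using reduced_homology_group_nsphere(1)[of n] unfolding is_iso_def by blast
  have bmh: "bm \<in> hom (?R m) integer_group" using bm by (simp add: iso_def)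
  define j where "j = hom_induced (int n) (nsphere n) {} (nsphere n) S id"
  have j: "j \<in> iso (?R n) ?N"
    unfolding j_def
  proof (rule iso_reduced_homology_by_contractible)
    show "contractible_space (subtopology (nsphere n) S)"
      unfolding S_def by (rule contractible_nsphere_minus_pole)
    show "topspace (nsphere n) \<inter> S \<noteq> {}"
      using base_point_in_nsphere[of n] base_point_neq_north_pole[of n] by (auto simp: S_def)
  qed
  \<comment> \<open>Reads a class of the sphere relative to its contractible part \<open>S\<close>
    as an integer, through the inverse of the isomorphism \<open>j\<close>.\<close>
  define \<kappa> where "\<kappa> = bn \<circ> inv_into (carrier (?R n)) j"
  have \<kappa>: "\<kappa> \<in> hom ?N integer_group"
    unfolding \<kappa>_def
    using group.iso_set_sym[OF group_reduced_homology_group j] bn by (auto intro: hom_compose simp: iso_def)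
  have \<kappa>j: "\<kappa> (j x) = bn x" if "x \<in> carrier (?R n)" for x
    using j that by (simp add: \<kappa>_def iso_def bij_betw_def)
  \<comment> \<open>After a characteristic map, \<open>q\<close> becomes \<open>radial\<close>
    followed by the pinched attaching map, whose degree is an incidence number.\<close>
  define q where "q = pinch X m g \<circ> retract n"
  have q: "continuous_map ?YU (nsphere m) q"
    unfolding q_def Y_def U_def n_def by (rule continuous_map_compose[OF continuous_retract continuous_pinch[OF g]])
  define \<delta> where "\<delta> = bm \<circ> (hom_induced (int m) ?YU {} (nsphere m) {} q \<circ> hom_boundary (int n) Y U)"
  have bdY: "hom_boundary (int n) Y U \<in> hom ?G (reduced_homology_group (int m) ?YU)"
    using hom_boundary_reduced_hom[of "int n" Y U] by simp
  have bdD: "hom_boundary (int n) ?D ?P \<in> hom ?H (reduced_homology_group (int m) ?DP)"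
    using hom_boundary_reduced_hom[of "int n" ?D ?P] by simp
  have \<delta>: "\<delta> \<in> hom ?G integer_group"
    unfolding \<delta>_def by (intro hom_compose[OF _ bmh] hom_compose[OF bdY] hom_induced_reduced_hom)
  define \<rho> where "\<rho> = hom_induced (int m) ?DP {} (nsphere m) {} (radial n) \<circ> hom_boundary (int n) ?D ?P"
  have \<rho>: "\<rho> \<in> hom ?H (?R m)"
    unfolding \<rho>_def by (intro hom_compose[OF bdD] hom_induced_reduced_hom)
  \<comment> \<open>\<open>\<mu>\<close> is the local contribution of the collapse of the standard
    ball, the same for every cell; its value is left undetermined and related to
    \<open>bm \<circ> \<rho>\<close> only through \<open>c1\<close> and \<open>c2\<close>.\<close>
  define \<mu> where "\<mu> = \<kappa> \<circ> hom_induced (int n) ?D ?P (nsphere n) S (disc_to_sphere n)"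
  define \<pi> where "\<pi> f = \<kappa> \<circ> hom_induced (int n) Y U (nsphere n) S (pinch X n f)" for f
  have \<mu>: "\<mu> \<in> hom ?H integer_group" and \<pi>: "\<pi> f \<in> hom ?G integer_group" for f
    unfolding \<mu>_def \<pi>_def by (intro hom_compose[OF hom_induced_hom \<kappa>])+
  have inj: "inj_on (bm \<circ> \<rho>) (carrier ?H)"
  proof -
    have "inj_on \<rho> (carrier ?H)"
      using inj_on_radial_boundary[of m] by (simp add: \<rho>_def o_def)
    moreover have "inj_on bm (\<rho> ` carrier ?H)"
      using bm \<rho> by (auto simp: iso_def bij_betw_def hom_def intro: inj_on_subset)
    ultimately show ?thesis by (rule comp_inj_on)
  qed
  obtain c1 c2 where c: "c1 \<noteq> 0" "\<And>w. w \<in> carrier ?H \<Longrightarrow> c1 * \<mu> w = c2 * (bm \<circ> \<rho>) w"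
    using hom_int_ratio[OF group_relative_homology_group hom_compose[OF \<rho> bmh] inj \<mu>] by metis
  define \<iota> where "\<iota> f = hom_induced (int n) ?D ?P Y U (char_map X n f)" for f
  have cont: "continuous_map ?D Y (char_map X n f)" "char_map X n f \<in> ?P \<rightarrow> U" if "f \<in> cells X n" for f
    using continuous_char_map_open[OF that] char_map_punctured[OF that] by (simp_all add: Y_def U_def)
  have pin: "continuous_map Y (nsphere n) (pinch X n f)" "pinch X n f \<in> U \<rightarrow> S" if f: "f \<in> cells X n" for f
  proof -
    show cp: "continuous_map Y (nsphere n) (pinch X n f)" using continuous_pinch[OF f] by (simp add: Y_def)
    show "pinch X n f \<in> U \<rightarrow> S"
      using continuous_map_image_subset_topspace[OF cp] pinch_eq_north_pole_iff[OF f] f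
      by (auto simp: S_def U_def punctured_def Y_def)
  qed
  have \<delta>\<iota>: "\<delta> (\<iota> f w) = incidence X m f g * (bm \<circ> \<rho>) w" if f: "f \<in> cells X n" and w: "w \<in> carrier ?H" for f w
  proof -
    let ?b = "hom_boundary (int n) ?D ?P w"
    have "hom_boundary (int n) Y U (\<iota> f w) = hom_induced (int m) ?DP {} ?YU {} (char_map X n f) ?b"
      using naturality_hom_induced[OF cont[OF f], of "int n"] by (simp add: \<iota>_def fun_eq_iff)
    moreover have cDP: "continuous_map ?DP ?YU (char_map X n f)"
      using cont[OF f] by (auto simp: continuous_map_in_subtopology continuous_map_from_subtopology)
    ultimately have "\<delta> (\<iota> f w) = bm (hom_induced (int m) ?DP {} (nsphere m) {} (q \<circ> char_map X n f) ?b)"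
      using q by (simp add: \<delta>_def hom_induced_compose_empty)
    also have "hom_induced (int m) ?DP {} (nsphere m) {} (q \<circ> char_map X n f)
        = hom_induced (int m) ?DP {} (nsphere m) {} ((pinch X m g \<circ> char_map X n f) \<circ> radial n)"
    proof (rule hom_induced_eq)
      fix x assume "x \<in> topspace ?DP"
      then have "x \<in> disc n" using open_disc_subset_disc by auto
      then show "(q \<circ> char_map X n f) x = ((pinch X m g \<circ> char_map X n f) \<circ> radial n) x"
        using retract_char_map[of f m x] f by (simp add: q_def)
    qed
    also have "\<dots> = hom_induced (int m) (nsphere m) {} (nsphere m) {} (pinch X m g \<circ> char_map X n f) \<circ> hom_induced (int m) ?DP {} (nsphere m) {} (radial n)"
    proof (rule hom_induced_compose_empty)
      have "?DP = subtopology (Euclidean_space n) ?P"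
        unfolding subtopology_subtopology by (rule arg_cong[of _ _ "subtopology _"]) auto
      then show "continuous_map ?DP (nsphere m) (radial n)"
        using continuous_map_radial[of ?P m] by simp
      show "continuous_map (nsphere m) (nsphere m) (pinch X m g \<circ> char_map X n f)"
        using continuous_map_compose[OF continuous_attaching_map continuous_pinch[OF g]] f by simp
    qed
    finally have "\<delta> (\<iota> f w) = bm (hom_induced (int m) (nsphere m) {} (nsphere m) {} (pinch X m g \<circ> char_map X n f) (\<rho> w))"
      by (simp add: \<rho>_def)
    also have "\<dots> = incidence X m f g * bm (\<rho> w)"
      using Brouwer_degree2_iso_integer[OF bm hom_in_carrier[OF \<rho> w]] by (simp add: incidence_def)
    finally show ?thesis by simp
  qed
  \<comment> \<open>A cell other than \<open>f\<close> is pinched entirely to the base point, which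
    lies in \<open>S\<close>; so \<open>\<pi> f\<close> detects only the contribution of
    \<open>f\<close>.\<close>
  have \<pi>\<iota>: "\<pi> f (\<iota> f' w) = (if f = f' then \<mu> w else 0)"
    if f: "f \<in> cells X n" and f': "f' \<in> cells X n" for f f' w
  proof -
    have "\<pi> f (\<iota> f' w) = \<kappa> (hom_induced (int n) ?D ?P (nsphere n) S (pinch X n f \<circ> char_map X n f') w)"
      using hom_induced_compose'[OF cont[OF f'] pin[OF f]] by (simp add: \<pi>_def \<iota>_def)
    also have "hom_induced (int n) ?D ?P (nsphere n) S (pinch X n f \<circ> char_map X n f')
      = hom_induced (int n) ?D ?P (nsphere n) S (if f = f' then disc_to_sphere n else (\<lambda>_. base_point n))"
    proof (rule hom_induced_eq)
      fix x assume "x \<in> topspace ?D"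
      then have x: "x \<in> open_disc n" "x \<in> disc n" using open_disc_subset_disc by auto
      show "(pinch X n f \<circ> char_map X n f') x = (if f = f' then disc_to_sphere n else (\<lambda>_. base_point n)) x"
      proof (cases "f = f'")
        case False
        then have "char_map X n f' x \<notin> open_cell X n f"
          using open_cells_disjoint[OF f f'] x by (auto simp: open_cell_def)
        with False show ?thesis by (simp add: pinch_outside)
      qed (use x pinch_char_map[OF f'] in simp)
    qed
    finally show ?thesis
      using hom_induced_const_trivial[of "base_point n" "nsphere n" S "int n" ?D ?P w] base_point_in_nsphere[of n] base_point_neq_north_pole[of n]
        hom_one[OF \<kappa>]
      by (auto simp: \<mu>_def S_def)
  qed
  \<comment> \<open>On the generator from cell \<open>f\<close> both terms equal the incidence of
    \<open>f\<close> with \<open>g\<close> times \<open>c2 * (bm \<circ> \<rho>) w\<close>, by the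
    choice of \<open>c1\<close> and \<open>c2\<close>; hence \<open>h\<close> vanishes on the whole
    group.\<close>
  define h where "h z = c2 * \<delta> z - c1 * (\<Sum>f\<in>cells X n. incidence X m f g * \<pi> f z)" for z
  have h: "h \<in> hom ?G integer_group"
  proof (rule homI)
    fix x y assume xy: "x \<in> carrier ?G" "y \<in> carrier ?G"
    have "\<delta> (x \<otimes>\<^bsub>?G\<^esub> y) = \<delta> x + \<delta> y" "\<pi> f (x \<otimes>\<^bsub>?G\<^esub> y) = \<pi> f x + \<pi> f y" for f
      using hom_mult[OF \<delta> xy] hom_mult[OF \<pi> xy] by simp_all
    then show "h (x \<otimes>\<^bsub>?G\<^esub> y) = h x \<otimes>\<^bsub>integer_group\<^esub> h y"
      by (simp only: h_def mult_integer_group distrib_left sum.distrib)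
  qed simp
  have hG: "group_hom ?G integer_group h"
    using h by (simp add: group_hom_def group_hom_axioms_def)
  have "carrier (relative_homology_group (int n) Y (topspace Y - centre X n ` cells X n)) \<subseteq> kernel ?G integer_group h"
  proof (rule subgroup_carrier_induct_open_pieces[where V = "open_cell X n"])
    have U: "topspace Y - centre X n ` cells X n = U" by (simp add: U_def Y_def punctured_def)
    show "finite (cells X n)" by (rule finite_cells)
    show "t1_space Y" unfolding Y_def by (rule Hausdorff_imp_t1_space[OF Hausdorff_skeleton])
    show "openin Y (open_cell X n f) \<and> centre X n f \<in> open_cell X n f" if "f \<in> cells X n" for f
      unfolding Y_def using openin_open_cell[OF that] centre_in_open_cell by blast
    show "pairwise (\<lambda>f g. disjnt (open_cell X n f) (open_cell X n g)) (cells X n)"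
      using open_cells_disjoint by (simp add: pairwise_def disjnt_def)
    show "subgroup (kernel ?G integer_group h) (relative_homology_group (int n) Y (topspace Y - centre X n ` cells X n))"
      unfolding U by (rule group_hom.subgroup_kernel[OF hG])
    fix f w assume f: "f \<in> cells X n" and w: "w \<in> carrier (relative_homology_group (int n) (subtopology Y (open_cell X n f)) (open_cell X n f - {centre X n f}))"
    obtain w' where w': "w' \<in> carrier ?H"
      "hom_induced (int n) (subtopology Y (open_cell X n f)) (open_cell X n f - {centre X n f}) Y U id w = \<iota> f w'"
      using induced_char_map_from_open_cell[OF f w[unfolded Y_def]] unfolding \<iota>_def Y_def U_def by blast
    have "(\<Sum>f'\<in>cells X n. incidence X m f' g * \<pi> f' (\<iota> f w')) = incidence X m f g * \<mu> w'"
      using f by (simp add: \<pi>\<iota> finite_cells if_distrib[of "\<lambda>x. _ * x"] cong: if_cong)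
    then have "h (\<iota> f w') = 0"
      using c(2)[OF w'(1)] by (simp add: h_def \<delta>\<iota>[OF f w'(1)] algebra_simps)
    then show "hom_induced (int n) (subtopology Y (open_cell X n f)) (open_cell X n f - {centre X n f}) Y (topspace Y - centre X n ` cells X n) id w \<in> kernel ?G integer_group h"
      unfolding U w'(2) by (simp add: kernel_def \<iota>_def hom_induced_carrier)
  qed
  then have h0: "h z = 0" if "z \<in> carrier ?G" for z
    using that by (auto simp: U_def Y_def punctured_def kernel_def)
  obtain s where s: "s \<in> carrier (?R n)" "bn s = 1"
  proof -
    have "1 \<in> bn ` carrier (?R n)" using bn by (simp add: iso_def bij_betw_def)
    then show thesis using that by auto
  qed
  have s': "s \<in> carrier (homology_group (int n) (nsphere n))"
    using s carrier_reduced_homology_group_subset by blast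
  define \<phi> where "\<phi> = char_map X (Suc n) e"
  have \<phi>: "continuous_map (nsphere n) Y \<phi>"
    unfolding \<phi>_def Y_def using continuous_attaching_map[of e n] e by simp
  define \<alpha> where "\<alpha> = hom_induced (int n) (nsphere n) {} Y {} \<phi> s"
  \<comment> \<open>Coming from absolute homology, \<open>z\<close> has trivial boundary, while its
    pinches have the incidence numbers of \<open>e\<close> as degrees, because \<open>s\<close> is a
    generator with \<open>bn s = 1\<close>.\<close>
  define z where "z = hom_induced (int n) Y {} Y U id \<alpha>"
  have z: "z \<in> carrier ?G" by (simp add: z_def hom_induced_carrier)
  have "hom_boundary (int n) Y U z = \<one>\<^bsub>homology_group (int n - 1) ?YU\<^esub>"
  proof -
    have "z \<in> kernel ?G (homology_group (int n - 1) ?YU) (hom_boundary (int n) Y U)"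
      using homology_exactness_axiom_1[of "int n" Y U] hom_induced_carrier[of "int n" "nsphere n" "{}" Y "{}" \<phi> s]
      by (auto simp: z_def \<alpha>_def)
    then show ?thesis by (simp add: kernel_def)
  qed
  then have "\<delta> z = 0"
    using hom_one[OF hom_induced_reduced_hom, of "int m" ?YU "nsphere m" q] hom_one[OF bmh]
    by (simp add: \<delta>_def one_reduced_homology_group)
  moreover have "\<pi> f z = incidence X n e f" if f: "f \<in> cells X n" for f
  proof -
    have "hom_induced (int n) Y U (nsphere n) S (pinch X n f) z
        = hom_induced (int n) (nsphere n) {} (nsphere n) S (pinch X n f \<circ> \<phi>) s"
      unfolding z_def \<alpha>_def using \<phi> pin[OF f] by (simp add: hom_induced_compose' o_assoc)
    also have "\<dots> = j (hom_induced (int n) (nsphere n) {} (nsphere n) {} (pinch X n f \<circ> \<phi>) s)"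
      unfolding j_def using continuous_map_compose[OF \<phi> pin(1)[OF f]] by (simp add: hom_induced_compose')
    finally have "\<pi> f z = bn (hom_induced (int n) (nsphere n) {} (nsphere n) {} (pinch X n f \<circ> \<phi>) s)"
      using \<kappa>j[OF hom_induced_reduced[OF s(1)]] by (simp add: \<pi>_def)
    also have "\<dots> = incidence X n e f"
      using Brouwer_degree2_iso_integer[OF bn s(1)] s(2) by (simp add: incidence_def \<phi>_def)
    finally show ?thesis .
  qed
  ultimately have "c1 * (\<Sum>f\<in>cells X n. incidence X m f g * incidence X n e f) = 0"
    using h0[OF z] by (simp add: h_def)
  then show ?thesis using c(1) by (simp add: mult.commute)
qed

end

section \<open>Indices of subgroups\<close>

definition add_subgroup :: "'a::ab_group_add set \<Rightarrow> bool" where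
  "add_subgroup S \<longleftrightarrow> 0 \<in> S \<and> (\<forall>x\<in>S. \<forall>y\<in>S. x - y \<in> S)"

definition add_cosets :: "'a::ab_group_add set \<Rightarrow> 'a set \<Rightarrow> 'a set set" where
  "add_cosets G H = (\<lambda>x. (+) x ` H) ` G"

text \<open>With infinitely many cosets the value is 0, so positivity of the index expresses its
  finiteness.\<close>

definition add_index :: "'a::ab_group_add set \<Rightarrow> 'a set \<Rightarrow> nat" where
  "add_index G H = card (add_cosets G H)"

lemma add_subgroupD:
  assumes "add_subgroup S"
  shows "0 \<in> S" "x \<in> S \<Longrightarrow> y \<in> S \<Longrightarrow> x - y \<in> S" "x \<in> S \<Longrightarrow> - x \<in> S" "x \<in> S \<Longrightarrow> y \<in> S \<Longrightarrow> x + y \<in> S"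
proof -
  show 0: "0 \<in> S" and d: "x \<in> S \<Longrightarrow> y \<in> S \<Longrightarrow> x - y \<in> S" for x y
    using assms by (auto simp: add_subgroup_def)
  show n: "x \<in> S \<Longrightarrow> - x \<in> S" for x using d[OF 0, of x] by simp
  show "x \<in> S \<Longrightarrow> y \<in> S \<Longrightarrow> x + y \<in> S" using d[of x "- y"] n[of y] by simp
qed

lemma coset_eq_iff:
  assumes "add_subgroup H"
  shows "(+) x ` H = (+) y ` H \<longleftrightarrow> x - y \<in> H"
proof
  assume "(+) x ` H = (+) y ` H"
  moreover have "x \<in> (+) x ` H" using add_subgroupD(1)[OF assms] by force
  ultimately obtain h where "h \<in> H" "x = y + h" by auto
  then show "x - y \<in> H" by simp
next
  assume d: "x - y \<in> H"
  have "(+) x ` H \<subseteq> (+) y ` H" if "x - y \<in> H" for x y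
  proof
    fix z assume "z \<in> (+) x ` H"
    then obtain h where "h \<in> H" "z = x + h" by auto
    then have "z = y + ((x - y) + h)" "(x - y) + h \<in> H"
      using that add_subgroupD(4)[OF assms] by auto
    then show "z \<in> (+) y ` H" by blast
  qed
  from this[OF d] this[of y x] show "(+) x ` H = (+) y ` H"
    using add_subgroupD(3)[OF assms d] by auto
qed

text \<open>A choice \<open>r\<close> of representatives for the cosets of \<open>K\<close> in
  \<open>G\<close> turns a pair of cosets into a coset of \<open>H\<close> in \<open>G\<close>,
  bijectively. Infinite indices are covered too, since \<open>card\<close> of a product is
  multiplicative also with the value 0.\<close>

lemma index_tower:
  assumes G: "add_subgroup G" and K: "add_subgroup K" and H: "add_subgroup H" and "H \<subseteq> K" "K \<subseteq> G"
  shows "add_index G H = add_index G K * add_index K H"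
proof -
  define r where "r C = (SOME x. x \<in> G \<and> C = (+) x ` K)" for C
  have r: "r C \<in> G \<and> C = (+) (r C) ` K" if "C \<in> add_cosets G K" for C
    unfolding r_def by (rule someI_ex) (use that in \<open>auto simp: add_cosets_def\<close>)
  have plus_image: "(+) x ` (+) y ` S = (+) (x + y) ` S" for x y and S :: "'a set"
    by (auto simp: image_iff add.assoc)
  have "bij_betw (\<lambda>(C, D). (+) (r C) ` D) (add_cosets G K \<times> add_cosets K H) (add_cosets G H)"
  proof (rule bij_betwI')
    fix P P' assume P: "P \<in> add_cosets G K \<times> add_cosets K H" and P': "P' \<in> add_cosets G K \<times> add_cosets K H"
    obtain C k where C: "P = (C, (+) k ` H)" "C \<in> add_cosets G K" "k \<in> K" using P by (auto simp: add_cosets_def)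
    obtain C' k' where C': "P' = (C', (+) k' ` H)" "C' \<in> add_cosets G K" "k' \<in> K" using P' by (auto simp: add_cosets_def)
    show "((case P of (C, D) \<Rightarrow> (+) (r C) ` D) = (case P' of (C, D) \<Rightarrow> (+) (r C) ` D)) = (P = P')"
    proof
      assume "(case P of (C, D) \<Rightarrow> (+) (r C) ` D) = (case P' of (C, D) \<Rightarrow> (+) (r C) ` D)"
      then have d: "(r C + k) - (r C' + k') \<in> H"
        by (simp add: C(1) C'(1) plus_image coset_eq_iff[OF H])
      have "r C - r C' = ((r C + k) - (r C' + k')) - (k - k')" by simp
      then have "r C - r C' \<in> K"
        using add_subgroupD(2)[OF K] d C(3) C'(3) assms(4) by (metis subsetD)
      then have "C = C'" using r[OF C(2)] r[OF C'(2)] coset_eq_iff[OF K] by metis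
      with d have "k - k' \<in> H" by simp
      then show "P = P'" using \<open>C = C'\<close> by (simp add: C(1) C'(1) coset_eq_iff[OF H])
    qed simp
  next
    fix P assume P: "P \<in> add_cosets G K \<times> add_cosets K H"
    obtain C k where C: "P = (C, (+) k ` H)" "C \<in> add_cosets G K" "k \<in> K" using P by (auto simp: add_cosets_def)
    have "r C + k \<in> G" using r[OF C(2)] C(3) assms(5) add_subgroupD(4)[OF G] by blast
    then show "(case P of (C, D) \<Rightarrow> (+) (r C) ` D) \<in> add_cosets G H"
      by (simp add: C(1) plus_image add_cosets_def)
  next
    fix D assume "D \<in> add_cosets G H"
    then obtain x where x: "x \<in> G" "D = (+) x ` H" by (auto simp: add_cosets_def)
    let ?C = "(+) x ` K"
    have C: "?C \<in> add_cosets G K" using x by (auto simp: add_cosets_def)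
    have "x - r ?C \<in> K" using r[OF C] coset_eq_iff[OF K] by metis
    then have "(+) (x - r ?C) ` H \<in> add_cosets K H" by (auto simp: add_cosets_def)
    moreover have "D = (+) (r ?C) ` (+) (x - r ?C) ` H" by (simp add: plus_image x)
    ultimately show "\<exists>P\<in>add_cosets G K \<times> add_cosets K H. D = (case P of (C, D) \<Rightarrow> (+) (r C) ` D)"
      using C by (intro bexI[of _ "(?C, (+) (x - r ?C) ` H)"]) auto
  qed
  from bij_betw_same_card[OF this] show ?thesis
    by (simp add: add_index_def card_cartesian_product)
qed

text \<open>\<open>m i\<close> stands for the integer multiple \<open>i \<cdot> a\<close> of a fixed element.\<close>

lemma index_extend_cyclic:
  fixes m :: "int \<Rightarrow> 'a::ab_group_add"
  assumes K: "add_subgroup K" and m: "\<And>i j. m (i + j) = m i + m j"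
    and indep: "\<And>i. m i \<in> K \<Longrightarrow> i = 0" and "n \<noteq> 0"
  shows "add_index {x + m i |x i. x \<in> K} {x + m (n * i) |x i. x \<in> K} = nat \<bar>n\<bar>"
proof -
  let ?G = "{x + m i |x i. x \<in> K}" and ?H = "{x + m (n * i) |x i. x \<in> K}"
  have m0: "m 0 = 0" using m[of 0 0] by simp
  have mneg: "m (- i) = - m i" for i using m[of i "- i"] m0 by (simp add: eq_neg_iff_add_eq_0 add.commute)
  have mdiff: "m (i - j) = m i - m j" for i j using m[of i "- j"] mneg by simp
  have H: "add_subgroup ?H"
    unfolding add_subgroup_def
  proof (intro conjI ballI)
    have "0 = 0 + m (n * 0)" by (simp add: m0)
    then show "0 \<in> ?H" using add_subgroupD(1)[OF K] by blast
    fix x y assume "x \<in> ?H" "y \<in> ?H"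
    then obtain a i b j where "a \<in> K" "b \<in> K" "x = a + m (n * i)" "y = b + m (n * j)" by blast
    moreover then have "x - y = (a - b) + m (n * (i - j))" by (simp add: right_diff_distrib mdiff)
    ultimately show "x - y \<in> ?H" using add_subgroupD(2)[OF K] by blast
  qed
  have mem: "m i \<in> ?H \<longleftrightarrow> n dvd i" for i
  proof
    assume "m i \<in> ?H"
    then obtain a j where aj: "a \<in> K" "m i = a + m (n * j)" by blast
    then have "m (i - n * j) \<in> K" by (simp add: mdiff)
    then have "i - n * j = 0" by (rule indep)
    then show "n dvd i" by simp
  next
    assume "n dvd i"
    then obtain j where "i = n * j" by (auto elim: dvdE)
    then have "m i = 0 + m (n * j)" by simp
    then show "m i \<in> ?H" using add_subgroupD(1)[OF K] by blast
  qed
  \<comment> \<open>The residues of the coefficient modulo n represent the cosets: reducing it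
    changes the element by a member of \<open>?H\<close>, and by \<open>mem\<close> distinct
    residues stay inequivalent.\<close>
  have "bij_betw (\<lambda>i. (+) (m i) ` ?H) {0..<\<bar>n\<bar>} (add_cosets ?G ?H)"
    unfolding bij_betw_def
  proof (intro conjI subset_antisym subsetI)
    show "inj_on (\<lambda>i. (+) (m i) ` ?H) {0..<\<bar>n\<bar>}"
    proof (rule inj_onI)
      fix i j assume ij: "i \<in> {0..<\<bar>n\<bar>}" "j \<in> {0..<\<bar>n\<bar>}" "(+) (m i) ` ?H = (+) (m j) ` ?H"
      then have "m (i - j) \<in> ?H" unfolding mdiff by (simp only: coset_eq_iff[OF H])
      then have "n dvd i - j" using mem by simp
      moreover have "\<bar>i - j\<bar> < \<bar>n\<bar>" using ij by auto
      ultimately show "i = j" using dvd_imp_le_int[of "i - j" n] by fastforce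
    qed
  next
    fix C assume "C \<in> (\<lambda>i. (+) (m i) ` ?H) ` {0..<\<bar>n\<bar>}"
    then obtain i where i: "C = (+) (m i) ` ?H" by blast
    have "m i = 0 + m i" by simp
    then have "m i \<in> ?G" using add_subgroupD(1)[OF K] by blast
    then show "C \<in> add_cosets ?G ?H" using i by (auto simp: add_cosets_def)
  next
    fix C assume "C \<in> add_cosets ?G ?H"
    then obtain a i where a: "a \<in> K" "C = (+) (a + m i) ` ?H" by (auto simp: add_cosets_def)
    let ?r = "i mod \<bar>n\<bar>"
    have "n dvd (i - ?r)" by (metis abs_dvd_iff dvd_minus_mod)
    then have "m (i - ?r) \<in> ?H" using mem by simp
    then obtain b j where b: "b \<in> K" "m (i - ?r) = b + m (n * j)" by blast
    have "(a + m i) - m ?r = (a + b) + m (n * j)"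
      using b by (simp add: mdiff algebra_simps)
    then have "(a + m i) - m ?r \<in> ?H" using add_subgroupD(4)[OF K a(1) b(1)] by blast
    then have "C = (+) (m ?r) ` ?H" unfolding a(2) by (simp only: coset_eq_iff[OF H])
    moreover have "?r \<in> {0..<\<bar>n\<bar>}" using \<open>n \<noteq> 0\<close> by simp
    ultimately show "C \<in> (\<lambda>i. (+) (m i) ` ?H) ` {0..<\<bar>n\<bar>}" by blast
  qed
  from bij_betw_same_card[OF this] show ?thesis by (simp add: add_index_def)
qed

section \<open>Principal minors\<close>

lemma principal_minor_transpose:
  assumes "finite T" shows "principal_minor (\<lambda>i j. A j i) T = principal_minor A T"
proof -
  have "principal_minor (\<lambda>i j. A j i) T
      = (\<Sum>p\<in>{p. p permutes T}. of_int (sign (inv_into UNIV p)) * (\<Prod>i\<in>T. A (inv_into UNIV p i) i))"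
    unfolding principal_minor_def by (subst sum_permutations_inverse) rule
  also have "\<dots> = principal_minor A T"
    unfolding principal_minor_def
  proof (rule sum.cong[OF refl])
    fix p assume p: "p \<in> {p. p permutes T}"
    then have "(\<Prod>i\<in>T. A (inv_into UNIV p i) i) = (\<Prod>i\<in>T. A (inv_into UNIV p (p i)) (p i))"
      using prod.permute[of p T "\<lambda>i. A (inv_into UNIV p i) i"] by (simp add: o_def)
    also have "\<dots> = (\<Prod>i\<in>T. A i (p i))" using p by (simp add: permutes_inverses)
    moreover have "sign (inv_into UNIV p) = sign p"
      using p assms permutation_permutes sign_inverse by blast
    ultimately show "of_int (sign (inv_into UNIV p)) * (\<Prod>i\<in>T. A (inv_into UNIV p i) i) = of_int (sign p) * (\<Prod>i\<in>T. A i (p i))"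
      by simp
  qed
  finally show ?thesis .
qed

text \<open>Composing each permutation with the transposition of \<open>g\<close> and
  \<open>h\<close> flips the sign and keeps the product, so the minor equals its own
  negative.\<close>

lemma principal_minor_identical_rows:
  fixes A :: "'a \<Rightarrow> 'a \<Rightarrow> 'r::{idom,ring_char_0}"
  assumes "finite T" "g \<in> T" "h \<in> T" "g \<noteq> h" and eq: "\<And>y. A g y = A h y"
  shows "principal_minor A T = 0"
proof -
  let ?t = "Transposition.transpose g h"
  have t: "?t permutes T" using assms by (simp add: permutes_swap_id)
  have At: "A (?t i) = A i" for i
    using eq by (cases "i = g"; cases "i = h") (auto simp: fun_eq_iff transpose_apply_other)
  have "principal_minor A T = (\<Sum>p\<in>{p. p permutes T}. of_int (sign (p \<circ> ?t)) * (\<Prod>i\<in>T. A i ((p \<circ> ?t) i)))"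
    unfolding principal_minor_def by (rule sum_permutations_compose_right[OF t])
  also have "\<dots> = (\<Sum>p\<in>{p. p permutes T}. - (of_int (sign p) * (\<Prod>i\<in>T. A i (p i))))"
  proof (rule sum.cong[OF refl])
    fix p assume "p \<in> {p. p permutes T}"
    then have "permutation p" using assms(1) permutation_permutes by auto
    then have "sign (p \<circ> ?t) = - sign p"
      using assms(4) by (simp add: sign_compose permutation_swap_id sign_swap_id)
    moreover have "(\<Prod>i\<in>T. A i (p (?t i))) = (\<Prod>i\<in>T. A (?t i) (p (?t i)))" by (simp add: At)
    moreover have "\<dots> = (\<Prod>i\<in>T. A i (p i))"
      using prod.permute[OF t, of "\<lambda>i. A i (p i)"] by (simp add: o_def)
    ultimately show "of_int (sign (p \<circ> ?t)) * (\<Prod>i\<in>T. A i ((p \<circ> ?t) i)) = - (of_int (sign p) * (\<Prod>i\<in>T. A i (p i)))"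
      by simp
  qed
  also have "\<dots> = - principal_minor A T" by (simp add: principal_minor_def sum_negf)
  finally show ?thesis by simp
qed

text \<open>Multilinearity in row \<open>g\<close>: replacing this row by a row \<open>h\<close>
  other than \<open>g\<close> repeats a row, so only the term of \<open>g\<close> survives. The
  factor \<open>N\<close> stays on the left to avoid division.\<close>

lemma principal_minor_row_combination:
  fixes A B :: "'a \<Rightarrow> 'a \<Rightarrow> 'r::{idom,ring_char_0}"
  assumes T: "finite T" "g \<in> T"
    and row: "\<And>y. y \<in> T \<Longrightarrow> N * A g y = (\<Sum>h\<in>T. k h * B h y)"
    and other: "\<And>x y. x \<in> T \<Longrightarrow> y \<in> T \<Longrightarrow> x \<noteq> g \<Longrightarrow> A x y = B x y"
  shows "N * principal_minor A T = k g * principal_minor B T"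
proof -
  have split: "principal_minor C T = (\<Sum>p\<in>{p. p permutes T}. of_int (sign p) * (C g (p g) * (\<Prod>i\<in>T - {g}. C i (p i))))" for C :: "'a \<Rightarrow> 'a \<Rightarrow> 'r"
    unfolding principal_minor_def using T by (simp add: prod.remove)
  have "N * principal_minor A T = (\<Sum>p\<in>{p. p permutes T}. of_int (sign p) * ((N * A g (p g)) * (\<Prod>i\<in>T - {g}. A i (p i))))"
    unfolding split sum_distrib_left by (simp add: mult_ac)
  also have "\<dots> = (\<Sum>p\<in>{p. p permutes T}. \<Sum>h\<in>T. k h * (of_int (sign p) * (B h (p g) * (\<Prod>i\<in>T - {g}. B i (p i)))))"
  proof (rule sum.cong[OF refl])
    fix p assume "p \<in> {p. p permutes T}"
    then have pT: "p i \<in> T" if "i \<in> T" for i using that by (simp add: permutes_in_image)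
    have "(\<Prod>i\<in>T - {g}. A i (p i)) = (\<Prod>i\<in>T - {g}. B i (p i))"
      using other pT by (intro prod.cong) auto
    then show "of_int (sign p) * ((N * A g (p g)) * (\<Prod>i\<in>T - {g}. A i (p i))) =
       (\<Sum>h\<in>T. k h * (of_int (sign p) * (B h (p g) * (\<Prod>i\<in>T - {g}. B i (p i)))))"
      by (simp add: row[OF pT[OF T(2)]] sum_distrib_left sum_distrib_right mult_ac)
  qed
  also have "\<dots> = (\<Sum>h\<in>T. k h * principal_minor (B(g := B h)) T)"
    unfolding split by (subst sum.swap) (simp add: sum_distrib_left)
  also have "\<dots> = (\<Sum>h\<in>T. if h = g then k g * principal_minor B T else 0)"
  proof (rule sum.cong[OF refl])
    fix h assume h: "h \<in> T"
    show "k h * principal_minor (B(g := B h)) T = (if h = g then k g * principal_minor B T else 0)"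
      using principal_minor_identical_rows[OF T h, of "B(g := B h)"] by auto
  qed
  finally show ?thesis using T by simp
qed

text \<open>Conjugating permutations by the transposition renames \<open>e\<close> to
  \<open>g\<close>, so that minors on two bases differing by one exchange become minors on the same
  index set \<open>T\<close>.\<close>

lemma principal_minor_transposition:
  assumes "finite T"
  shows "principal_minor A (Transposition.transpose e g ` T)
    = principal_minor (\<lambda>i j. A (Transposition.transpose e g i) (Transposition.transpose e g j)) T"
proof -
  let ?t = "Transposition.transpose e g"
  have conj: "?t \<circ> p \<circ> ?t permutes ?t ` S" if "p permutes S" for p S
  proof -
    have b: "bij (?t \<circ> p \<circ> ?t)" using that by (intro bij_comp) (auto simp: permutes_bij)
    show ?thesis
      unfolding permutes_def
    proof (intro conjI allI impI)
      fix x assume "x \<notin> ?t ` S"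
      then have "?t x \<notin> S" by (metis image_eqI transpose_involutory)
      then show "(?t \<circ> p \<circ> ?t) x = x" using that by (simp add: permutes_not_in)
    next
      fix y show "\<exists>!x. (?t \<circ> p \<circ> ?t) x = y" using b by (simp add: bij_iff)
    qed
  qed
  have tt: "?t ` ?t ` S = S" for S by (simp add: image_comp)
  have inv: "?t \<circ> (?t \<circ> p \<circ> ?t) \<circ> ?t = p" for p :: "'a \<Rightarrow> 'a" by (simp add: fun_eq_iff)
  show ?thesis
    unfolding principal_minor_def
  proof (rule sum.reindex_bij_witness[of _ "\<lambda>p. ?t \<circ> p \<circ> ?t" "\<lambda>p. ?t \<circ> p \<circ> ?t"])
    fix p assume p: "p \<in> {p. p permutes ?t ` T}"
    show "?t \<circ> p \<circ> ?t \<in> {p. p permutes T}" using conj[of p "?t ` T"] p by (simp add: tt)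
    have "permutation p" using p assms permutation_permutes by blast
    then have "sign (?t \<circ> p \<circ> ?t) = sign p"
      by (simp add: sign_compose permutation_compose permutation_swap_id sign_swap_id)
    moreover have "(\<Prod>i\<in>?t ` T. A i (p i)) = (\<Prod>i\<in>T. A (?t i) (p (?t i)))"
      by (subst prod.reindex) (auto intro: inj_on_subset[OF inj_transpose])
    ultimately show "of_int (sign (?t \<circ> p \<circ> ?t)) * (\<Prod>i\<in>T. A (?t i) (?t ((?t \<circ> p \<circ> ?t) i))) = of_int (sign p) * (\<Prod>i\<in>?t ` T. A i (p i))"
      by simp
  qed (use inv conj in auto)
qed

text \<open>The relation is used once for the row of \<open>e\<close> and once, after transposing,
  for its column; this is the source of the squares.\<close>

lemma principal_minor_exchange:
  fixes A :: "'a \<Rightarrow> 'a \<Rightarrow> 'r::{idom,ring_char_0}"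
  assumes T: "finite T" "g \<in> T" "e \<notin> T" "T \<subseteq> E" "e \<in> E"
    and row: "\<And>y. y \<in> E \<Longrightarrow> N * A e y = (\<Sum>h\<in>T. k h * A h y)"
    and col: "\<And>x. x \<in> E \<Longrightarrow> N * A x e = (\<Sum>h\<in>T. k h * A x h)"
  shows "N\<^sup>2 * principal_minor A (insert e (T - {g})) = (k g)\<^sup>2 * principal_minor A T"
proof -
  let ?t = "Transposition.transpose e g"
  have tg: "?t g = e" by simp
  have tx: "?t x = x" if "x \<in> T" "x \<noteq> g" for x
    using that T(3) by (metis transpose_apply_other)
  have tE: "?t x \<in> E" if "x \<in> T" for x
    using that T tx[of x] by (cases "x = g") auto
  have "?t ` T = insert e (T - {g})"
    using T(2) tx by force
  then have 1: "principal_minor A (insert e (T - {g})) = principal_minor (\<lambda>i j. A (?t i) (?t j)) T"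
    using principal_minor_transposition[OF T(1), of A e g] by simp
  have 2: "N * principal_minor (\<lambda>i j. A (?t i) (?t j)) T = k g * principal_minor (\<lambda>i j. A i (?t j)) T"
    by (rule principal_minor_row_combination[OF T(1,2)]) (use row tE tx in auto)
  have "N * principal_minor (\<lambda>i j. A j (?t i)) T = k g * principal_minor (\<lambda>i j. A j i) T"
    by (rule principal_minor_row_combination[OF T(1,2)]) (use col T(4) tx in auto)
  then have 3: "N * principal_minor (\<lambda>i j. A i (?t j)) T = k g * principal_minor A T"
    using principal_minor_transpose[OF T(1), of "\<lambda>i j. A i (?t j)"] principal_minor_transpose[OF T(1), of A] by simp
  show ?thesis
    unfolding 1 using 2 3 by (simp add: power2_eq_square mult.assoc)
qed

section \<open>The projection onto the coboundaries\<close>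

text \<open>Members vanish outside \<open>E\<close>, so that equality on \<open>E\<close> already
  identifies them as functions; otherwise the projection would not be unique.\<close>

definition row_space :: "'c set \<Rightarrow> 'c set \<Rightarrow> ('c \<Rightarrow> 'c \<Rightarrow> complex) \<Rightarrow> ('c \<Rightarrow> complex) set" where
  "row_space E R \<rho> = {(\<lambda>e. if e \<in> E then \<Sum>f\<in>R. u f * \<rho> f e else 0) | u. True}"

lemma row_spaceI: "(\<lambda>e. if e \<in> E then \<Sum>f\<in>R. u f * \<rho> f e else 0) \<in> row_space E R \<rho>"
  unfolding row_space_def by (intro CollectI exI[of _ u]) simp

definition finite_inner :: "'c set \<Rightarrow> ('c \<Rightarrow> complex) \<Rightarrow> ('c \<Rightarrow> complex) \<Rightarrow> complex" where
  "finite_inner E c d = (\<Sum>e\<in>E. c e * cnj (d e))"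

lemma finite_inner_linear:
  "finite_inner E (\<lambda>e. a e - b e) d = finite_inner E a d - finite_inner E b d"
  "finite_inner E (\<lambda>e. a e + b e) d = finite_inner E a d + finite_inner E b d"
  "finite_inner E (\<lambda>e. t * a e) d = t * finite_inner E a d"
  "finite_inner E d (\<lambda>e. a e + b e) = finite_inner E d a + finite_inner E d b"
  "finite_inner E d (\<lambda>e. t * a e) = cnj t * finite_inner E d a"
  by (simp_all add: finite_inner_def algebra_simps sum.distrib sum_subtractf sum_distrib_left)

lemma cnj_finite_inner: "cnj (finite_inner E a b) = finite_inner E b a"
  by (simp add: finite_inner_def mult.commute)

lemma finite_inner_self_eq_0:
  assumes "finite E" "finite_inner E a a = 0" "e \<in> E"
  shows "a e = 0"
proof -
  have "finite_inner E a a = of_real (\<Sum>e\<in>E. (cmod (a e))\<^sup>2)"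
    unfolding finite_inner_def of_real_sum complex_norm_square ..
  then have "(\<Sum>e\<in>E. (cmod (a e))\<^sup>2) = 0" using assms(2) by (metis of_real_eq_0_iff)
  then show ?thesis using assms by (subst (asm) sum_nonneg_eq_0_iff) auto
qed

lemma row_space_add:
  assumes "v \<in> row_space E R \<rho>" "w \<in> row_space E R \<rho>"
  shows "(\<lambda>e. v e + w e) \<in> row_space E R \<rho>"
proof -
  obtain a b where "v = (\<lambda>e. if e \<in> E then \<Sum>f\<in>R. a f * \<rho> f e else 0)" "w = (\<lambda>e. if e \<in> E then \<Sum>f\<in>R. b f * \<rho> f e else 0)"
    using assms unfolding row_space_def by blast
  then have "(\<lambda>e. v e + w e) = (\<lambda>e. if e \<in> E then \<Sum>f\<in>R. (a f + b f) * \<rho> f e else 0)"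
    by (auto simp: fun_eq_iff distrib_right sum.distrib)
  then show ?thesis by (simp only: row_spaceI)
qed

lemma row_space_scale:
  assumes "v \<in> row_space E R \<rho>"
  shows "(\<lambda>e. t * v e) \<in> row_space E R \<rho>"
proof -
  obtain a where "v = (\<lambda>e. if e \<in> E then \<Sum>f\<in>R. a f * \<rho> f e else 0)"
    using assms unfolding row_space_def by blast
  then have "(\<lambda>e. t * v e) = (\<lambda>e. if e \<in> E then \<Sum>f\<in>R. (t * a f) * \<rho> f e else 0)"
    by (auto simp: fun_eq_iff sum_distrib_left mult.assoc)
  then show ?thesis by (simp only: row_spaceI)
qed

lemma row_space_insert:
  assumes "finite R" "f \<notin> R"
  shows "row_space E (insert f R) \<rho> = {(\<lambda>e. v e + t * (if e \<in> E then \<rho> f e else 0)) | v t. v \<in> row_space E R \<rho>}"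
    (is "?L = ?R")
proof (intro subset_antisym subsetI)
  fix w assume "w \<in> ?L"
  then obtain u where "w = (\<lambda>e. if e \<in> E then \<Sum>f\<in>insert f R. u f * \<rho> f e else 0)"
    unfolding row_space_def by blast
  then have "w = (\<lambda>e. (if e \<in> E then \<Sum>f\<in>R. u f * \<rho> f e else 0) + u f * (if e \<in> E then \<rho> f e else 0))"
    using assms by (auto simp: fun_eq_iff add.commute)
  then show "w \<in> ?R"
    by (intro CollectI exI[of _ "\<lambda>e. if e \<in> E then \<Sum>f\<in>R. u f * \<rho> f e else 0"] exI[of _ "u f"] conjI row_spaceI)
next
  fix w assume "w \<in> ?R"
  then obtain u t where "w = (\<lambda>e. (if e \<in> E then \<Sum>f\<in>R. u f * \<rho> f e else 0) + t * (if e \<in> E then \<rho> f e else 0))"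
    unfolding row_space_def by blast
  moreover have "(\<Sum>h\<in>R. (u(f := t)) h * \<rho> h e) = (\<Sum>h\<in>R. u h * \<rho> h e)" for e
    using assms by (intro sum.cong) auto
  ultimately have "w = (\<lambda>e. if e \<in> E then \<Sum>h\<in>insert f R. (u(f := t)) h * \<rho> h e else 0)"
    using assms by (auto simp: fun_eq_iff add.commute)
  then show "w \<in> ?L" by (simp only: row_spaceI)
qed

text \<open>Gram-Schmidt, one row at a time: the projection onto the old rows is corrected along
  \<open>b'\<close>, the component of the new row orthogonal to them.\<close>

lemma row_space_projection_exists:
  assumes "finite E" "finite R"
  shows "\<exists>w\<in>row_space E R \<rho>. \<forall>v\<in>row_space E R \<rho>. finite_inner E (\<lambda>e. c e - w e) v = 0"
  using assms(2)
proof (induction R arbitrary: c rule: finite_induct)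
  case empty
  show ?case by (auto simp: row_space_def finite_inner_def)
next
  case (insert f R)
  define b where "b = (\<lambda>e. if e \<in> E then \<rho> f e else 0)"
  obtain b0 where b0: "b0 \<in> row_space E R \<rho>" "\<And>v. v \<in> row_space E R \<rho> \<Longrightarrow> finite_inner E (\<lambda>e. b e - b0 e) v = 0"
    using insert.IH[of b] by blast
  obtain w0 where w0: "w0 \<in> row_space E R \<rho>" "\<And>v. v \<in> row_space E R \<rho> \<Longrightarrow> finite_inner E (\<lambda>e. c e - w0 e) v = 0"
    using insert.IH[of c] by blast
  define b' where "b' = (\<lambda>e. b e - b0 e)"
  define t where "t = finite_inner E (\<lambda>e. c e - w0 e) b' / finite_inner E b' b'"
  define w where "w = (\<lambda>e. w0 e + t * b' e)"
  \<comment> \<open>If the new row depends on the old ones then \<open>b'\<close> is 0 on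
    \<open>E\<close>, and both sides vanish whatever the quotient defining \<open>t\<close>
    is.\<close>
  have t: "finite_inner E (\<lambda>e. c e - w0 e) b' = t * finite_inner E b' b'"
  proof (cases "finite_inner E b' b' = 0")
    case True
    have "b' e = 0" if "e \<in> E" for e
      by (rule finite_inner_self_eq_0[OF assms(1) True that])
    then have "finite_inner E (\<lambda>e. c e - w0 e) b' = 0"
      by (simp add: finite_inner_def)
    then show ?thesis using True by simp
  qed (simp add: t_def)
  have mem: "(\<lambda>e. v e + s * b' e) \<in> row_space E (insert f R) \<rho>" if "v \<in> row_space E R \<rho>" for v s
  proof -
    have "(\<lambda>e. v e + (- s) * b0 e) \<in> row_space E R \<rho>"
      by (intro row_space_add row_space_scale that b0)
    moreover have "(\<lambda>e. v e + s * b' e) = (\<lambda>e. (\<lambda>e. v e + (- s) * b0 e) e + s * (if e \<in> E then \<rho> f e else 0))"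
      by (auto simp: b'_def b_def fun_eq_iff algebra_simps)
    ultimately show ?thesis
      unfolding row_space_insert[OF insert.hyps]
      by (intro CollectI exI[of _ "\<lambda>e. v e + (- s) * b0 e"] exI[of _ s] conjI)
  qed
  have "finite_inner E (\<lambda>e. c e - w e) v = 0" if vmem: "v \<in> row_space E (insert f R) \<rho>" for v
  proof -
    obtain v0 s where v: "v = (\<lambda>e. v0 e + s * b e)" "v0 \<in> row_space E R \<rho>"
      using vmem unfolding row_space_insert[OF insert.hyps] b_def by blast
    define v' where "v' = (\<lambda>e. v0 e + s * b0 e)"
    have v': "v' \<in> row_space E R \<rho>"
      unfolding v'_def by (intro row_space_add row_space_scale v b0)
    have "v = (\<lambda>e. v' e + s * b' e)" by (auto simp: v v'_def b'_def algebra_simps)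
    moreover have "(\<lambda>e. c e - w e) = (\<lambda>e. (\<lambda>e. c e - w0 e) e - t * b' e)"
      by (auto simp: w_def algebra_simps)
    ultimately have "finite_inner E (\<lambda>e. c e - w e) v
       = (finite_inner E (\<lambda>e. c e - w0 e) v' - t * finite_inner E b' v')
         + cnj s * (finite_inner E (\<lambda>e. c e - w0 e) b' - t * finite_inner E b' b')"
      by (simp only: finite_inner_linear) (simp add: algebra_simps)
    also have "\<dots> = 0"
      using w0(2)[OF v'] b0(2)[OF v'] t by (simp add: b'_def)
    finally show ?thesis .
  qed
  moreover have "w \<in> row_space E (insert f R) \<rho>" unfolding w_def by (rule mem[OF w0(1)])
  ultimately show ?case by blast
qed

lemma coboundaries_eq_row_space:
  fixes X :: "('a, 'c) cell_structure"
  assumes "\<And>m. finite (cells X m)"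
  shows "coboundaries X (Suc m) = row_space (cells X (Suc m)) (cells X m) (\<lambda>f e. of_int (incidence X m e f))"
proof (intro subset_antisym subsetI)
  fix w :: "'c \<Rightarrow> complex" assume "w \<in> coboundaries X (Suc m)"
  then obtain u where "w = (\<lambda>e. if e \<in> cells X (Suc m) then \<Sum>f\<in>cells X m. of_int (incidence X m e f) * u f else 0)"
    by auto
  then show "w \<in> row_space (cells X (Suc m)) (cells X m) (\<lambda>f e. of_int (incidence X m e f))"
    using row_spaceI[where E = "cells X (Suc m)" and u = u and R = "cells X m" and \<rho> = "\<lambda>f e. of_int (incidence X m e f)"]
    by (simp only: mult.commute[of "u _"])
next
  fix w assume "w \<in> row_space (cells X (Suc m)) (cells X m) (\<lambda>f e. complex_of_int (incidence X m e f))"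
  then obtain u where u: "w = (\<lambda>e. if e \<in> cells X (Suc m) then \<Sum>f\<in>cells X m. u f * of_int (incidence X m e f) else 0)"
    unfolding row_space_def by auto
  let ?u = "\<lambda>f. if f \<in> cells X m then u f else 0"
  have "w = (\<lambda>e. if e \<in> cells X (Suc m) then \<Sum>f\<in>cells X m. of_int (incidence X m e f) * ?u f else 0)"
    unfolding u by (intro ext if_cong sum.cong refl) simp
  moreover have "?u \<in> cell_chains X m" by (simp add: cell_chains_def)
  ultimately show "w \<in> coboundaries X (Suc m)" unfolding coboundaries.simps by (intro CollectI exI[of _ ?u] conjI)
qed

text \<open>Discharges the definite description: the difference of two candidates lies in the row
  space and is orthogonal to it, hence to itself.\<close>

lemma coboundary_proj_Suc:
  fixes X :: "('a, 'c) cell_structure"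
  assumes fin: "\<And>m. finite (cells X m)"
  shows "coboundary_proj X (Suc m) c \<in> coboundaries X (Suc m)"
    and "v \<in> coboundaries X (Suc m) \<Longrightarrow> cell_inner X (Suc m) (\<lambda>e. c e - coboundary_proj X (Suc m) c e) v = 0"
proof -
  let ?E = "cells X (Suc m)"
  let ?V = "row_space ?E (cells X m) (\<lambda>f e. of_int (incidence X m e f)) :: ('c \<Rightarrow> complex) set"
  have inner: "cell_inner X (Suc m) = finite_inner ?E" by (auto simp: cell_inner_def finite_inner_def fun_eq_iff)
  let ?P = "\<lambda>w. w \<in> ?V \<and> (\<forall>v\<in>?V. finite_inner ?E (\<lambda>e. c e - w e) v = 0)"
  obtain w where w: "?P w" using row_space_projection_exists[OF fin fin] by blast
  have "w' = w" if w': "?P w'" for w'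
  proof -
    have d: "(\<lambda>e. w e + (- 1) * w' e) \<in> ?V" using w w' row_space_add row_space_scale by metis
    have "finite_inner ?E (\<lambda>e. w e + (- 1) * w' e) (\<lambda>e. w e + (- 1) * w' e)
      = finite_inner ?E (\<lambda>e. (c e - w' e) - (c e - w e)) (\<lambda>e. w e + (- 1) * w' e)"
      by (rule arg_cong[of _ _ "\<lambda>x. finite_inner ?E x _"]) auto
    also have "\<dots> = 0"
      unfolding finite_inner_linear(1)[of ?E "\<lambda>e. c e - w' e" "\<lambda>e. c e - w e"] using w w' d by simp
    finally have *: "w e + (- 1) * w' e = 0" if "e \<in> ?E" for e
      using finite_inner_self_eq_0[OF fin _ that] by fast
    show ?thesis
    proof
      fix e show "w' e = w e"
        using *[of e] w w' by (cases "e \<in> ?E") (auto simp: row_space_def)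
    qed
  qed
  with w have "\<exists>!w. ?P w" by blast
  from theI'[OF this] have "?P (coboundary_proj X (Suc m) c)"
    unfolding coboundary_proj_def inner coboundaries_eq_row_space[OF fin] .
  then show "coboundary_proj X (Suc m) c \<in> coboundaries X (Suc m)"
    and "v \<in> coboundaries X (Suc m) \<Longrightarrow> cell_inner X (Suc m) (\<lambda>e. c e - coboundary_proj X (Suc m) c e) v = 0"
    unfolding inner coboundaries_eq_row_space[OF fin] by blast+
qed

lemma Q_matrix_column:
  fixes X :: "('a, 'c) cell_structure"
  assumes "\<And>m. finite (cells X m)"
  shows "(\<lambda>e. Q_matrix X (Suc m) e f) \<in> coboundaries X (Suc m)"
  unfolding Q_matrix_def using coboundary_proj_Suc(1)[OF assms] .

text \<open>Each residual is orthogonal to all projections, so an entry is, up to conjugation, the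
  inner product of two projected unit vectors. This carries relations from rows of the matrix over
  to columns.\<close>

lemma Q_matrix_hermitian:
  fixes X :: "('a, 'c) cell_structure"
  assumes fin: "\<And>m. finite (cells X m)" and "e \<in> cells X (Suc m)" "f \<in> cells X (Suc m)"
  shows "Q_matrix X (Suc m) e f = cnj (Q_matrix X (Suc m) f e)"
proof -
  let ?E = "cells X (Suc m)"
  let ?d = "\<lambda>f g. if g = f then 1 else (0::complex)"
  let ?q = "\<lambda>f. coboundary_proj X (Suc m) (?d f)"
  have inner: "cell_inner X (Suc m) = finite_inner ?E" by (auto simp: cell_inner_def finite_inner_def fun_eq_iff)
  have "finite_inner ?E (\<lambda>g. ?d e g - ?q e g) (?q f) = 0" for e f
    using coboundary_proj_Suc(2)[OF fin coboundary_proj_Suc(1)[OF fin], of m] unfolding inner .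
  then have q: "finite_inner ?E (?d e) (?q f) = finite_inner ?E (?q e) (?q f)" for e f
    unfolding finite_inner_linear(1) by simp
  have d: "finite_inner ?E (?d e) v = cnj (v e)" if "e \<in> ?E" for e v
    using that fin by (simp add: finite_inner_def if_distrib[of "\<lambda>x. x * _"] cong: if_cong)
  have "cnj (?q f e) = finite_inner ?E (?q e) (?q f)" using d[OF assms(2)] q by metis
  moreover have "cnj (?q e f) = finite_inner ?E (?q f) (?q e)" using d[OF assms(3)] q by metis
  ultimately show ?thesis
    unfolding Q_matrix_def by (metis cnj_finite_inner complex_cnj_cnj)
qed

section \<open>Lattices spanned by integer columns\<close>

text \<open>The complex numbers are viewed as a rational vector space, and \<open>z\<close> is
  extended to a basis. Applied to the coefficients of a complex relation among integer columns, the
  functional gives a rational relation in which the coefficient of one chosen column is 1.\<close>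

lemma rational_functional_exists:
  assumes "z \<noteq> (0::complex)"
  shows "\<exists>\<phi>::complex \<Rightarrow> rat. (\<forall>x y. \<phi> (x + y) = \<phi> x + \<phi> y) \<and> (\<forall>(i::int) x. \<phi> (of_int i * x) = of_int i * \<phi> x) \<and> \<phi> z = 1"
proof -
  let ?s1 = "\<lambda>(q::rat) (z::complex). of_rat q * z" and ?s2 = "(*) :: rat \<Rightarrow> rat \<Rightarrow> rat"
  interpret vector_space_pair ?s1 ?s2
    by unfold_locales (simp_all add: algebra_simps of_rat_add of_rat_mult)
  have "vs1.independent {z}" using assms by simp
  from linear_independent_extend[OF this, of "\<lambda>_. 1"]
  obtain \<phi> where \<phi>: "Vector_Spaces.linear ?s1 ?s2 \<phi>" "\<phi> z = 1" by auto
  interpret l: Vector_Spaces.linear ?s1 ?s2 \<phi> by (rule \<phi>)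
  have "\<phi> (of_int i * x) = of_int i * \<phi> x" for i :: int and x
    using l.scale[of "of_int i" x] by simp
  with l.add \<phi>(2) show ?thesis by blast
qed

lemma common_denominator:
  fixes d :: "'e \<Rightarrow> rat"
  assumes "finite T"
  shows "\<exists>N k. N \<noteq> (0::int) \<and> (\<forall>h\<in>T. of_int N * d h = of_int (k h))"
  using assms
proof (induction T rule: finite_induct)
  case (insert x T)
  then obtain N k where N: "N \<noteq> 0" "\<And>h. h \<in> T \<Longrightarrow> of_int N * d h = of_int (k h)" by blast
  obtain a b where ab: "d x = of_int a / of_int b" "b > 0"
    by (metis quotient_of_denom_pos quotient_of_div surj_pair)
  let ?k = "\<lambda>h. if h = x then N * a else b * k h"
  have "of_int (N * b) * d h = of_int (?k h)" if "h \<in> insert x T" for h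
  proof (cases "h = x")
    case False
    then show ?thesis using N(2)[of h] that by (simp add: mult.assoc mult.left_commute)
  qed (use ab in simp)
  then show ?case using N(1) ab(2) by (intro exI[of _ "N * b"] exI[of _ ?k]) auto
qed (auto intro: exI[of _ 1])

definition lattice :: "('e \<Rightarrow> 'f \<Rightarrow> int) \<Rightarrow> 'e set \<Rightarrow> ('f \<Rightarrow> int) set" where
  "lattice v T = {(\<lambda>f. \<Sum>e\<in>T. c e * v e f) | c. True}"

text \<open>For a lattice, these are the integer vectors in its rational span.\<close>

definition saturation :: "('f \<Rightarrow> int) set \<Rightarrow> ('f \<Rightarrow> int) set" where
  "saturation L = {w. \<exists>n. n \<noteq> 0 \<and> (\<lambda>f. n * w f) \<in> L}"

definition columns_independent :: "('e \<Rightarrow> 'f \<Rightarrow> int) \<Rightarrow> 'e set \<Rightarrow> bool" where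
  "columns_independent v T \<longleftrightarrow>
     (\<forall>c::'e \<Rightarrow> complex. (\<forall>f. (\<Sum>e\<in>T. c e * of_int (v e f)) = 0) \<longrightarrow> (\<forall>e\<in>T. c e = 0))"

text \<open>Spanning is meant over the rationals but written with cleared denominators, so the
  integers \<open>N\<close> and \<open>k\<close> can enter lattice indices directly.\<close>

definition column_basis :: "('e \<Rightarrow> 'f \<Rightarrow> int) \<Rightarrow> 'e set \<Rightarrow> 'e set \<Rightarrow> bool" where
  "column_basis v E T \<longleftrightarrow> T \<subseteq> E \<and> columns_independent v T \<and>
     (\<forall>e\<in>E. \<exists>N k. N \<noteq> 0 \<and> (\<forall>f. N * v e f = (\<Sum>h\<in>T. k h * v h f)))"

lemma latticeI: "(\<lambda>f. \<Sum>e\<in>T. c e * v e f) \<in> lattice v T"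
  unfolding lattice_def by (intro CollectI exI[of _ c]) simp

lemma add_subgroup_lattice: "add_subgroup (lattice v T)"
  unfolding add_subgroup_def
proof (intro conjI ballI)
  show "0 \<in> lattice v T"
    using latticeI[of "\<lambda>_. 0" v T] by (simp add: zero_fun_def)
  fix x y assume "x \<in> lattice v T" "y \<in> lattice v T"
  then obtain a b where "x = (\<lambda>f. \<Sum>e\<in>T. a e * v e f)" "y = (\<lambda>f. \<Sum>e\<in>T. b e * v e f)"
    unfolding lattice_def by blast
  then have "x - y = (\<lambda>f. \<Sum>e\<in>T. (a e - b e) * v e f)"
    by (simp add: fun_eq_iff left_diff_distrib sum_subtractf)
  then show "x - y \<in> lattice v T" by (simp only: latticeI)
qed

lemma lattice_scale: "x \<in> lattice v T \<Longrightarrow> (\<lambda>f. n * x f) \<in> lattice v T"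
proof -
  assume "x \<in> lattice v T"
  then obtain a where "x = (\<lambda>f. \<Sum>e\<in>T. a e * v e f)" unfolding lattice_def by blast
  then have "(\<lambda>f. n * x f) = (\<lambda>f. \<Sum>e\<in>T. (n * a e) * v e f)"
    by (simp add: fun_eq_iff sum_distrib_left mult.assoc)
  then show ?thesis by (simp only: latticeI)
qed

lemma lattice_insert:
  assumes "finite S" "x \<notin> S"
  shows "lattice v (insert x S) = {y + (\<lambda>f. i * v x f) | y i. y \<in> lattice v S}"
proof (intro subset_antisym subsetI)
  fix w assume "w \<in> lattice v (insert x S)"
  then obtain c where "w = (\<lambda>f. \<Sum>e\<in>insert x S. c e * v e f)" unfolding lattice_def by blast
  then have "w = (\<lambda>f. \<Sum>e\<in>S. c e * v e f) + (\<lambda>f. c x * v x f)"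
    using assms by (simp add: fun_eq_iff add.commute)
  then show "w \<in> {y + (\<lambda>f. i * v x f) | y i. y \<in> lattice v S}"
    by (intro CollectI exI[of _ "\<lambda>f. \<Sum>e\<in>S. c e * v e f"] exI[of _ "c x"] conjI latticeI)
next
  fix w assume "w \<in> {y + (\<lambda>f. i * v x f) | y i. y \<in> lattice v S}"
  then obtain c i where w: "w = (\<lambda>f. \<Sum>e\<in>S. c e * v e f) + (\<lambda>f. i * v x f)"
    unfolding lattice_def by blast
  have "(\<Sum>e\<in>S. (c(x := i)) e * v e f) = (\<Sum>e\<in>S. c e * v e f)" for f
    using assms by (intro sum.cong) auto
  then have "w = (\<lambda>f. \<Sum>e\<in>insert x S. (c(x := i)) e * v e f)"
    using assms by (simp add: w fun_eq_iff add.commute)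
  then show "w \<in> lattice v (insert x S)" by (simp only: latticeI)
qed

lemma lattice_mono:
  assumes "finite E" "T \<subseteq> E" shows "lattice v T \<subseteq> lattice v E"
proof
  fix w assume "w \<in> lattice v T"
  then obtain c where w: "w = (\<lambda>f. \<Sum>e\<in>T. c e * v e f)" unfolding lattice_def by blast
  have "(\<Sum>e\<in>T. c e * v e f) = (\<Sum>e\<in>E. (if e \<in> T then c e else 0) * v e f)" for f
    using assms by (intro sum.mono_neutral_cong_left) auto
  then show "w \<in> lattice v E" unfolding w by (simp only: latticeI)
qed

lemma add_subgroup_saturation:
  assumes "L = lattice v T" shows "add_subgroup (saturation L)"
  unfolding add_subgroup_def
proof (intro conjI ballI)
  show "0 \<in> saturation L"
    using add_subgroupD(1)[OF add_subgroup_lattice, of v T]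
    by (auto simp: saturation_def assms zero_fun_def intro!: exI[of _ 1])
  fix x y assume "x \<in> saturation L" "y \<in> saturation L"
  then obtain a b where ab: "a \<noteq> 0" "(\<lambda>f. a * x f) \<in> L" "b \<noteq> 0" "(\<lambda>f. b * y f) \<in> L"
    unfolding saturation_def by blast
  have "(\<lambda>f. b * (a * x f)) - (\<lambda>f. a * (b * y f)) \<in> L"
    using add_subgroupD(2)[OF add_subgroup_lattice] lattice_scale ab(2,4) unfolding assms by blast
  moreover have "(\<lambda>f. b * (a * x f)) - (\<lambda>f. a * (b * y f)) = (\<lambda>f. (a * b) * (x - y) f)"
    by (simp add: fun_eq_iff algebra_simps)
  ultimately show "x - y \<in> saturation L"
    using ab(1,3) unfolding saturation_def by (intro CollectI exI[of _ "a * b"]) auto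
qed

text \<open>Every column has a nonzero multiple in the lattice of \<open>T\<close>, and saturating
  twice adds nothing. Thus all bases are compared inside one common group.\<close>

lemma saturation_basis:
  assumes "finite E" "column_basis v E T"
  shows "saturation (lattice v T) = saturation (lattice v E)"
proof
  have TE: "T \<subseteq> E" using assms(2) by (simp add: column_basis_def)
  have sp: "\<forall>e\<in>E. \<exists>N k. N \<noteq> 0 \<and> (\<forall>f. N * v e f = (\<Sum>h\<in>T. k h * v h f))"
    using assms(2) by (simp add: column_basis_def)
  show "saturation (lattice v T) \<subseteq> saturation (lattice v E)"
    using lattice_mono[OF assms(1) TE] unfolding saturation_def by blast
  have "lattice v F \<subseteq> saturation (lattice v T)" if "finite F" "F \<subseteq> E" for F
    using that
  proof (induction F rule: finite_induct)
    case empty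
    then show ?case
      using add_subgroupD(1)[OF add_subgroup_saturation, of _ v T] by (auto simp: lattice_def zero_fun_def)
  next
    case (insert x F)
    obtain N k where N: "N \<noteq> 0" "\<And>f. N * v x f = (\<Sum>h\<in>T. k h * v h f)"
      using sp insert.prems by (meson insert_subset)
    have "(\<lambda>f. i * v x f) \<in> saturation (lattice v T)" for i
    proof -
      have "(\<lambda>f. N * (i * v x f)) = (\<lambda>f. i * (\<Sum>h\<in>T. k h * v h f))"
        using N(2) by (simp add: fun_eq_iff mult.left_commute)
      then have "(\<lambda>f. N * (i * v x f)) \<in> lattice v T"
        using lattice_scale[OF latticeI] by simp
      then show ?thesis using N(1) unfolding saturation_def by blast
    qed
    then show ?case
      using insert.IH insert.prems add_subgroupD(4)[OF add_subgroup_saturation[OF refl, of v T]]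
      unfolding lattice_insert[OF insert.hyps] by auto
  qed
  from this[of E] have sub: "lattice v E \<subseteq> saturation (lattice v T)" using assms(1) by simp
  show "saturation (lattice v E) \<subseteq> saturation (lattice v T)"
  proof
    fix w assume "w \<in> saturation (lattice v E)"
    then obtain n where n: "n \<noteq> 0" "(\<lambda>f. n * w f) \<in> lattice v E" unfolding saturation_def by blast
    then have "(\<lambda>f. n * w f) \<in> saturation (lattice v T)" using sub by blast
    then obtain m where m: "m \<noteq> 0" "(\<lambda>f. m * (n * w f)) \<in> lattice v T" unfolding saturation_def by blast
    then show "w \<in> saturation (lattice v T)"
      using n(1) unfolding saturation_def by (intro CollectI exI[of _ "m * n"]) (simp add: mult.assoc)
  qed
qed

lemma lattice_subset_saturation: "lattice v T \<subseteq> saturation (lattice v T)"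
  unfolding saturation_def by (auto intro: exI[of _ 1])

text \<open>Reducing coefficients modulo the denominator gives coset representatives in a bounded box.\<close>

lemma index_saturation_pos:
  assumes T: "finite T" and R: "finite R" and v: "\<And>e f. f \<notin> R \<Longrightarrow> v e f = 0"
  shows "add_index (saturation (lattice v T)) (lattice v T) > 0"
proof -
  let ?W = "saturation (lattice v T)" and ?L = "lattice v T"
  define M where "M f = (\<Sum>e\<in>T. \<bar>v e f\<bar>)" for f
  \<comment> \<open>The sum of all \<open>M f\<close> bounds every coordinate at once, giving a box
    with the same finite range in each coordinate of \<open>R\<close>.\<close>
  define B where "B = {w::'b \<Rightarrow> int. \<forall>f. (f \<in> R \<longrightarrow> w f \<in> {- (\<Sum>f\<in>R. M f)..(\<Sum>f\<in>R. M f)}) \<and> (f \<notin> R \<longrightarrow> w f = 0)}"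
  have finB: "finite B" unfolding B_def by (rule finite_set_of_finite_funs) (use R in auto)
  have "add_cosets ?W ?L \<subseteq> (\<lambda>x. (+) x ` ?L) ` B"
  proof
    fix C assume "C \<in> add_cosets ?W ?L"
    then obtain w where w: "w \<in> ?W" "C = (+) w ` ?L" by (auto simp: add_cosets_def)
    then obtain n c where n: "n \<noteq> 0" "(\<lambda>f. n * w f) = (\<lambda>f. \<Sum>e\<in>T. c e * v e f)"
      unfolding saturation_def lattice_def by blast
    \<comment> \<open>Replacing \<open>n\<close> by its absolute value, with the sign absorbed into
      \<open>d\<close>, gives a positive modulus and hence nonnegative remainders.\<close>
    define p where "p = \<bar>n\<bar>"
    define d where "d e = sgn n * c e" for e
    have p: "p > 0" using n by (simp add: p_def)
    have pw: "p * w f = (\<Sum>e\<in>T. d e * v e f)" for f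
    proof -
      have "p * w f = sgn n * (n * w f)" by (simp add: p_def abs_sgn mult_ac)
      also have "n * w f = (\<Sum>e\<in>T. c e * v e f)" using n(2) by (rule fun_cong)
      finally show ?thesis by (simp add: d_def sum_distrib_left mult.assoc)
    qed
    \<comment> \<open>The integral parts of the coefficients \<open>d e / p\<close> are removed.
      What remains has coefficients in [0,1), which bounds \<open>w' f\<close> by
      \<open>M f\<close>.\<close>
    define w' where "w' = w - (\<lambda>f. \<Sum>e\<in>T. (d e div p) * v e f)"
    have pw': "p * w' f = (\<Sum>e\<in>T. (d e mod p) * v e f)" for f
      unfolding w'_def
      by (simp add: right_diff_distrib pw sum_distrib_left minus_mult_div_eq_mod[symmetric] left_diff_distrib sum_subtractf mult.assoc)
    have bound: "\<bar>w' f\<bar> \<le> M f" for f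
    proof -
      have "p * \<bar>w' f\<bar> = \<bar>p * w' f\<bar>" using p by (simp add: abs_mult)
      also have "\<dots> \<le> (\<Sum>e\<in>T. \<bar>(d e mod p) * v e f\<bar>)" unfolding pw' by (rule sum_abs)
      also have "\<dots> \<le> (\<Sum>e\<in>T. p * \<bar>v e f\<bar>)"
      proof (rule sum_mono)
        fix e
        have "0 \<le> d e mod p" "d e mod p \<le> p" using p by (auto intro: less_imp_le)
        then show "\<bar>(d e mod p) * v e f\<bar> \<le> p * \<bar>v e f\<bar>"
          by (simp add: abs_mult mult_right_mono)
      qed
      finally show ?thesis using p by (simp add: M_def flip: sum_distrib_left)
    qed
    have "w' f \<in> {- (\<Sum>f\<in>R. M f)..(\<Sum>f\<in>R. M f)}" if "f \<in> R" for f
    proof -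
      have "M f \<le> (\<Sum>f\<in>R. M f)"
        using R that by (intro member_le_sum) (auto simp: M_def sum_nonneg)
      then show ?thesis using bound[of f] by (simp add: abs_le_iff)
    qed
    moreover have "w' f = 0" if "f \<notin> R" for f
      using pw'[of f] p v[OF that] by simp
    ultimately have "w' \<in> B" unfolding B_def by blast
    moreover have "C = (+) w' ` ?L"
      unfolding w(2) coset_eq_iff[OF add_subgroup_lattice] w'_def by (simp add: latticeI)
    ultimately show "C \<in> (\<lambda>x. (+) x ` ?L) ` B" by blast
  qed
  then have "finite (add_cosets ?W ?L)" using finB finite_surj by blast
  moreover have "add_cosets ?W ?L \<noteq> {}"
    using lattice_subset_saturation[of v T] add_subgroupD(1)[OF add_subgroup_lattice, of v T]
    by (auto simp: add_cosets_def)
  ultimately show ?thesis by (simp add: add_index_def card_gt_0_iff)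
qed

text \<open>Maximality gives a complex relation when \<open>e\<close> is adjoined to
  \<open>T\<close>; a rational functional makes its coefficients rational, and a common denominator
  makes them integral.\<close>

lemma maximal_independent_imp_basis:
  assumes E: "finite E" and T: "T \<subseteq> E" "columns_independent v T"
    and max: "\<And>T'. T \<subset> T' \<Longrightarrow> T' \<subseteq> E \<Longrightarrow> \<not> columns_independent v T'"
  shows "column_basis v E T"
  unfolding column_basis_def
proof (intro conjI ballI T)
  have finT: "finite T" using E T(1) finite_subset by blast
  fix e assume e: "e \<in> E"
  show "\<exists>N k. N \<noteq> 0 \<and> (\<forall>f. N * v e f = (\<Sum>h\<in>T. k h * v h f))"
  proof (cases "e \<in> T")
    case True
    have "1 * v e f = (\<Sum>h\<in>T. (if h = e then 1 else 0) * v h f)" for f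
      using True finT by (simp add: if_distrib[of "\<lambda>x. x * _"] cong: if_cong)
    then show ?thesis by (intro exI[of _ 1] exI[of _ "\<lambda>h. if h = e then 1 else 0"]) simp
  next
    case False
    then have "\<not> columns_independent v (insert e T)" using max[of "insert e T"] T(1) e by blast
    then obtain c :: "'a \<Rightarrow> complex" and x where
      rel: "\<And>f. (\<Sum>h\<in>insert e T. c h * of_int (v h f)) = 0" and x: "x \<in> insert e T" "c x \<noteq> 0"
      unfolding columns_independent_def by blast
    have ce: "c e \<noteq> 0"
    proof
      assume "c e = 0"
      then have "(\<Sum>h\<in>T. c h * of_int (v h f)) = 0" for f
        using rel[of f] False finT by simp
      then have "\<forall>h\<in>T. c h = 0" using T(2) unfolding columns_independent_def by blast
      then show False using x \<open>c e = 0\<close> by auto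
    qed
    \<comment> \<open>Normalising at \<open>c e\<close> guarantees that column \<open>e\<close> does
      not disappear from the rational relation.\<close>
    obtain \<phi> :: "complex \<Rightarrow> rat" where \<phi>: "\<And>x y. \<phi> (x + y) = \<phi> x + \<phi> y" "\<And>i x. \<phi> (of_int i * x) = of_int i * \<phi> x" "\<phi> (c e) = 1"
      using rational_functional_exists[OF ce] by blast
    have \<phi>0: "\<phi> 0 = 0" using \<phi>(1)[of 0 0] by simp
    have \<phi>2: "\<phi> (x * of_int i) = of_int i * \<phi> x" for i x
      using \<phi>(2)[of i x] by (simp add: mult.commute)
    have \<phi>sum: "\<phi> (\<Sum>h\<in>S. c h * of_int (v h f)) = (\<Sum>h\<in>S. of_int (v h f) * \<phi> (c h))" if "finite S" for S f
      using that by (induction S rule: finite_induct) (simp_all add: \<phi>0 \<phi>(1) \<phi>2)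
    have rel': "of_int (v e f) + (\<Sum>h\<in>T. of_int (v h f) * \<phi> (c h)) = 0" for f
      using \<phi>sum[of "insert e T" f] rel[of f] False finT \<phi>(3) \<phi>0 by simp
    obtain N k where N: "N \<noteq> (0::int)" "\<And>h. h \<in> T \<Longrightarrow> of_int N * \<phi> (c h) = of_int (k h)"
      using common_denominator[OF finT, of "\<lambda>h. \<phi> (c h)"] by blast
    have "N * v e f = (\<Sum>h\<in>T. - k h * v h f)" for f
    proof -
      have "(of_int (N * v e f) :: rat) = - (\<Sum>h\<in>T. of_int (v h f) * (of_int N * \<phi> (c h)))"
      proof -
        have "of_int N * (of_int (v e f) + (\<Sum>h\<in>T. of_int (v h f) * \<phi> (c h))) = 0"
          by (simp add: rel')
        then show ?thesis
          by (simp add: eq_neg_iff_add_eq_0 distrib_left sum_distrib_left mult.left_commute[of "of_int N"])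
      qed
      also have "\<dots> = of_int (\<Sum>h\<in>T. - k h * v h f)"
        by (simp add: N(2) sum_negf mult.commute)
      finally show ?thesis by (simp only: of_int_eq_iff)
    qed
    then have "N \<noteq> 0 \<and> (\<forall>f. N * v e f = (\<Sum>h\<in>T. - k h * v h f))"
      using N(1) by (intro conjI allI)
    then show ?thesis by (intro exI[of _ N] exI[of _ "\<lambda>h. - k h"])
  qed
qed

lemma columns_independentD:
  "columns_independent v T \<Longrightarrow> (\<And>f. (\<Sum>e\<in>T. c e * complex_of_int (v e f)) = 0) \<Longrightarrow> e \<in> T \<Longrightarrow> c e = 0"
  by (simp add: columns_independent_def)

text \<open>Modulo the lattice \<open>?K\<close> of \<open>T - {g}\<close>, the vectors
  \<open>N * v e\<close> and \<open>k g * v g\<close> agree, so they extend \<open>?K\<close> to the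
  same lattice. It has index |N| in the lattice of the new basis and |k g| in that of the old one;
  the tower law inside the common saturation compares the two.\<close>

lemma column_basis_exchange:
  assumes E: "finite E" and T: "column_basis v E T" and e: "e \<in> E" "e \<notin> T"
    and rel: "\<And>f. N * v e f = (\<Sum>h\<in>T. k h * v h f)" and "N \<noteq> 0" and g: "g \<in> T" "k g \<noteq> 0"
  shows "column_basis v E (insert e (T - {g}))"
    and "\<bar>N\<bar> * int (add_index (saturation (lattice v E)) (lattice v (insert e (T - {g}))))
       = \<bar>k g\<bar> * int (add_index (saturation (lattice v E)) (lattice v T))"
proof -
  let ?S = "T - {g}"
  let ?T1 = "insert e ?S"
  have TE: "T \<subseteq> E" and indep: "columns_independent v T"
    and sp: "\<forall>x\<in>E. \<exists>N k. N \<noteq> 0 \<and> (\<forall>f. N * v x f = (\<Sum>h\<in>T. k h * v h f))"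
    using T by (simp_all add: column_basis_def)
  have finT: "finite T" using E TE finite_subset by blast
  then have finS: "finite ?S" by simp
  have eS: "e \<notin> ?S" using e by simp
  have T_eq: "T = insert g ?S" using g by blast
  have rel': "N * v e f = k g * v g f + (\<Sum>h\<in>?S. k h * v h f)" for f
    unfolding rel using finT g by (simp add: sum.remove)
  show T1: "column_basis v E ?T1"
    unfolding column_basis_def
  proof (intro conjI ballI)
    show "?T1 \<subseteq> E" using TE e by blast
    show "columns_independent v ?T1"
      unfolding columns_independent_def
    proof (intro allI impI)
      fix c :: "'a \<Rightarrow> complex"
      assume c: "\<forall>f. (\<Sum>h\<in>?T1. c h * of_int (v h f)) = 0"
      \<comment> \<open>The coefficients over \<open>T\<close> of \<open>N\<close> times the given
        relation, after \<open>N * v e\<close> is replaced by its expansion.\<close>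
      let ?d = "\<lambda>h. if h = g then c e * of_int (k g) else of_int N * c h + c e * of_int (k h)"
      have "(\<Sum>h\<in>T. ?d h * of_int (v h f)) = 0" for f
      proof -
        have "(\<Sum>h\<in>T. ?d h * of_int (v h f)) = c e * of_int (k g) * of_int (v g f) + (\<Sum>h\<in>?S. (of_int N * c h + c e * of_int (k h)) * of_int (v h f))"
          using finT g by (simp add: sum.remove[of T g])
        also have "(\<Sum>h\<in>?S. (of_int N * c h + c e * of_int (k h)) * of_int (v h f))
          = of_int N * (\<Sum>h\<in>?S. c h * of_int (v h f)) + c e * of_int (\<Sum>h\<in>?S. k h * v h f)"
          by (simp add: distrib_right sum.distrib sum_distrib_left mult.assoc)
        also have "c e * of_int (k g) * of_int (v g f) + \<dots> = of_int N * (\<Sum>h\<in>?S. c h * of_int (v h f)) + c e * of_int (N * v e f)"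
          unfolding rel' by (simp add: algebra_simps)
        also have "\<dots> = of_int N * (\<Sum>h\<in>?T1. c h * of_int (v h f))"
          using finS eS by (simp add: algebra_simps)
        finally show ?thesis using c by simp
      qed
      then have d: "\<forall>h\<in>T. ?d h = 0" using columns_independentD[OF indep, where c = ?d] by blast
      then have ce: "c e = 0" using g by auto
      show "\<forall>h\<in>?T1. c h = 0"
      proof
        fix h assume "h \<in> ?T1"
        then show "c h = 0" using d ce \<open>N \<noteq> 0\<close> by (cases "h = e") auto
      qed
    qed
    fix x assume "x \<in> E"
    then obtain M l where M: "M \<noteq> 0" "\<And>f. M * v x f = (\<Sum>h\<in>T. l h * v h f)" using sp by meson
    \<comment> \<open>These come from multiplying the expansion of \<open>M * v x\<close> by
      \<open>k g\<close> and eliminating \<open>v g\<close> through the exchange relation.\<close>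
    let ?l = "\<lambda>h. if h = e then l g * N else k g * l h - l g * k h"
    have "(k g * M) * v x f = (\<Sum>h\<in>?T1. ?l h * v h f)" for f
    proof -
      have "(\<Sum>h\<in>?T1. ?l h * v h f) = l g * (N * v e f) + (\<Sum>h\<in>?S. (k g * l h - l g * k h) * v h f)"
        using finS e by (simp add: mult.assoc) (rule sum.cong, auto)
      also have "\<dots> = k g * (l g * v g f + (\<Sum>h\<in>?S. l h * v h f))"
        unfolding rel' by (simp add: algebra_simps sum_subtractf sum_distrib_left)
      also have "l g * v g f + (\<Sum>h\<in>?S. l h * v h f) = M * v x f"
        unfolding M(2) using finT g by (simp add: sum.remove)
      finally show ?thesis by simp
    qed
    then have "k g * M \<noteq> 0 \<and> (\<forall>f. (k g * M) * v x f = (\<Sum>h\<in>?T1. ?l h * v h f))"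
      using M(1) g(2) by simp
    then show "\<exists>N k. N \<noteq> 0 \<and> (\<forall>f. N * v x f = (\<Sum>h\<in>?T1. k h * v h f))"
      by (intro exI[of _ "k g * M"] exI[of _ ?l])
  qed
  let ?W = "saturation (lattice v E)"
  let ?K = "lattice v ?S"
  define m where "m x i = (\<lambda>f. i * v x f)" for x i
  have madd: "m x (i + j) = m x i + m x j" for x i j by (simp add: m_def fun_eq_iff distrib_right)
  \<comment> \<open>By independence no nonzero multiple of column \<open>x\<close> lies in
    \<open>?K\<close>, the condition under which adjoining it is a cyclic extension with computable
    index.\<close>
  have free: "i = 0" if B: "columns_independent v (insert x ?S)" "x \<notin> ?S" and i: "m x i \<in> ?K" for x i
  proof -
    obtain c where c: "(\<lambda>f. i * v x f) = (\<lambda>f. \<Sum>h\<in>?S. c h * v h f)"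
      using i unfolding m_def lattice_def by blast
    let ?d = "\<lambda>h. complex_of_int (if h = x then i else - c h)"
    have "(\<Sum>h\<in>insert x ?S. ?d h * of_int (v h f)) = 0" for f
    proof -
      have "(\<Sum>h\<in>insert x ?S. ?d h * of_int (v h f)) = of_int (i * v x f) + (\<Sum>h\<in>?S. ?d h * of_int (v h f))"
        using finS B(2) by simp
      also have "(\<Sum>h\<in>?S. ?d h * of_int (v h f)) = (\<Sum>h\<in>?S. of_int (- (c h * v h f)))"
        using B(2) by (intro sum.cong) auto
      also have "\<dots> = of_int (- (\<Sum>h\<in>?S. c h * v h f))" by (simp add: sum_negf)
      also have "(\<Sum>h\<in>?S. c h * v h f) = i * v x f" using fun_cong[OF c, of f] by simp
      finally show ?thesis by simp
    qed
    then have "?d x = 0" using columns_independentD[OF B(1), where c = ?d] by blast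
    then show ?thesis by simp
  qed
  have L: "lattice v (insert x ?S) = {y + m x i |y i. y \<in> ?K}" if "x \<notin> ?S" for x
    unfolding lattice_insert[OF finS that] m_def ..
  define b where "b = (\<lambda>f. \<Sum>h\<in>?S. k h * v h f)"
  have bK: "(\<lambda>f. i * b f) \<in> ?K" for i unfolding b_def by (rule lattice_scale[OF latticeI])
  have mNe: "m e (N * i) = (\<lambda>f. i * b f) + m g (k g * i)" for i
  proof
    fix f
    have "m e (N * i) f = i * (N * v e f)" by (simp add: m_def mult_ac)
    also have "\<dots> = i * b f + (k g * i) * v g f" unfolding rel' b_def by (simp add: algebra_simps)
    finally show "m e (N * i) f = ((\<lambda>f. i * b f) + m g (k g * i)) f" by (simp add: m_def)
  qed
  \<comment> \<open>The two generators differ by multiples of \<open>b\<close>, which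
    \<open>?K\<close> absorbs.\<close>
  have L0: "{y + m e (N * i) |y i. y \<in> ?K} = {y + m g (k g * i) |y i. y \<in> ?K}" (is "?A = ?B")
  proof (intro subset_antisym subsetI)
    fix z assume "z \<in> ?A"
    then obtain y i where z: "z = y + m e (N * i)" "y \<in> ?K" by blast
    then have "z = (y + (\<lambda>f. i * b f)) + m g (k g * i)" by (simp add: mNe add.assoc)
    moreover have "y + (\<lambda>f. i * b f) \<in> ?K" by (rule add_subgroupD(4)[OF add_subgroup_lattice z(2) bK])
    ultimately show "z \<in> ?B" by blast
  next
    fix z assume "z \<in> ?B"
    then obtain y i where z: "z = y + m g (k g * i)" "y \<in> ?K" by blast
    then have "z = (y - (\<lambda>f. i * b f)) + m e (N * i)" by (simp add: mNe)
    moreover have "y - (\<lambda>f. i * b f) \<in> ?K" by (rule add_subgroupD(2)[OF add_subgroup_lattice z(2) bK])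
    ultimately show "z \<in> ?A" by blast
  qed
  have gS: "g \<notin> ?S" by simp
  have indT1: "columns_independent v ?T1" using T1 by (simp add: column_basis_def)
  have W: "add_subgroup ?W" by (rule add_subgroup_saturation[OF refl])
  have tower: "add_index ?W {y + m x (n * i) |y i. y \<in> ?K} = add_index ?W (lattice v (insert x ?S)) * nat \<bar>n\<bar>"
    if x: "x \<notin> ?S" "columns_independent v (insert x ?S)" "insert x ?S \<subseteq> E" and "n \<noteq> 0" for x n
  proof -
    have i: "add_index (lattice v (insert x ?S)) {y + m x (n * i) |y i. y \<in> ?K} = nat \<bar>n\<bar>"
      unfolding L[OF x(1)]
      by (rule index_extend_cyclic[OF add_subgroup_lattice madd free[OF x(2,1)] \<open>n \<noteq> 0\<close>])
    have sub1: "{y + m x (n * i) |y i. y \<in> ?K} \<subseteq> lattice v (insert x ?S)"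
      unfolding L[OF x(1)] by blast
    have sub2: "lattice v (insert x ?S) \<subseteq> ?W"
      using lattice_mono[OF E x(3)] lattice_subset_saturation by blast
    have "add_subgroup {y + m x (n * i) |y i. y \<in> ?K}"
      unfolding add_subgroup_def
    proof (intro conjI ballI)
      have "0 = 0 + m x (n * 0)" by (simp add: m_def zero_fun_def)
      then show "0 \<in> {y + m x (n * i) |y i. y \<in> ?K}"
        using add_subgroupD(1)[OF add_subgroup_lattice] by blast
      fix z w assume "z \<in> {y + m x (n * i) |y i. y \<in> ?K}" "w \<in> {y + m x (n * i) |y i. y \<in> ?K}"
      then obtain y i y' i' where zw: "z = y + m x (n * i)" "y \<in> ?K" "w = y' + m x (n * i')" "y' \<in> ?K" by blast
      then have "z - w = (y - y') + m x (n * (i - i'))" by (simp add: m_def fun_eq_iff algebra_simps)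
      then show "z - w \<in> {y + m x (n * i) |y i. y \<in> ?K}"
        using add_subgroupD(2)[OF add_subgroup_lattice zw(2,4)] by blast
    qed
    from index_tower[OF W add_subgroup_lattice this sub1 sub2] show ?thesis unfolding i .
  qed
  have "add_index ?W (lattice v ?T1) * nat \<bar>N\<bar> = add_index ?W (lattice v T) * nat \<bar>k g\<bar>"
  proof -
    have "add_index ?W (lattice v ?T1) * nat \<bar>N\<bar> = add_index ?W {y + m e (N * i) |y i. y \<in> ?K}"
      using tower[OF eS indT1 _ \<open>N \<noteq> 0\<close>] T1 by (simp add: column_basis_def)
    also have "\<dots> = add_index ?W {y + m g (k g * i) |y i. y \<in> ?K}" unfolding L0 ..
    also have "\<dots> = add_index ?W (lattice v T) * nat \<bar>k g\<bar>"
      using tower[OF gS _ _ g(2)] indep TE unfolding T_eq[symmetric] by blast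
    finally show ?thesis .
  qed
  then have "int (add_index ?W (lattice v ?T1) * nat \<bar>N\<bar>) = int (add_index ?W (lattice v T) * nat \<bar>k g\<bar>)"
    by simp
  then show "\<bar>N\<bar> * int (add_index ?W (lattice v ?T1)) = \<bar>k g\<bar> * int (add_index ?W (lattice v T))"
    by (simp add: mult.commute)
qed

text \<open>An element of \<open>T\<close> outside \<open>T'\<close> would be dependent on
  \<open>T'\<close>, against the independence of \<open>T\<close>. This ends the chain of
  exchanges.\<close>

lemma column_basis_subset_eq:
  assumes "finite T" "column_basis v E T" "column_basis v E T'" "T' \<subseteq> T"
  shows "T' = T"
proof (rule ccontr)
  assume "T' \<noteq> T"
  then obtain x where x: "x \<in> T" "x \<notin> T'" using assms(4) by blast
  then have "x \<in> E" using assms(2) by (auto simp: column_basis_def)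
  then obtain N k where N: "N \<noteq> 0" "\<And>f. N * v x f = (\<Sum>h\<in>T'. k h * v h f)"
    using assms(3) unfolding column_basis_def by meson
  let ?d = "\<lambda>h. complex_of_int (if h = x then N else if h \<in> T' then - k h else 0)"
  have "(\<Sum>h\<in>T. ?d h * of_int (v h f)) = 0" for f
  proof -
    have "(\<Sum>h\<in>T. ?d h * of_int (v h f)) = (\<Sum>h\<in>insert x T'. ?d h * of_int (v h f))"
      using assms(1,4) x by (intro sum.mono_neutral_right) auto
    also have "\<dots> = of_int (N * v x f) + (\<Sum>h\<in>T'. ?d h * of_int (v h f))"
      using x assms(1,4) finite_subset by (subst sum.insert) auto
    also have "(\<Sum>h\<in>T'. ?d h * of_int (v h f)) = (\<Sum>h\<in>T'. of_int (- (k h * v h f)))"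
      using x by (intro sum.cong) auto
    also have "\<dots> = - of_int (N * v x f)" unfolding N(2) by (simp add: sum_negf)
    finally show ?thesis by simp
  qed
  moreover have "columns_independent v T" using assms(2) by (simp add: column_basis_def)
  ultimately have "?d x = 0" using x(1) columns_independentD[where c = ?d] by blast
  then show False using N(1) by simp
qed

text \<open>Any two bases are joined by single exchanges, and each exchange multiplies both the squared
  index and \<open>D\<close> by the square of the same coefficient.\<close>

lemma index_square_proportional:
  fixes D :: "'e set \<Rightarrow> complex" and v :: "'e \<Rightarrow> 'f \<Rightarrow> int"
  assumes E: "finite E" and T: "column_basis v E T" and T': "column_basis v E T'"
    and D: "\<And>T e g N k. column_basis v E T \<Longrightarrow> e \<in> E \<Longrightarrow> e \<notin> T \<Longrightarrow> g \<in> T \<Longrightarrow> N \<noteq> 0 \<Longrightarrow>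
       (\<And>f. N * v e f = (\<Sum>h\<in>T. k h * v h f)) \<Longrightarrow>
       (of_int N)\<^sup>2 * D (insert e (T - {g})) = (of_int (k g))\<^sup>2 * D T"
  defines "t \<equiv> \<lambda>T. complex_of_int (int (add_index (saturation (lattice v E)) (lattice v T)))"
  shows "D T' * (t T)\<^sup>2 = D T * (t T')\<^sup>2"
  using T'
proof (induction "card (T - T')" arbitrary: T' rule: less_induct)
  case less
  have fin: "finite T" "finite T'"
    using E T less.prems finite_subset by (auto simp: column_basis_def)
  show ?case
  proof (cases "T \<subseteq> T'")
    case True
    then show ?thesis using column_basis_subset_eq[OF fin(2) less.prems T] by simp
  next
    case False
    then obtain e where e: "e \<in> T" "e \<notin> T'" by blast
    then have eE: "e \<in> E" using T by (auto simp: column_basis_def)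
    obtain N k where N: "N \<noteq> 0" "\<And>f. N * v e f = (\<Sum>h\<in>T'. k h * v h f)"
      using less.prems eE unfolding column_basis_def by meson
    \<comment> \<open>Otherwise \<open>v e\<close> would depend only on members of \<open>T'\<close>
      that lie in \<open>T\<close>, contradicting the independence of \<open>T\<close>. Removing a
      \<open>g\<close> outside \<open>T\<close> ensures that the exchange brings \<open>T'\<close>
      closer to \<open>T\<close>.\<close>
    have "\<exists>g\<in>T' - T. k g \<noteq> 0"
    proof (rule ccontr)
      assume "\<not> (\<exists>g\<in>T' - T. k g \<noteq> 0)"
      then have k0: "k h = 0" if "h \<in> T'" "h \<notin> T" for h using that by blast
      let ?d = "\<lambda>h. complex_of_int (if h = e then N else if h \<in> T' then - k h else 0)"
      have "(\<Sum>h\<in>T. ?d h * of_int (v h f)) = 0" for f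
      proof -
        have "(\<Sum>h\<in>T. ?d h * of_int (v h f)) = of_int (N * v e f) + (\<Sum>h\<in>T - {e}. ?d h * of_int (v h f))"
          using fin e by (simp add: sum.remove)
        also have "(\<Sum>h\<in>T - {e}. ?d h * of_int (v h f)) = (\<Sum>h\<in>T'. of_int (- (k h * v h f)))"
          using fin e k0 by (intro sum.mono_neutral_cong) auto
        also have "\<dots> = - of_int (N * v e f)" unfolding N(2) by (simp add: sum_negf)
        finally show ?thesis by simp
      qed
      moreover have "columns_independent v T" using T by (simp add: column_basis_def)
      ultimately have "?d e = 0" using e(1) columns_independentD[where c = ?d] by blast
      then show False using N(1) by simp
    qed
    then obtain g where g: "g \<in> T'" "g \<notin> T" "k g \<noteq> 0" by blast
    let ?T1 = "insert e (T' - {g})"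
    have b: "column_basis v E ?T1"
      and idx: "\<bar>N\<bar> * int (add_index (saturation (lattice v E)) (lattice v ?T1))
       = \<bar>k g\<bar> * int (add_index (saturation (lattice v E)) (lattice v T'))"
      using column_basis_exchange[OF E less.prems eE e(2) N(2,1) g(1,3)] by blast+
    have "T - ?T1 = (T - T') - {e}" using g by blast
    then have "card (T - ?T1) < card (T - T')"
      using e fin by (metis DiffI Diff_iff card_Diff1_less finite_Diff)
    from less.hyps[OF this b] have IH: "D ?T1 * (t T)\<^sup>2 = D T * (t ?T1)\<^sup>2" .
    have "of_int (\<bar>N\<bar> * int (add_index (saturation (lattice v E)) (lattice v ?T1)))
       = (of_int (\<bar>k g\<bar> * int (add_index (saturation (lattice v E)) (lattice v T'))) :: complex)"
      unfolding idx ..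
    then have "of_int \<bar>N\<bar> * t ?T1 = of_int \<bar>k g\<bar> * t T'" unfolding t_def of_int_mult .
    then have "(of_int \<bar>N\<bar> * t ?T1)\<^sup>2 = (of_int \<bar>k g\<bar> * t T')\<^sup>2" by simp
    then have tt: "(of_int N)\<^sup>2 * (t ?T1)\<^sup>2 = (of_int (k g))\<^sup>2 * (t T')\<^sup>2"
      by (simp add: power_mult_distrib flip: of_int_power)
    have DD: "(of_int N)\<^sup>2 * D ?T1 = (of_int (k g))\<^sup>2 * D T'"
      by (rule D[OF less.prems eE e(2) g(1) N])
    have "(of_int (k g))\<^sup>2 * (D T' * (t T)\<^sup>2) = (of_int N)\<^sup>2 * (D ?T1 * (t T)\<^sup>2)"
      using DD by (simp flip: mult.assoc)
    also have "\<dots> = D T * ((of_int N)\<^sup>2 * (t ?T1)\<^sup>2)" unfolding IH by (simp add: mult_ac)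
    also have "\<dots> = (of_int (k g))\<^sup>2 * (D T * (t T')\<^sup>2)" unfolding tt by (simp add: mult_ac)
    finally show ?thesis using g(3) by simp
  qed
qed

section \<open>Torsion numbers and minors of a CW-complex\<close>

text \<open>Extension by 0 makes each column an integral chain of \<open>X\<close>, and lets
  \<open>f\<close> range over the whole index type.\<close>

definition boundary_column :: "('a, 'c) cell_structure \<Rightarrow> nat \<Rightarrow> 'c \<Rightarrow> 'c \<Rightarrow> int" where
  "boundary_column X m e f = (if f \<in> cells X m then incidence X m e f else 0)"

lemma incidence_subcomplex [simp]: "incidence (subcomplex X k T) m e f = incidence X m e f"
proof -
  have "pinch (subcomplex X k T) m f = pinch X m f"
    by (simp add: pinch_def open_cell_def subcomplex_def fun_eq_iff)
  then show ?thesis by (simp add: incidence_def subcomplex_def)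
qed

lemma cells_subcomplex [simp]:
  "cells (subcomplex X k T) j = (if j < k then cells X j else if j = k then T else {})"
  by (simp add: subcomplex_def)

lemma cell_boundary_subcomplex:
  "cell_boundary (subcomplex X (Suc m) T) (Suc m) c = (\<lambda>f. \<Sum>e\<in>T. c e * of_int (boundary_column X m e f))"
proof
  fix f
  show "cell_boundary (subcomplex X (Suc m) T) (Suc m) c f = (\<Sum>e\<in>T. c e * of_int (boundary_column X m e f))"
    by (cases "f \<in> cells X m") (simp_all add: boundary_column_def mult.commute)
qed

lemma cell_boundaries_subcomplex:
  fixes X :: "('a, 'c) cell_structure"
  shows "cell_boundaries (subcomplex X (Suc m) T) m = lattice (boundary_column X m) T"
proof (intro subset_antisym subsetI)
  fix w :: "'c \<Rightarrow> int" assume "w \<in> cell_boundaries (subcomplex X (Suc m) T) m"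
  then obtain c where "w = (\<lambda>f. \<Sum>e\<in>T. c e * boundary_column X m e f)"
    unfolding cell_boundaries_def cell_boundary_subcomplex by auto
  then show "w \<in> lattice (boundary_column X m) T" by (simp only: latticeI)
next
  fix w assume "w \<in> lattice (boundary_column X m) T"
  then obtain c where c: "w = (\<lambda>f. \<Sum>e\<in>T. c e * boundary_column X m e f)" unfolding lattice_def by blast
  let ?c = "\<lambda>e. if e \<in> T then c e else 0"
  have "?c \<in> cell_chains (subcomplex X (Suc m) T) (Suc m)" by (simp add: cell_chains_def)
  moreover have "cell_boundary (subcomplex X (Suc m) T) (Suc m) ?c = w"
    unfolding c cell_boundary_subcomplex by (intro ext sum.cong) auto
  ultimately show "w \<in> cell_boundaries (subcomplex X (Suc m) T) m"
    unfolding cell_boundaries_def by blast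
qed

lemma cell_cycles_subcomplex:
  fixes X :: "('a, 'c) cell_structure"
  shows "(cell_cycles (subcomplex X (Suc m) T) m :: ('c \<Rightarrow> 'r::comm_ring_1) set) = cell_cycles X m"
proof -
  have "cell_boundary (subcomplex X (Suc m) T) m = (cell_boundary X m :: ('c \<Rightarrow> 'r) \<Rightarrow> _)"
    by (cases m) (auto simp: fun_eq_iff)
  then show ?thesis by (simp add: cell_cycles_def cell_chains_def)
qed

lemma acyclic_cells_Suc_iff:
  fixes X :: "('a, 'c) cell_structure"
  shows
  "acyclic_cells X (Suc m) T \<longleftrightarrow> T \<subseteq> cells X (Suc m) \<and> columns_independent (boundary_column X m) T"
proof -
  let ?Z = "cell_cycles (subcomplex X (Suc m) T) (Suc m) :: ('c \<Rightarrow> complex) set"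
  have rel: "(\<forall>f. (\<Sum>e\<in>T. c e * of_int (boundary_column X m e f)) = 0)
      \<longleftrightarrow> cell_boundary (subcomplex X (Suc m) T) (Suc m) c = (\<lambda>_. 0)" for c :: "'c \<Rightarrow> complex"
    unfolding cell_boundary_subcomplex by (simp add: fun_eq_iff)
  have "?Z = {\<lambda>_. 0} \<longleftrightarrow> columns_independent (boundary_column X m) T"
  proof
    assume Z: "?Z = {\<lambda>_. 0}"
    show "columns_independent (boundary_column X m) T"
      unfolding columns_independent_def
    proof (intro allI impI ballI)
      fix c :: "'c \<Rightarrow> complex" and e
      assume c: "\<forall>f. (\<Sum>e\<in>T. c e * of_int (boundary_column X m e f)) = 0" and e: "e \<in> T"
      let ?c = "\<lambda>e. if e \<in> T then c e else 0"
      have "\<forall>f. (\<Sum>e\<in>T. ?c e * of_int (boundary_column X m e f)) = 0"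
        using c by (simp cong: sum.cong)
      then have "?c \<in> ?Z" using rel[of ?c] by (simp add: cell_cycles_def cell_chains_def)
      then have "?c = (\<lambda>_. 0)" using Z by simp
      then show "c e = 0" using e by (auto dest: fun_cong[of _ _ e])
    qed
  next
    assume ind: "columns_independent (boundary_column X m) T"
    have "c = (\<lambda>_. 0)" if "c \<in> ?Z" for c
    proof
      fix e
      have "cell_boundary (subcomplex X (Suc m) T) (Suc m) c = (\<lambda>_. 0)" "\<forall>e. e \<notin> T \<longrightarrow> c e = 0"
        using that by (auto simp: cell_cycles_def cell_chains_def)
      then show "c e = 0"
        using ind rel[of c] unfolding columns_independent_def by blast
    qed
    moreover have "(\<lambda>_. 0) \<in> ?Z"
      by (simp add: cell_cycles_def cell_chains_def cell_boundary_subcomplex del: cell_boundary.simps)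
    ultimately show "?Z = {\<lambda>_. 0}" by blast
  qed
  then show ?thesis by (simp add: acyclic_cells_def)
qed

context CW
begin

text \<open>The only point where \<open>incidence_compose_eq_0\<close>, and with it the homological
  part, enters the algebra.\<close>

lemma lattice_subset_cycles:
  assumes "T \<subseteq> cells X (Suc m)"
  shows "lattice (boundary_column X m) T \<subseteq> cell_cycles X m"
proof
  fix w assume "w \<in> lattice (boundary_column X m) T"
  then obtain c where c: "w = (\<lambda>f. \<Sum>e\<in>T. c e * boundary_column X m e f)" unfolding lattice_def by blast
  have chain: "w \<in> cell_chains X m" by (simp add: c cell_chains_def boundary_column_def)
  have "cell_boundary X m w = (\<lambda>_. 0)"
  proof (cases m)
    case (Suc l)
    have "(\<Sum>f\<in>cells X m. incidence X l f g * w f) = 0" if g: "g \<in> cells X l" for g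
    proof -
      have "(\<Sum>f\<in>cells X m. incidence X l f g * w f)
          = (\<Sum>e\<in>T. c e * (\<Sum>f\<in>cells X m. incidence X m e f * incidence X l f g))"
        unfolding c sum_distrib_left
        by (subst sum.swap) (simp add: boundary_column_def mult_ac)
      also have "\<dots> = 0"
        using incidence_compose_eq_0[OF _ g] assms Suc by (intro sum.neutral) auto
      finally show ?thesis .
    qed
    then show ?thesis using Suc by (auto simp: fun_eq_iff)
  qed simp
  with chain show "w \<in> cell_cycles X m" by (simp add: cell_cycles_def)
qed

text \<open>The integers are torsion-free: if a nonzero multiple of \<open>w\<close> is a cycle, so
  is \<open>w\<close>.\<close>

lemma saturation_subset_cycles:
  assumes "T \<subseteq> cells X (Suc m)"
  shows "saturation (lattice (boundary_column X m) T) \<subseteq> cell_cycles X m"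
proof
  fix w assume "w \<in> saturation (lattice (boundary_column X m) T)"
  then obtain n where n: "n \<noteq> 0" "(\<lambda>f. n * w f) \<in> cell_cycles X m"
    using lattice_subset_cycles[OF assms] unfolding saturation_def by blast
  have "w \<in> cell_chains X m" using n by (auto simp: cell_cycles_def cell_chains_def)
  moreover have "cell_boundary X m (\<lambda>f. n * w f) g = n * cell_boundary X m w g" for g
    by (cases m) (simp_all add: sum_distrib_left mult_ac)
  then have "cell_boundary X m w g = 0" for g
    using n by (auto simp: cell_cycles_def fun_eq_iff)
  ultimately show "w \<in> cell_cycles X m" by (auto simp: cell_cycles_def)
qed

text \<open>A coset is torsion exactly when a positive multiple of its representative lies in
  \<open>L\<close>, that is, when the representative is in the saturation. As the saturation
  consists of cycles, all its cosets count.\<close>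

lemma torsion_number_eq_index:
  assumes "T \<subseteq> cells X (Suc m)"
  defines "L \<equiv> lattice (boundary_column X m) T"
  shows "torsion_number X (Suc m) T = add_index (saturation L) L"
proof -
  let ?Z = "integral_cycle_group (subcomplex X (Suc m) T) m"
  let ?G = "?Z Mod L"
  have L: "add_subgroup L" unfolding L_def by (rule add_subgroup_lattice)
  have plus: "(\<lambda>e. c e + d e) = c + d" for c d :: "'c \<Rightarrow> int" by (simp add: fun_eq_iff)
  have carr: "carrier ?Z = cell_cycles X m" and mult: "mult ?Z = (+)"
    by (simp_all add: integral_cycle_group_def cell_cycles_subcomplex fun_eq_iff)
  have carrier: "carrier ?G = (\<lambda>a. (+) a ` L) ` cell_cycles X m"
    by (auto simp: FactGroup_def RCOSETS_def r_coset_def carr mult image_def add.commute)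
  have one: "\<one>\<^bsub>?G\<^esub> = L" by (simp add: FactGroup_def)
  have mult_coset: "(+) a ` L \<otimes>\<^bsub>?G\<^esub> (+) b ` L = (+) (a + b) ` L" for a b
  proof (intro subset_antisym subsetI)
    fix z assume "z \<in> (+) a ` L \<otimes>\<^bsub>?G\<^esub> (+) b ` L"
    then obtain x y where xy: "x \<in> L" "y \<in> L" "z = (a + x) + (b + y)"
      by (auto simp: FactGroup_def set_mult_def mult)
    then have "z = (a + b) + (x + y)" by (simp add: add_ac)
    then show "z \<in> (+) (a + b) ` L" using add_subgroupD(4)[OF L xy(1,2)] by blast
  next
    fix z assume "z \<in> (+) (a + b) ` L"
    then obtain x where x: "x \<in> L" "z = (a + x) + (b + 0)" by (auto simp: add_ac)
    then show "z \<in> (+) a ` L \<otimes>\<^bsub>?G\<^esub> (+) b ` L"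
      using add_subgroupD(1)[OF L] unfolding FactGroup_def set_mult_def mult by force
  qed
  have pow: "(+) a ` L [^]\<^bsub>?G\<^esub> n = (+) (\<lambda>f. int n * a f) ` L" for a and n :: nat
  proof (induction n)
    case 0
    have "(+) (\<lambda>f. int 0 * a f) ` L = L" by (simp flip: zero_fun_def)
    then show ?case by (simp add: nat_pow_def one)
  next
    case (Suc n)
    have "(+) a ` L [^]\<^bsub>?G\<^esub> Suc n = ((+) a ` L [^]\<^bsub>?G\<^esub> n) \<otimes>\<^bsub>?G\<^esub> (+) a ` L"
      by (simp add: nat_pow_def)
    also have "\<dots> = (+) ((\<lambda>f. int n * a f) + a) ` L" unfolding Suc mult_coset ..
    also have "(\<lambda>f. int n * a f) + a = (\<lambda>f. int (Suc n) * a f)" by (simp add: fun_eq_iff algebra_simps)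
    finally show ?case .
  qed
  have coset_one: "(+) a ` L = L \<longleftrightarrow> a \<in> L" for a
    using coset_eq_iff[OF L, of a 0] by simp
  have sat: "a \<in> saturation L \<longleftrightarrow> (\<exists>n::nat. n > 0 \<and> (\<lambda>f. int n * a f) \<in> L)" for a
  proof
    assume "a \<in> saturation L"
    then obtain n where n: "n \<noteq> 0" "(\<lambda>f. n * a f) \<in> L" unfolding saturation_def by blast
    have "(\<lambda>f. sgn n * (n * a f)) \<in> L" using lattice_scale n(2) unfolding L_def by blast
    moreover have "sgn n * (n * a f) = int (nat \<bar>n\<bar>) * a f" for f
      by (simp add: sgn_if abs_if)
    ultimately show "\<exists>n::nat. n > 0 \<and> (\<lambda>f. int n * a f) \<in> L"
      using n(1) by (intro exI[of _ "nat \<bar>n\<bar>"]) simp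
  next
    assume "\<exists>n::nat. n > 0 \<and> (\<lambda>f. int n * a f) \<in> L"
    then obtain n :: nat where "n > 0" "(\<lambda>f. int n * a f) \<in> L" by blast
    then show "a \<in> saturation L" unfolding saturation_def by (intro CollectI exI[of _ "int n"]) simp
  qed
  have "torsion_part ?G = (\<lambda>a. (+) a ` L) ` {a \<in> cell_cycles X m. \<exists>n::nat. n > 0 \<and> (+) a ` L [^]\<^bsub>?G\<^esub> n = \<one>\<^bsub>?G\<^esub>}"
    unfolding torsion_part_def carrier by blast
  also have "\<dots> = (\<lambda>a. (+) a ` L) ` {a \<in> cell_cycles X m. a \<in> saturation L}"
    unfolding pow one coset_one sat ..
  also have "{a \<in> cell_cycles X m. a \<in> saturation L} = saturation L"
    using saturation_subset_cycles[OF assms(1)] unfolding L_def by blast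
  also have "(\<lambda>a. (+) a ` L) ` saturation L = add_cosets (saturation L) L"
    unfolding add_cosets_def ..
  finally show ?thesis
    by (simp add: integral_homology_def cell_boundaries_subcomplex add_index_def L_def)
qed

lemma k_base_imp_column_basis:
  assumes "k_base X (Suc m) T"
  shows "column_basis (boundary_column X m) (cells X (Suc m)) T"
  using assms unfolding k_base_def acyclic_cells_Suc_iff
  by (intro maximal_independent_imp_basis finite_cells) auto

lemma Q_matrix_exchange:
  assumes T: "T \<subseteq> cells X (Suc m)" "g \<in> T" and e: "e \<in> cells X (Suc m)" "e \<notin> T"
    and rel: "\<And>f. N * boundary_column X m e f = (\<Sum>h\<in>T. k h * boundary_column X m h f)"
  shows "(of_int N)\<^sup>2 * principal_minor (Q_matrix X (Suc m)) (insert e (T - {g}))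
    = (of_int (k g))\<^sup>2 * principal_minor (Q_matrix X (Suc m)) T"
proof -
  let ?E = "cells X (Suc m)" and ?Q = "Q_matrix X (Suc m)"
  have row: "of_int N * ?Q e y = (\<Sum>h\<in>T. of_int (k h) * ?Q h y)" for y
  proof -
    obtain u where u: "(\<lambda>e. ?Q e y) = (\<lambda>e. if e \<in> ?E then \<Sum>f\<in>cells X m. of_int (incidence X m e f) * u f else 0)"
      using Q_matrix_column[OF finite_cells, of m y] by auto
    have Q: "?Q x y = (\<Sum>f\<in>cells X m. of_int (boundary_column X m x f) * u f)" if "x \<in> ?E" for x
      using fun_cong[OF u, of x] that by (simp add: boundary_column_def)
    have "of_int N * ?Q e y = (\<Sum>f\<in>cells X m. of_int (N * boundary_column X m e f) * u f)"
      by (simp add: Q[OF e(1)] sum_distrib_left mult.assoc)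
    also have "\<dots> = (\<Sum>f\<in>cells X m. \<Sum>h\<in>T. of_int (k h) * (of_int (boundary_column X m h f) * u f))"
      unfolding rel by (simp add: sum_distrib_right mult.assoc)
    also have "\<dots> = (\<Sum>h\<in>T. of_int (k h) * ?Q h y)"
      using T(1) by (subst sum.swap) (auto simp: Q sum_distrib_left intro!: sum.cong)
    finally show ?thesis .
  qed
  \<comment> \<open>Hermitian symmetry turns the row relation into its conjugate, and conjugation
    fixes the integer coefficients.\<close>
  have col: "of_int N * ?Q x e = (\<Sum>h\<in>T. of_int (k h) * ?Q x h)" if x: "x \<in> ?E" for x
  proof -
    have "of_int N * ?Q x e = cnj (of_int N * ?Q e x)"
      using Q_matrix_hermitian[OF finite_cells x e(1)] by simp
    also have "\<dots> = (\<Sum>h\<in>T. of_int (k h) * cnj (?Q h x))" unfolding row by simp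
    also have "\<dots> = (\<Sum>h\<in>T. of_int (k h) * ?Q x h)"
      using Q_matrix_hermitian[OF finite_cells x] T(1) by (intro sum.cong refl) (metis subsetD)
    finally show ?thesis .
  qed
  show ?thesis
    using principal_minor_exchange[where k = "\<lambda>h. complex_of_int (k h)" and A = ?Q and E = ?E and N = "of_int N"]
      finite_subset[OF T(1) finite_cells] T e row col by blast
qed

text \<open>\<open>ennreal\<close> sends negative reals to 0, which accounts for the
  \<open>max\<close>. The truncation is harmless later because it commutes with multiplication by
  nonnegative factors.\<close>

lemma measure_lower_matroidal:
  assumes "k_base X k T"
  shows "measure (lower_matroidal_measure X k) {T} = max 0 (Re (principal_minor (Q_matrix X k) T))"
proof -
  have "{T. k_base X k T} \<subseteq> Pow (cells X k)" by (auto simp: k_base_def acyclic_cells_def)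
  then have "finite {T. k_base X k T}" using finite_cells finite_subset by blast
  then have "emeasure (lower_matroidal_measure X k) {T} = ennreal (Re (principal_minor (Q_matrix X k) T))"
    using assms by (simp add: lower_matroidal_measure_def emeasure_point_measure_finite)
  then show ?thesis
    by (cases "Re (principal_minor (Q_matrix X k) T) \<ge> 0") (auto simp: measure_def ennreal_neg)
qed

lemma k_base_0_eq_empty:
  assumes "k_base X 0 T" shows "T = {}"
proof (rule ccontr)
  assume "T \<noteq> {}"
  then obtain x where x: "x \<in> T" by blast
  let ?c = "\<lambda>e. if e = x then 1 else (0::complex)"
  have "?c \<in> cell_cycles (subcomplex X 0 T) 0"
    using x by (simp add: cell_cycles_def cell_chains_def)
  then have "?c = (\<lambda>_. 0)"
    using assms by (simp add: k_base_def acyclic_cells_def)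
  from fun_cong[OF this, of x] show False by simp
qed

end

theorem proposition3p1:
  fixes X :: "('a, 'c) cell_structure" and k :: nat
  assumes "finite_CW X"
  shows "\<exists>a::real. \<forall>T. k_base X k T \<longrightarrow>
           measure (lower_matroidal_measure X k) {T} = a * (real (torsion_number X k T))\<^sup>2"
proof -
  interpret CW X by (rule CW.intro[OF assms])
  show ?thesis
  proof (cases k)
    \<comment> \<open>Here the boundary map is 0, so the empty set is the only possible base; its
      torsion number is 1, and the constant is its measure.\<close>
    case 0
    then show ?thesis
      using k_base_0_eq_empty
      by (intro exI[of _ "measure (lower_matroidal_measure X 0) {{}}"]) auto
  next
    case (Suc m)
    show ?thesis
    proof (cases "\<exists>S. k_base X k S")
      case True
      \<comment> \<open>\<open>S\<close> serves as reference base; if there is no base, the claim is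
        vacuous.\<close>
      then obtain S where S: "k_base X k S" by blast
      let ?v = "boundary_column X m" and ?E = "cells X k"
      define D where "D = principal_minor (Q_matrix X k)"
      define t where "t T = real (torsion_number X k T)" for T
      have basis: "column_basis ?v ?E T" if "k_base X k T" for T
        using k_base_imp_column_basis that Suc by simp
      have t: "t T = real (add_index (saturation (lattice ?v ?E)) (lattice ?v T))" if "k_base X k T" for T
        using torsion_number_eq_index[of T m] saturation_basis[OF finite_cells basis[OF that]] basis[OF that] Suc
        by (simp add: t_def column_basis_def)
      \<comment> \<open>Needed to divide by the squared torsion number of \<open>S\<close> in the
        constant.\<close>
      have "t S > 0"
        using index_saturation_pos[of S "cells X m" ?v] finite_cells basis[OF S] saturation_basis[OF finite_cells basis[OF S]]
          finite_subset[of S ?E]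
        by (simp add: t[OF S] column_basis_def boundary_column_def)
      have proportional: "Re (D T) * (t S)\<^sup>2 = Re (D S) * (t T)\<^sup>2" if T: "k_base X k T" for T
      proof -
        have "D T * (complex_of_int (int (add_index (saturation (lattice ?v ?E)) (lattice ?v S))))\<^sup>2
            = D S * (complex_of_int (int (add_index (saturation (lattice ?v ?E)) (lattice ?v T))))\<^sup>2"
        proof (rule index_square_proportional[OF finite_cells basis[OF S] basis[OF T]])
          fix B e g N c
          assume "column_basis ?v ?E B" "e \<in> ?E" "e \<notin> B" "g \<in> B"
            "\<And>f. N * ?v e f = (\<Sum>h\<in>B. c h * ?v h f)"
          then show "(of_int N)\<^sup>2 * D (insert e (B - {g})) = (of_int (c g))\<^sup>2 * D B"
            unfolding D_def Suc by (intro Q_matrix_exchange) (auto simp: column_basis_def)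
        qed
        then have "D T * of_real ((t S)\<^sup>2) = D S * of_real ((t T)\<^sup>2)"
          by (simp add: t[OF S] t[OF T])
        from arg_cong[OF this, of Re] show ?thesis by simp
      qed
      have "measure (lower_matroidal_measure X k) {T} = max 0 (Re (D S)) / (t S)\<^sup>2 * (t T)\<^sup>2" if T: "k_base X k T" for T
      proof -
        have "Re (D T) = Re (D S) / (t S)\<^sup>2 * (t T)\<^sup>2"
          using proportional[OF T] \<open>t S > 0\<close> by (simp add: field_simps)
        then have "max 0 (Re (D T)) = max 0 (Re (D S)) / (t S)\<^sup>2 * (t T)\<^sup>2"
          by (cases "Re (D S) \<ge> 0") (simp_all add: max_def mult_le_0_iff divide_le_0_iff zero_le_mult_iff zero_le_divide_iff)
        then show ?thesis using measure_lower_matroidal[OF T] by (simp add: D_def)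
      qed
      then show ?thesis unfolding t_def by blast
    qed blast
  qed
qed

end
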